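(* Let $\lambda\in\mathbf{R}$, $L>0$, and let $\gamma:[0,L]\to\mathbf{R}^2$ be an arc-length parametrised $\lambda$-elastica with non-constant and monotone signed curvature. If $\gamma$ is not a subcritical wavelike elastica, then $\gamma$ is the unique minimiser of the modified bending energy $\mathsf{E}^\lambda$ in the set $\widetilde{\mathcal{A}}(\gamma)$.
   Context: For $L>0$, $W^{2,2}_{\mathrm{arc}}(0,L;\mathbf{R}^2)$ denotes the set of $\gamma\in W^{2,2}(0,L;\mathbf{R}^2)$ with $|\gamma'|\equiv 1$. The signed curvature $k$ is defined by $\gamma''=kN$, where $N$ is the counterclockwise rotation of $T=\gamma'$ by $\pi/2$. For such a curve, $\mathsf{B}[\gamma]=\int_0^L k^2\,ds$, $\mathsf{L}[\gamma]=L$, and $\mathsf{E}^\lambda[\gamma]=\mathsf{B}[\gamma]+\lambda\mathsf{L}[\gamma]$. A $\lambda$-elastica is a curve $\gamma\in W^{2,2}_{\mathrm{arc}}(0,L;\mathbf{R}^2)$ whose signed curvature satisfies $2k''+k^3-\lambda k=0$ in the distributional sense (this implies that $\gamma$ is smooth). $\widetilde{\mathcal{A}}(\gamma)$ is the set of all curves $\tilde\gamma\in W^{2,2}_{\mathrm{arc}}(0,\tilde L;\mathbf{R}^2)$, with arbitrary $\tilde L>0$, such that $\tilde\gamma(0)=\gamma(0)$, $\tilde\gamma(\tilde L)=\gamma(L)$, $\tilde\gamma'(0)=\gamma'(0)$, $\tilde\gamma'(\tilde L)=\gamma'(L)$. Elliptic functions (parameter $m\in(0,1)$ is the squared modulus):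 $F(x,m)=\int_0^x\frac{d\theta}{\sqrt{1-m\sin^2\theta}}$, $E(x,m)=\int_0^x\sqrt{1-m\sin^2\theta}\,d\theta$, $K(m)=F(\pi/2,m)$, $E(m)=E(\pi/2,m)$, $\operatorname{am}(\cdot,m)=F^{-1}(\cdot,m)$ on $\mathbf{R}$, $\operatorname{cn}(x,m)=\cos(\operatorname{am}(x,m))$. A wavelike elastica with parameter $m\in(0,1)$ is a curve that, up to the action of the similarity group of $\mathbf{R}^2$ and reparametrisation, is of the form $s\mapsto\gamma_w(s+s_0,m)$ for some $s_0\in\mathbf{R}$, where $\gamma_w(s,m)=\big(2E(\operatorname{am}(s,m),m)-s,\;-2\sqrt m\,\operatorname{cn}(s,m)\big)^\top$. It is called subcritical if $m<m_0$, where $m_0\in(0,1)$ is the unique root of the decreasing function $m\mapsto 2E(m)-K(m)$. *)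

theory Defs
  imports "HOL-Analysis.Analysis"
begin

section \<open>Sobolev spaces and distributions on an interval\<close>

definition test_function :: "real \<Rightarrow> (real \<Rightarrow> real) \<Rightarrow> bool" where
  "test_function L \<phi> \<longleftrightarrow>
     (\<forall>n x. (deriv ^^ n) \<phi> field_differentiable at x) \<and>
     (\<exists>a b. 0 < a \<and> b < L \<and> (\<forall>x. x \<notin> {a..b} \<longrightarrow> \<phi> x = 0))"

definition locally_integrable ::
  "real \<Rightarrow> (real \<Rightarrow> 'a::{banach, second_countable_topology}) \<Rightarrow> bool" where
  "locally_integrable L f \<longleftrightarrow>
     (\<forall>a b. 0 < a \<longrightarrow> b < L \<longrightarrow> integrable (lebesgue_on {a..b}) f)"

definition square_integrable ::
  "real \<Rightarrow> (real \<Rightarrow> 'a::{banach, second_countable_topology}) \<Rightarrow> bool" where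
  "square_integrable L f \<longleftrightarrow>
     f \<in> borel_measurable (lebesgue_on {0<..<L}) \<and>
     integrable (lebesgue_on {0<..<L}) (\<lambda>s. (norm (f s))\<^sup>2)"

definition weak_derivative ::
  "real \<Rightarrow> (real \<Rightarrow> 'a::{banach, second_countable_topology}) \<Rightarrow> (real \<Rightarrow> 'a) \<Rightarrow> bool" where
  "weak_derivative L f g \<longleftrightarrow>
     locally_integrable L f \<and> locally_integrable L g \<and>
     (\<forall>\<phi>. test_function L \<phi> \<longrightarrow>
        (\<integral>s. deriv \<phi> s *\<^sub>R f s \<partial>lebesgue_on {0<..<L}) =
        - (\<integral>s. \<phi> s *\<^sub>R g s \<partial>lebesgue_on {0<..<L}))"

definition W22 ::
  "real \<Rightarrow> (real \<Rightarrow> 'a::{banach, second_countable_topology}) set" where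
  "W22 L = {f. \<exists>f1 f2. weak_derivative L f f1 \<and> weak_derivative L f1 f2 \<and>
     square_integrable L f \<and> square_integrable L f1 \<and> square_integrable L f2}"

section \<open>Arc-length parametrised curves and their curvature\<close>

text \<open>A curve on \<open>[0,L]\<close> is a total function of which only the restriction to \<open>[0,L]\<close> matters;
  at the end points derivatives are one-sided.\<close>

definition tangent :: "real \<Rightarrow> (real \<Rightarrow> real^2) \<Rightarrow> real \<Rightarrow> real^2" where
  "tangent L \<gamma> s = vector_derivative \<gamma> (at s within {0..L})"

definition rot90 :: "real^2 \<Rightarrow> real^2" where
  "rot90 v = vector [- (v $ 2), v $ 1]"

text \<open>Every class in \<open>W\<^sup>2\<^sup>,\<^sup>2(0,L)\<close> has exactly one representative that is \<open>C\<^sup>1\<close> on \<open>[0,L]\<close>.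
  The curves considered are these representatives, so that the values of the curve and of its
  tangent at \<open>0\<close> and \<open>L\<close> are the traces.\<close>

definition W22_arc :: "real \<Rightarrow> (real \<Rightarrow> real^2) set" where
  "W22_arc L = {\<gamma> \<in> W22 L.
     (\<forall>s\<in>{0..L}. \<gamma> differentiable at s within {0..L}) \<and>
     continuous_on {0..L} (tangent L \<gamma>) \<and>
     (\<forall>s\<in>{0..L}. norm (tangent L \<gamma> s) = 1)}"

text \<open>The equation \<open>\<gamma>'' = k N\<close> for the weak second derivative; it determines \<open>k\<close> up to a null
  subset of \<open>(0,L)\<close>.\<close>

definition is_signed_curvature ::
  "real \<Rightarrow> (real \<Rightarrow> real^2) \<Rightarrow> (real \<Rightarrow> real) \<Rightarrow> bool" where
  "is_signed_curvature L \<gamma> k \<longleftrightarrow>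
     square_integrable L k \<and>
     weak_derivative L (tangent L \<gamma>) (\<lambda>s. k s *\<^sub>R rot90 (tangent L \<gamma> s))"

definition signed_curvature :: "real \<Rightarrow> (real \<Rightarrow> real^2) \<Rightarrow> real \<Rightarrow> real" where
  "signed_curvature L \<gamma> = (SOME k. is_signed_curvature L \<gamma> k)"

definition bending_energy :: "real \<Rightarrow> (real \<Rightarrow> real^2) \<Rightarrow> real" where
  "bending_energy L \<gamma> = (\<integral>s. (signed_curvature L \<gamma> s)\<^sup>2 \<partial>lebesgue_on {0<..<L})"

text \<open>A curve is passed as the pair \<open>(L, \<gamma>)\<close>; it is parametrised by arc length, so its length
  is \<open>L\<close>.\<close>

definition modified_energy :: "real \<Rightarrow> real \<times> (real \<Rightarrow> real^2) \<Rightarrow> real" where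
  "modified_energy lam = (\<lambda>(L, \<gamma>). bending_energy L \<gamma> + lam * L)"

text \<open>Local integrability of \<open>k\<^sup>3\<close> is what makes \<open>k\<^sup>3\<close> a distribution.\<close>

definition elastica :: "real \<Rightarrow> real \<Rightarrow> (real \<Rightarrow> real^2) \<Rightarrow> bool" where
  "elastica lam L \<gamma> \<longleftrightarrow>
     \<gamma> \<in> W22_arc L \<and>
     (\<exists>k. is_signed_curvature L \<gamma> k \<and> locally_integrable L (\<lambda>s. k s ^ 3) \<and>
       (\<forall>\<phi>. test_function L \<phi> \<longrightarrow>
          (\<integral>s. 2 * k s * (deriv ^^ 2) \<phi> s + (k s ^ 3 - lam * k s) * \<phi> s
             \<partial>lebesgue_on {0<..<L}) = 0))"

definition admissible :: "real \<Rightarrow> (real \<Rightarrow> real^2) \<Rightarrow> (real \<times> (real \<Rightarrow> real^2)) set" where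
  "admissible L \<gamma> = {(L', \<gamma>'). 0 < L' \<and> \<gamma>' \<in> W22_arc L' \<and>
     \<gamma>' 0 = \<gamma> 0 \<and> \<gamma>' L' = \<gamma> L \<and>
     tangent L' \<gamma>' 0 = tangent L \<gamma> 0 \<and> tangent L' \<gamma>' L' = tangent L \<gamma> L}"

section \<open>Elliptic functions and wavelike elasticae\<close>

definition ellF :: "real \<Rightarrow> real \<Rightarrow> real" where
  "ellF x m = (LBINT \<theta>=0..ereal x. 1 / sqrt (1 - m * (sin \<theta>)\<^sup>2))"

definition ellE :: "real \<Rightarrow> real \<Rightarrow> real" where
  "ellE x m = (LBINT \<theta>=0..ereal x. sqrt (1 - m * (sin \<theta>)\<^sup>2))"

definition complete_K :: "real \<Rightarrow> real" where
  "complete_K m = ellF (pi / 2) m"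

definition complete_E :: "real \<Rightarrow> real" where
  "complete_E m = ellE (pi / 2) m"

definition am :: "real \<Rightarrow> real \<Rightarrow> real" where
  "am x m = inv (\<lambda>y. ellF y m) x"

definition cn :: "real \<Rightarrow> real \<Rightarrow> real" where
  "cn x m = cos (am x m)"

definition wave_curve :: "real \<Rightarrow> real \<Rightarrow> real^2" where
  "wave_curve s m = vector [2 * ellE (am s m) m - s, - 2 * sqrt m * cn s m]"

definition similarity :: "(real^2 \<Rightarrow> real^2) \<Rightarrow> bool" where
  "similarity f \<longleftrightarrow>
     (\<exists>c A b. 0 < c \<and> orthogonal_transformation A \<and> (\<forall>x. f x = c *\<^sub>R A x + b))"

definition wavelike_elastica :: "real \<Rightarrow> real \<Rightarrow> (real \<Rightarrow> real^2) \<Rightarrow> bool" where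
  "wavelike_elastica m L \<gamma> \<longleftrightarrow> 0 < m \<and> m < 1 \<and>
     (\<exists>f s0 L' \<phi> \<psi>. similarity f \<and> 0 < L' \<and> homeomorphism {0..L} {0..L'} \<phi> \<psi> \<and>
       (\<forall>s\<in>{0..L}. \<gamma> s = f (wave_curve (\<phi> s + s0) m)))"

definition m0 :: real where
  "m0 = (THE m. 0 < m \<and> m < 1 \<and> 2 * complete_E m - complete_K m = 0)"

definition subcritical_wavelike :: "real \<Rightarrow> (real \<Rightarrow> real^2) \<Rightarrow> bool" where
  "subcritical_wavelike L \<gamma> \<longleftrightarrow> (\<exists>m. wavelike_elastica m L \<gamma> \<and> m < m0)"

end

theory Submission
  imports Defs "HOL-Computational_Algebra.Polynomial"
begin

text \<open>
  Along an elastica the vector \<open>P = (k\<^sup>2 - lam) T + 2 k' N\<close> is constant. Measuring the tangent angle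
  \<open>\<theta>\<close> from \<open>P\<close> and writing \<open>p = |P|\<close>, this says \<open>k\<^sup>2 = lam + p cos \<theta>\<close> and \<open>2 k' = - p sin \<theta>\<close>, so
  monotonicity of \<open>k\<close> confines \<open>\<theta>\<close> to half a turn. As the end points are fixed, minimising the energy
  means minimising \<open>\<integral> \<theta>'\<^sup>2 + lam + p cos \<theta>\<close>.

  If \<open>p \<le> lam\<close>, the potential is nonnegative, and completing the square
  (\<open>\<theta>'\<^sup>2 + f(\<theta>)\<^sup>2 \<ge> 2 |\<theta>'| f(\<theta>)\<close>) bounds the energy by its value at \<open>\<gamma>\<close>.

  If \<open>lam < p\<close>, then \<open>\<gamma>\<close> is an arc of a wavelike elastica of parameter \<open>m\<close>, and since it is not
  subcritical, \<open>2 E(m) - K(m) \<le> 0\<close>. Both curves are completed to a full half period between two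
  extrema of the curvature. A competitor whose angle has maximal modulus \<open>\<alpha>\<close> is estimated with the
  multiplier \<open>q\<close> for which \<open>lam + q cos\<close> vanishes at \<open>\<alpha>\<close>, instead of \<open>p\<close>; the resulting bound is a
  function of \<open>sin\<^sup>2(\<alpha>/2)\<close> that has a strict minimum at \<open>m\<close>, because \<open>2 E - K\<close> is decreasing and
  nonpositive at \<open>m\<close>. In the equality case the angle solves \<open>\<theta>' = \<plusminus> sqrt (lam + p cos \<theta>)\<close>, possibly
  resting at its maximal value; the prescribed displacement excludes the rest.
\<close>

text \<open>The multiplier is free because both curves have the same displacement along
  \<open>P\<close>: adding \<open>q\<close> times it shifts both energies equally. Completing the
  square needs a real square root of \<open>lam + q cos\<close> along the whole competitor. In the
  wavelike case \<open>q = p\<close> supplies one only while the competitor turns no further than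
  the completed half period, so the multiplier must depend on the competitor, and its turn must
  exceed a right angle. Here \<open>2 E - K \<le> 0\<close> enters for the first time: it says that
  the half period does not advance along \<open>P\<close>, whereas a competitor confined to angles
  of modulus at most pi/2 would advance. The sign enters again in the monotonicity of the bound. The
  end tangents fix the final angle only modulo full turns, so every estimate has to admit a
  competitor with additional winding \<open>n\<close>. A competitor that reaches the angle pi is
  handled with \<open>q = lam\<close>, the limit of the multipliers as the turn tends to pi. The
  displacement across \<open>P\<close> rules out the mirror image, which can share the energy and
  the displacement along \<open>P\<close>.\<close>

section \<open>Absolutely continuous functions\<close>

text \<open>Absolute continuity in Lebesgue's sense, carrying one representative \<open>v\<close> of
  the derivative that may be altered on null sets; no pointwise derivative is asserted. For
  \<open>b < a\<close> the predicate holds vacuously.\<close>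

definition ac_on :: "real \<Rightarrow> real \<Rightarrow> (real \<Rightarrow> 'a::euclidean_space) \<Rightarrow> (real \<Rightarrow> 'a) \<Rightarrow> bool" where
  "ac_on a b u v \<longleftrightarrow> v absolutely_integrable_on {a..b} \<and>
     (\<forall>t\<in>{a..b}. u t - u a = integral {a..t} v)"

lemma ac_on_integrable:
  assumes "ac_on a b u v" "a \<le> s" "t \<le> b"
  shows "v absolutely_integrable_on {s..t}" "v integrable_on {s..t}"
    "(\<lambda>x. norm (v x)) integrable_on {s..t}"
proof -
  show *: "v absolutely_integrable_on {s..t}"
    using assms absolutely_integrable_on_subinterval[of "{a..b}" v s t] by (auto simp: ac_on_def)
  then show "v integrable_on {s..t}" "(\<lambda>x. norm (v x)) integrable_on {s..t}"
    by (simp_all add: absolutely_integrable_on_def)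
qed

lemmas integral_split = Henstock_Kurzweil_Integration.integral_combine

lemma ac_on_increment:
  assumes "ac_on a b u v" "a \<le> s" "s \<le> t" "t \<le> b"
  shows "u t - u s = integral {s..t} v"
proof -
  have "integral {a..s} v + integral {s..t} v = integral {a..t} v"
    using assms by (intro integral_split ac_on_integrable) auto
  moreover have "u t - u a = integral {a..t} v" "u s - u a = integral {a..s} v"
    using assms by (auto simp: ac_on_def)
  ultimately show ?thesis by (simp add: algebra_simps)
qed

lemma ac_on_continuous:
  assumes "ac_on a b u v"
  shows "continuous_on {a..b} u"
proof -
  have "continuous_on {a..b} (\<lambda>t. u a + integral {a..t} v)"
    using ac_on_integrable[OF assms order_refl order_refl]
    by (intro continuous_intros indefinite_integral_continuous_1) auto
  then show ?thesis
    by (rule continuous_on_eq) (simp add: ac_on_increment[OF assms order_refl, symmetric])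
qed

lemma ac_on_subinterval:
  assumes "ac_on a b u v" "a \<le> c" "d \<le> b"
  shows "ac_on c d u v"
  unfolding ac_on_def
proof (intro conjI ballI)
  show "v absolutely_integrable_on {c..d}" using ac_on_integrable assms by blast
  fix t assume t: "t \<in> {c..d}"
  show "u t - u c = integral {c..t} v"
    using ac_on_increment[OF assms(1), of c t] assms t by auto
qed

lemma ac_onI_increment:
  assumes "v absolutely_integrable_on {a..b}"
    and "\<And>t. a \<le> t \<Longrightarrow> t \<le> b \<Longrightarrow> u t - u a = integral {a..t} v"
  shows "ac_on a b u v"
  using assms by (auto simp: ac_on_def)

lemma ac_on_cong:
  assumes "ac_on a b u v"
    and "\<And>t. a \<le> t \<Longrightarrow> t \<le> b \<Longrightarrow> u' t = u t" "\<And>t. a < t \<Longrightarrow> t < b \<Longrightarrow> v' t = v t"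
  shows "ac_on a b u' v'"
proof (cases "a \<le> b")
  case True
  have neg: "negligible {a,b}" by simp
  show ?thesis
  proof (rule ac_onI_increment)
    have "v absolutely_integrable_on {a..b}" using assms(1) by (simp add: ac_on_def)
    then show "v' absolutely_integrable_on {a..b}"
      by (rule absolutely_integrable_spike[OF _ neg]) (use assms(3) in auto)
    fix t assume t: "a \<le> t" "t \<le> b"
    have "integral {a..t} v' = integral {a..t} v"
      using assms t by (intro integral_spike[OF neg]) auto
    then show "u' t - u' a = integral {a..t} v'"
      using assms(2)[of t] assms(2)[of a] t ac_on_increment[OF assms(1) order_refl t] by auto
  qed
qed (auto simp: ac_on_def)

lemma ac_on_combine:
  assumes "ac_on a b u v" "ac_on b c u v" "a \<le> b" "b \<le> c"
  shows "ac_on a c u v"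
proof (rule ac_onI_increment)
  have "v absolutely_integrable_on {a..b} \<union> {b..c}"
    using assms by (intro absolutely_integrable_Un) (auto simp: ac_on_def)
  then show int: "v absolutely_integrable_on {a..c}"
    using assms by (simp add: ivl_disj_un_two_touch)
  fix t assume t: "a \<le> t" "t \<le> c"
  show "u t - u a = integral {a..t} v"
  proof (cases "t \<le> b")
    case True
    then show ?thesis using ac_on_increment[OF assms(1), of a t] t by auto
  next
    case False
    have "v integrable_on {a..t}"
      using absolutely_integrable_on_subinterval[OF int, of a t] t
      by (auto simp: absolutely_integrable_on_def)
    then have "integral {a..b} v + integral {b..t} v = integral {a..t} v"
      using False assms by (intro integral_split) auto
    then show ?thesis
      using ac_on_increment[OF assms(1), of a b] ac_on_increment[OF assms(2), of b t] False t assms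
      by (auto simp: algebra_simps)
  qed
qed

lemma ac_on_linear:
  assumes "ac_on a b u v" "bounded_linear h"
  shows "ac_on a b (\<lambda>t. h (u t)) (\<lambda>t. h (v t))"
proof (rule ac_onI_increment)
  interpret bounded_linear h by fact
  show "(\<lambda>t. h (v t)) absolutely_integrable_on {a..b}"
    using absolutely_integrable_linear[of "{a..b}" v h] assms by (auto simp: ac_on_def o_def)
  fix t assume t: "a \<le> t" "t \<le> b"
  have "integral {a..t} (\<lambda>t. h (v t)) = h (integral {a..t} v)"
    using integral_linear[OF ac_on_integrable(2)[OF assms(1) order_refl t(2)] assms(2)]
    by (simp add: o_def)
  then show "h (u t) - h (u a) = integral {a..t} (\<lambda>t. h (v t))"
    using ac_on_increment[OF assms(1) order_refl t] by (simp flip: diff)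
qed

lemma ac_on_add:
  assumes "ac_on a b u v" "ac_on a b u' v'"
  shows "ac_on a b (\<lambda>t. u t + u' t) (\<lambda>t. v t + v' t)"
proof (rule ac_onI_increment)
  show "(\<lambda>t. v t + v' t) absolutely_integrable_on {a..b}"
    using assms by (auto simp: ac_on_def)
  fix t assume t: "a \<le> t" "t \<le> b"
  have "integral {a..t} (\<lambda>t. v t + v' t) = integral {a..t} v + integral {a..t} v'"
    using assms t by (intro integral_add ac_on_integrable) auto
  then show "(u t + u' t) - (u a + u' a) = integral {a..t} (\<lambda>t. v t + v' t)"
    using ac_on_increment[OF assms(1) order_refl t] ac_on_increment[OF assms(2) order_refl t]
    by (simp add: algebra_simps)
qed

lemma ac_on_cmult:
  fixes u :: "real \<Rightarrow> real"
  assumes "ac_on a b u v"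
  shows "ac_on a b (\<lambda>t. c * u t) (\<lambda>t. c * v t)"
  using ac_on_linear[OF assms bounded_linear_mult_right[of c]] by simp

lemma ac_on_minus:
  assumes "ac_on a b u v"
  shows "ac_on a b (\<lambda>t. - u t) (\<lambda>t. - v t)"
  using ac_on_linear[OF assms bounded_linear_minus[OF bounded_linear_ident]] by simp

lemma ac_on_diff:
  assumes "ac_on a b u v" "ac_on a b u' v'"
  shows "ac_on a b (\<lambda>t. u t - u' t) (\<lambda>t. v t - v' t)"
  using ac_on_add[OF assms(1) ac_on_minus[OF assms(2)]] by simp

lemma ac_on_const: "ac_on a b (\<lambda>t. c) (\<lambda>t. 0)"
  by (rule ac_onI_increment) auto

lemma ac_on_add_const:
  assumes "ac_on a b u v"
  shows "ac_on a b (\<lambda>t. u t + c) v"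
  using ac_on_add[OF assms ac_on_const[of a b c]] by simp

lemma ac_on_ftc:
  assumes "\<And>t. a \<le> t \<Longrightarrow> t \<le> b \<Longrightarrow> (u has_vector_derivative v t) (at t within {a..b})"
    and "continuous_on {a..b} v"
  shows "ac_on a b u v"
proof (rule ac_onI_increment)
  show "v absolutely_integrable_on {a..b}"
    using assms by (intro absolutely_integrable_continuous_real)
  fix t assume t: "a \<le> t" "t \<le> b"
  have "(v has_integral u t - u a) {a..t}"
    using t by (intro fundamental_theorem_of_calculus)
      (auto intro!: has_vector_derivative_within_subset[OF assms(1)])
  then show "u t - u a = integral {a..t} v" by (simp add: integral_unique)
qed

lemma ac_on_DERIV:
  fixes u v :: "real \<Rightarrow> real"
  assumes "\<And>t. (u has_real_derivative v t) (at t)" "continuous_on {a..b} v"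
  shows "ac_on a b u v"
  by (rule ac_on_ftc[OF has_vector_derivative_at_within assms(2)])
     (simp add: assms(1) flip: has_real_derivative_iff_has_vector_derivative)

lemma has_integral_DERIV:
  fixes F f :: "real \<Rightarrow> real"
  assumes "a \<le> b" "\<And>x. a \<le> x \<Longrightarrow> x \<le> b \<Longrightarrow> (F has_real_derivative f x) (at x)"
  shows "(f has_integral F b - F a) {a..b}"
  by (rule fundamental_theorem_of_calculus[OF assms(1) has_vector_derivative_at_within])
     (simp add: assms(2) flip: has_real_derivative_iff_has_vector_derivative)

lemma absolutely_integrable_shift_real:
  fixes v :: "real \<Rightarrow> 'a::euclidean_space"
  assumes "v absolutely_integrable_on {a..b}"
  shows "(\<lambda>t. v (t - c)) absolutely_integrable_on {a+c..b+c}"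
proof -
  have *: "(\<lambda>t. f (t - c)) integrable_on {a+c..b+c}"
    if "f integrable_on {a..b}" for f :: "real \<Rightarrow> 'b::euclidean_space"
  proof (cases "a \<le> b")
    case True
    then show ?thesis
    using integrable_affinity[of f a b 1 "-c"] that by auto
  qed auto
  show ?thesis
    using assms *[of v] *[of "\<lambda>x. norm (v x)"] by (auto simp: absolutely_integrable_on_def)
qed

lemma integral_shift_real_interval:
  fixes v :: "real \<Rightarrow> 'a::euclidean_space"
  shows "integral {a+c..b+c} (\<lambda>t. v (t - c)) = integral {a..b} v"
  using integral_shift_real_ivl[of "a+c" "-c" "b+c" v] integral_shift_real_ivl[of "a" "-c" "b" v] by simp

lemma ac_on_shift:
  assumes "ac_on a b u v"
  shows "ac_on (a+c) (b+c) (\<lambda>t. u (t - c)) (\<lambda>t. v (t - c))"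
proof (rule ac_onI_increment)
  show "(\<lambda>t. v (t - c)) absolutely_integrable_on {a + c..b + c}"
    using assms by (intro absolutely_integrable_shift_real) (auto simp: ac_on_def)
  fix t assume t: "a+c \<le> t" "t \<le> b+c"
  show "u (t - c) - u (a + c - c) = integral {a + c..t} (\<lambda>t. v (t - c))"
    using ac_on_increment[OF assms order_refl, of "t-c"] t
      integral_shift_real_interval[of a c "t-c" v]
    by (auto simp: algebra_simps)
qed

lemma ac_on_reflect:
  assumes "ac_on a b u v"
  shows "ac_on (-b) (-a) (\<lambda>t. u (-t)) (\<lambda>t. - v (-t))"
proof (cases "a \<le> b")
  case True
  show ?thesis
  proof (rule ac_onI_increment)
    show "(\<lambda>t. - v (- t)) absolutely_integrable_on {-b..-a}"
      using absolutely_integrable_scaleR_left[of "{-b..-a}" "\<lambda>t. v (-t)" "-1"] assms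
      by (simp add: ac_on_def)
    fix t assume t: "-b \<le> t" "t \<le> -a"
    have "integral {-b..t} (\<lambda>t. v (- t)) = integral {-t..b} v"
      using Henstock_Kurzweil_Integration.integral_reflect_real[of b "-t" v] by simp
    then show "u (- t) - u (- (-b)) = integral {-b..t} (\<lambda>t. - v (- t))"
      using ac_on_increment[OF assms, of "-t" b] t by (auto simp: algebra_simps)
  qed
qed (auto simp: ac_on_def)

text \<open>Over a partition of small mesh the defects add up to at most epsilon times the integral
  of \<open>w\<close>, and epsilon is arbitrary. Applied to the defect of the chain rule, this takes
  the place of differentiation almost everywhere.\<close>

lemma additive_interval_function_zero:
  fixes D :: "real \<Rightarrow> real \<Rightarrow> 'a::real_normed_vector" and w :: "real \<Rightarrow> real"
  assumes ab: "a \<le> b"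
    and add: "\<And>r s t. a \<le> r \<Longrightarrow> r \<le> s \<Longrightarrow> s \<le> t \<Longrightarrow> t \<le> b \<Longrightarrow> D r t = D r s + D s t"
    and w: "w integrable_on {a..b}"
    and small: "\<And>\<epsilon>. \<epsilon> > 0 \<Longrightarrow> \<exists>\<delta>>0. \<forall>s t. a \<le> s \<longrightarrow> s \<le> t \<longrightarrow> t \<le> b \<longrightarrow> t - s \<le> \<delta> \<longrightarrow>
       norm (D s t) \<le> \<epsilon> * integral {s..t} w"
  shows "D a b = 0"
proof -
  have bound: "norm (D a b) \<le> \<epsilon> * integral {a..b} w" if eps: "\<epsilon> > 0" for \<epsilon>
  proof -
    obtain \<delta> where "\<delta> > 0" and \<delta>: "\<And>s t. a \<le> s \<Longrightarrow> s \<le> t \<Longrightarrow> t \<le> b \<Longrightarrow> t - s \<le> \<delta> \<Longrightarrow>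
       norm (D s t) \<le> \<epsilon> * integral {s..t} w"
      using small[OF eps] by metis
    have ind: "norm (D s b) \<le> \<epsilon> * integral {s..b} w" if "a \<le> s" "s \<le> b" "b - s \<le> real n * \<delta>" for n s
      using that
    proof (induction n arbitrary: s)
      case 0
      then show ?case using \<delta>[of s b] \<open>\<delta> > 0\<close> by auto
    next
      case (Suc n)
      define r where "r = min b (s + \<delta>)"
      have r: "s \<le> r" "r \<le> b" "r - s \<le> \<delta>" "b - r \<le> real n * \<delta>"
        using Suc.prems \<open>\<delta> > 0\<close> by (auto simp: r_def min_def algebra_simps)
      have "norm (D s b) \<le> norm (D s r) + norm (D r b)"
        using add[of s r b] Suc.prems r norm_triangle_ineq[of "D s r" "D r b"] by simp
      also have "\<dots> \<le> \<epsilon> * integral {s..r} w + \<epsilon> * integral {r..b} w"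
        using \<delta>[of s r] Suc.IH[of r] Suc.prems r by (intro add_mono) auto
      also have "\<dots> = \<epsilon> * integral {s..b} w"
        using integral_split[of s r b w]
          integrable_on_subinterval[OF w, of s b] r Suc.prems
        by (auto simp flip: distrib_left)
      finally show ?case .
    qed
    obtain n where "b - a \<le> real n * \<delta>"
      using \<open>\<delta> > 0\<close> by (meson ex_less_of_nat_mult less_imp_le)
    then show ?thesis using ind[of a n] ab by auto
  qed
  have "norm (D a b) \<le> 0"
  proof (rule field_le_epsilon)
    fix e :: real assume "e > 0"
    let ?I = "\<bar>integral {a..b} w\<bar> + 1"
    have "norm (D a b) \<le> e / ?I * integral {a..b} w"
      using \<open>e > 0\<close> by (intro bound) auto
    also have "\<dots> \<le> e / ?I * ?I"
      using \<open>e > 0\<close> by (intro mult_left_mono) auto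
    also have "\<dots> = e" by (simp add: add_nonneg_eq_0_iff)
    finally show "norm (D a b) \<le> 0 + e" by simp
  qed
  then show ?thesis by simp
qed

lemma absolutely_integrable_continuous_mult:
  fixes f g :: "real \<Rightarrow> real"
  assumes "continuous_on {a..b} f" "g absolutely_integrable_on {a..b}"
  shows "(\<lambda>x. f x * g x) absolutely_integrable_on {a..b}"
proof (rule absolutely_integrable_bounded_measurable_product_real)
  show "bounded (f ` {a..b})"
    using assms(1) by (intro compact_imp_bounded compact_continuous_image) auto
  show "f \<in> borel_measurable (lebesgue_on {a..b})"
    using assms(1) by (intro continuous_imp_measurable_on_sets_lebesgue) auto
qed (use assms in auto)

text \<open>On a short interval the mean value theorem for \<open>H\<close> and the intermediate
  value theorem for \<open>u\<close> give \<open>H (u t) - H (u s) = w (u r) * (u t - u s)\<close>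
  with \<open>r\<close> between \<open>s\<close> and \<open>t\<close>. Uniform continuity of
  \<open>w\<close> along \<open>u\<close> then bounds the defect \<open>D\<close> by epsilon times
  the integral of \<open>\<bar>v\<bar>\<close>.\<close>

lemma ac_on_chain:
  fixes u v H w :: "real \<Rightarrow> real"
  assumes uv: "ac_on a b u v" and H: "\<And>x. (H has_real_derivative w x) (at x)"
    and w: "continuous_on UNIV w"
  shows "ac_on a b (\<lambda>t. H (u t)) (\<lambda>t. w (u t) * v t)"
proof -
  have u: "continuous_on {a..b} u" using ac_on_continuous[OF uv] .
  have wu: "continuous_on {a..b} (\<lambda>t. w (u t))"
    using continuous_on_compose2[OF w u] by auto
  have ai: "(\<lambda>t. w (u t) * v t) absolutely_integrable_on {a..b}"
    using uv by (intro absolutely_integrable_continuous_mult wu) (auto simp: ac_on_def)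
  have int: "(\<lambda>t. w (u t) * v t) integrable_on {s..t}" if "a \<le> s" "t \<le> b" for s t
    using absolutely_integrable_on_subinterval[OF ai, of s t] that
    by (auto simp: absolutely_integrable_on_def)
  define D where "D s t = H (u t) - H (u s) - integral {s..t} (\<lambda>t. w (u t) * v t)" for s t
  have D0: "D a c = 0" if c: "a \<le> c" "c \<le> b" for c
  proof (rule additive_interval_function_zero[where w = "\<lambda>x. \<bar>v x\<bar>" and D = D])
    show "D r t = D r s + D s t" if "a \<le> r" "r \<le> s" "s \<le> t" "t \<le> c" for r s t
      using integral_split[of r s t "\<lambda>t. w (u t) * v t"]
        int[of r t] that c by (auto simp: D_def algebra_simps)
    show "(\<lambda>x. \<bar>v x\<bar>) integrable_on {a..c}"
      using ac_on_integrable(3)[OF uv, of a c] c by simp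
    fix \<epsilon> :: real assume "\<epsilon> > 0"
    have "uniformly_continuous_on {a..b} (\<lambda>t. w (u t))"
      by (intro compact_uniformly_continuous wu) auto
    then obtain \<delta> where "\<delta> > 0" and \<delta>: "\<And>x y. x \<in> {a..b} \<Longrightarrow> y \<in> {a..b} \<Longrightarrow> dist x y < \<delta> \<Longrightarrow>
        dist (w (u x)) (w (u y)) < \<epsilon>"
      unfolding uniformly_continuous_on_def using \<open>\<epsilon> > 0\<close> by metis
    show "\<exists>\<delta>>0. \<forall>s t. a \<le> s \<longrightarrow> s \<le> t \<longrightarrow> t \<le> c \<longrightarrow> t - s \<le> \<delta> \<longrightarrow>
        norm (D s t) \<le> \<epsilon> * integral {s..t} (\<lambda>x. \<bar>v x\<bar>)"
    proof (intro exI[of _ "\<delta>/2"] conjI allI impI)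
      fix s t assume st: "a \<le> s" "s \<le> t" "t \<le> c" "t - s \<le> \<delta>/2"
      have us: "continuous_on {s..t} u"
        using u by (rule continuous_on_subset) (use st c in auto)
      obtain r where r: "s \<le> r" "r \<le> t" "H (u t) - H (u s) = w (u r) * (u t - u s)"
      proof (cases "u s = u t")
        case True
        then show ?thesis using that[of s] st by auto
      next
        case False
        then consider "u s < u t" | "u t < u s" by linarith
        then show ?thesis
        proof cases
          case 1
          obtain z where "u s < z" "z < u t" "H (u t) - H (u s) = (u t - u s) * w z"
            using MVT2[of "u s" "u t" H w] 1 H by auto
          moreover obtain r where "s \<le> r" "r \<le> t" "u r = z"
            using IVT'[of u s z t] us st calculation by auto
          ultimately show ?thesis using that[of r] by (auto simp: algebra_simps)
        next
          case 2
          obtain z where z: "u t < z" "z < u s" "H (u s) - H (u t) = (u s - u t) * w z"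
            using MVT2[of "u t" "u s" H w] 2 H by auto
          moreover obtain r where "s \<le> r" "r \<le> t" "u r = z"
            using IVT2'[of u t z s] us st calculation by auto
          ultimately show ?thesis using that[of r] by (auto simp: algebra_simps)
        qed
      qed
      have vi: "v integrable_on {s..t}" "(\<lambda>x. norm (v x)) integrable_on {s..t}"
        using ac_on_integrable[OF uv, of s t] st c by auto
      have "D s t = integral {s..t} (\<lambda>x. w (u r) * v x) - integral {s..t} (\<lambda>x. w (u x) * v x)"
        using r ac_on_increment[OF uv, of s t] st c by (simp add: D_def)
      also have "\<dots> = integral {s..t} (\<lambda>x. w (u r) * v x - w (u x) * v x)"
        using vi int[of s t] st c by (intro integral_diff[symmetric] integrable_on_mult_right) auto
      finally have "norm (D s t) = norm (integral {s..t} (\<lambda>x. w (u r) * v x - w (u x) * v x))" by simp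
      also have "\<dots> \<le> integral {s..t} (\<lambda>x. \<epsilon> * \<bar>v x\<bar>)"
      proof (rule integral_norm_bound_integral)
        show "(\<lambda>x. w (u r) * v x - w (u x) * v x) integrable_on {s..t}"
          using vi int[of s t] st c by (intro integrable_diff integrable_on_mult_right) auto
        show "(\<lambda>x. \<epsilon> * \<bar>v x\<bar>) integrable_on {s..t}"
          using vi by (intro integrable_on_mult_right) auto
        fix x assume x: "x \<in> {s..t}"
        have "\<bar>w (u r) - w (u x)\<bar> < \<epsilon>"
          using \<delta>[of r x] x r st c \<open>\<delta> > 0\<close> by (auto simp: dist_real_def)
        then show "norm (w (u r) * v x - w (u x) * v x) \<le> \<epsilon> * \<bar>v x\<bar>"
          by (simp add: abs_mult mult_right_mono flip: left_diff_distrib)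
      qed
      finally show "norm (D s t) \<le> \<epsilon> * integral {s..t} (\<lambda>x. \<bar>v x\<bar>)" by simp
    qed (use \<open>\<delta> > 0\<close> in auto)
  qed (use c in auto)
  show ?thesis
    by (rule ac_onI_increment[OF ai]) (use D0 in \<open>auto simp: D_def\<close>)
qed

text \<open>By polarisation, \<open>4 u v = (u + v)\<^sup>2 - (u - v)\<^sup>2\<close>, it is enough
  to differentiate squares.\<close>

lemma ac_on_mult:
  fixes u v u' v' :: "real \<Rightarrow> real"
  assumes "ac_on a b u u'" "ac_on a b v v'"
  shows "ac_on a b (\<lambda>t. u t * v t) (\<lambda>t. u' t * v t + u t * v' t)"
proof -
  have sq: "ac_on a b (\<lambda>t. (f t)\<^sup>2) (\<lambda>t. (2 * f t) * g t)" if "ac_on a b f g" for f g :: "real \<Rightarrow> real"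
    by (rule ac_on_chain[OF that]) (auto intro!: derivative_eq_intros continuous_intros)
  have "ac_on a b (\<lambda>t. (1/4) * ((u t + v t)\<^sup>2 - (u t - v t)\<^sup>2))
      (\<lambda>t. (1/4) * (2 * (u t + v t) * (u' t + v' t) - 2 * (u t - v t) * (u' t - v' t)))"
    by (intro ac_on_cmult ac_on_diff sq ac_on_add assms)
  then show ?thesis
    by (rule ac_on_cong) (auto simp: power2_eq_square algebra_simps)
qed

text \<open>By Lebesgue's differentiation theorem the right-sided averages of \<open>v\<close>,
  extended by zero, converge to \<open>v\<close> off a null set, and those over intervals inside
  \<open>{a..b}\<close> vanish. The end point \<open>b\<close> joins the null set, as no such
  interval lies to its right.\<close>

lemma negligible_of_integral_zero:
  fixes v :: "real \<Rightarrow> 'a::euclidean_space"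
  assumes v: "v absolutely_integrable_on {a..b}" and zero: "\<And>t. a \<le> t \<Longrightarrow> t \<le> b \<Longrightarrow> integral {a..t} v = 0"
  shows "negligible {x \<in> {a..b}. v x \<noteq> 0}"
proof -
  define f where "f x = (if x \<in> {a..b} then v x else 0)" for x
  have "f absolutely_integrable_on UNIV"
    unfolding f_def using v absolutely_integrable_restrict_UNIV by blast
  then have f_int: "f integrable_on cbox c d" for c d
    by (meson absolutely_integrable_on_def integrable_on_subcbox top_greatest)
  have z: "integral {s..t} v = 0" if "a \<le> s" "s \<le> t" "t \<le> b" for s t
    using ac_on_increment[of a b "\<lambda>t. integral {a..t} v" v s t] that v zero
    by (auto simp: ac_on_def)
  obtain N where N: "negligible N"
    "\<And>x e. \<lbrakk>x \<notin> N; 0 < e\<rbrakk> \<Longrightarrow> \<exists>d>0. \<forall>h. 0 < h \<and> h < d \<longrightarrow>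
        norm (integral (cbox x (x + h *\<^sub>R One)) f /\<^sub>R h ^ DIM(real) - f x) < e"
    using integrable_ccontinuous_explicit[of f] f_int by blast
  have "v x = 0" if x: "x \<in> {a..b}" "x \<notin> N" "x \<noteq> b" for x
  proof (rule ccontr)
    assume "v x \<noteq> 0"
    then obtain d where d: "d > 0" "\<And>h. 0 < h \<Longrightarrow> h < d \<Longrightarrow>
        norm (integral (cbox x (x + h *\<^sub>R One)) f /\<^sub>R h ^ DIM(real) - f x) < norm (v x)"
      using N(2)[of x "norm (v x)"] x by auto
    define h where "h = min (d/2) (b - x)"
    have h: "0 < h" "h < d" "x + h \<le> b" using d x by (auto simp: h_def)
    have "integral {x..x+h} f = integral {x..x+h} v"
      using h x by (intro integral_cong) (auto simp: f_def)
    also have "\<dots> = 0" using z[of x "x+h"] h x by auto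
    finally show False using d(2)[OF h(1,2)] x by (simp add: f_def)
  qed
  then have "{x \<in> {a..b}. v x \<noteq> 0} \<subseteq> insert b N" by auto
  then show ?thesis using N(1) by (meson negligible_insert negligible_subset)
qed

section \<open>Elliptic integrals\<close>

text \<open>Legendre's Delta; at \<open>x = am u m\<close> it is Jacobi's dn.\<close>

definition ellR :: "real \<Rightarrow> real \<Rightarrow> real" where
  "ellR m x = sqrt (1 - m * (sin x)\<^sup>2)"

lemma ellR_radicand_pos:
  fixes m x :: real
  assumes "0 < m" "m < 1"
  shows "0 < 1 - m * (sin x)\<^sup>2"
proof -
  have "m * (sin x)\<^sup>2 \<le> m * 1"
    using assms sin_squared_eq[of x] by (intro mult_left_mono) auto
  then show ?thesis using assms by linarith
qed

lemma ellR_bounds: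
  assumes "0 < m" "m < 1"
  shows "0 < ellR m x" "ellR m x \<le> 1" "(ellR m x)\<^sup>2 = 1 - m * (sin x)\<^sup>2"
  using ellR_radicand_pos[OF assms, of x] assms by (auto simp: ellR_def)

lemma continuous_on_ellR [continuous_intros]:
  fixes f :: "'a::t2_space \<Rightarrow> real"
  assumes "continuous_on S f"
  shows "continuous_on S (\<lambda>x. ellR m (f x))"
  unfolding ellR_def using assms by (auto intro!: continuous_intros)

lemma DERIV_interval_integral:
  fixes f :: "real \<Rightarrow> real"
  assumes "continuous_on UNIV f"
  shows "((\<lambda>u. LBINT y=0..ereal u. f y) has_real_derivative f x) (at x)"
proof -
  \<comment> \<open>The interval contains 0 and has \<open>x\<close> in its interior, so the
    derivative within it is a two-sided one.\<close>
  define M where "M = \<bar>x\<bar> + 1"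
  have "((\<lambda>u. LBINT y=ereal 0..ereal u. f y) has_vector_derivative f x) (at x within {-M..M})"
    by (rule interval_integral_FTC2) (auto simp: M_def intro: continuous_on_subset[OF assms])
  moreover have "at x within {-M..M} = at x"
    by (rule at_within_interior) (auto simp: M_def)
  ultimately show ?thesis
    by (simp add: has_real_derivative_iff_has_vector_derivative zero_ereal_def)
qed

lemma DERIV_ellF:
  assumes "0 < m" "m < 1"
  shows "((\<lambda>x. ellF x m) has_real_derivative 1 / ellR m x) (at x)"
  unfolding ellF_def ellR_def
  by (rule DERIV_interval_integral)
     (use ellR_radicand_pos[OF assms] in \<open>auto intro!: continuous_intros simp: less_imp_neq[symmetric]\<close>)

lemma DERIV_ellE:
  shows "((\<lambda>x. ellE x m) has_real_derivative ellR m x) (at x)"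
  unfolding ellE_def ellR_def by (rule DERIV_interval_integral) (auto intro!: continuous_intros)

lemma ellF_0 [simp]: "ellF 0 m = 0" and ellE_0 [simp]: "ellE 0 m = 0"
  unfolding ellF_def ellE_def by (simp_all flip: zero_ereal_def)

section \<open>The amplitude as inverse of the elliptic integral of the first kind\<close>

context
  fixes m :: real
  assumes m: "0 < m" "m < 1"
begin

text \<open>The integrand of \<open>ellF\<close> is at least 1. Injectivity, surjectivity and the
  Lipschitz bound for the inverse \<open>am\<close> rest on this inequality.\<close>

lemma ellF_expanding:
  assumes "x \<le> y"
  shows "y - x \<le> ellF y m - ellF x m"
proof -
  have "ellF x m - x \<le> ellF y m - y"
  proof (rule DERIV_nonneg_imp_nondecreasing[OF assms])
    fix z
    have "0 \<le> 1 / ellR m z - 1" using ellR_bounds[OF m, of z] by simp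
    moreover have "((\<lambda>x. ellF x m - x) has_real_derivative 1 / ellR m z - 1) (at z)"
      by (rule derivative_eq_intros DERIV_ellF[OF m] refl | simp)+
    ultimately show "\<exists>d. ((\<lambda>x. ellF x m - x) has_real_derivative d) (at z) \<and> 0 \<le> d" by blast
  qed
  then show ?thesis by simp
qed

lemma ellF_inj: "inj (\<lambda>x. ellF x m)"
proof (rule injI)
  fix x y assume "ellF x m = ellF y m"
  then show "x = y" using ellF_expanding[of x y] ellF_expanding[of y x] by linarith
qed

lemma ellF_surj: "surj (\<lambda>x. ellF x m)"
proof -
  have cont: "continuous_on UNIV (\<lambda>x. ellF x m)"
    using DERIV_ellF[OF m] by (meson DERIV_continuous_on has_field_derivative_at_within)
  have "\<exists>x. ellF x m = y" for y
  proof -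
    have "ellF (-\<bar>y\<bar>) m \<le> y" "y \<le> ellF \<bar>y\<bar> m"
      using ellF_expanding[of 0 "\<bar>y\<bar>"] ellF_expanding[of "-\<bar>y\<bar>" 0] by auto
    then show ?thesis
      using IVT'[of "\<lambda>x. ellF x m" "-\<bar>y\<bar>" y "\<bar>y\<bar>"] continuous_on_subset[OF cont] by auto
  qed
  then show ?thesis by (metis surjI)
qed

lemma ellF_am [simp]: "ellF (am x m) m = x"
  unfolding am_def using surj_f_inv_f[OF ellF_surj] by simp

lemma am_ellF [simp]: "am (ellF x m) m = x"
  unfolding am_def using inv_f_f[OF ellF_inj] by simp

lemma am_nonexpanding: "\<bar>am x m - am y m\<bar> \<le> \<bar>x - y\<bar>"
  using ellF_expanding[of "am x m" "am y m"] ellF_expanding[of "am y m" "am x m"] unfolding ellF_am by linarith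

lemma DERIV_am: "((\<lambda>x. am x m) has_real_derivative ellR m (am x m)) (at x)"
proof -
  have "isCont (\<lambda>x. am x m) x"
    unfolding continuous_at_eps_delta
    using am_nonexpanding by (metis dist_real_def order_le_less_trans)
  then have "((\<lambda>x. am x m) has_real_derivative inverse (1 / ellR m (am x m))) (at x)"
    using ellR_bounds[OF m, of "am x m"]
    by (intro DERIV_inverse_function[OF DERIV_ellF[OF m], of _ x "x - 1" "x + 1"]) auto
  then show ?thesis by simp
qed

lemma am_strict_mono: "x < y \<Longrightarrow> am x m < am y m"
  using ellF_expanding[of "am y m" "am x m"] by (cases "am x m < am y m") auto

lemma am_0 [simp]: "am 0 m = 0"
  using am_ellF[of 0] by simp

lemma ellF_reflect: "ellF (pi - x) m + ellF x m = 2 * complete_K m"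
proof -
  have "ellF (pi - x) m + ellF x m = ellF (pi - pi/2) m + ellF (pi/2) m"
  proof (rule DERIV_isconst_all[of "\<lambda>x. ellF (pi - x) m + ellF x m"], rule allI)
    fix x :: real
    have "((\<lambda>x. ellF (pi - x) m + ellF x m) has_real_derivative
        1 / ellR m (pi - x) * (-1) + 1 / ellR m x) (at x)"
      by (rule derivative_eq_intros DERIV_chain2[OF DERIV_ellF[OF m]] DERIV_ellF[OF m] refl | simp)+
    then show "((\<lambda>x. ellF (pi - x) m + ellF x m) has_real_derivative 0) (at x)"
      by (simp add: ellR_def)
  qed
  then show ?thesis by (simp add: complete_K_def)
qed

lemma ellF_pi: "ellF pi m = 2 * complete_K m"
  using ellF_reflect[of 0] by simp

lemma ellE_pi: "ellE pi m = 2 * complete_E m"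
proof -
  have "ellE (pi - pi) m + ellE pi m = ellE (pi - pi/2) m + ellE (pi/2) m"
  proof (rule DERIV_isconst_all[of "\<lambda>x. ellE (pi - x) m + ellE x m"], rule allI)
    fix x :: real
    have "((\<lambda>x. ellE (pi - x) m + ellE x m) has_real_derivative
        ellR m (pi - x) * (-1) + ellR m x) (at x)"
      by (rule derivative_eq_intros DERIV_chain2[OF DERIV_ellE] DERIV_ellE refl | simp)+
    then show "((\<lambda>x. ellE (pi - x) m + ellE x m) has_real_derivative 0) (at x)"
      by (simp add: ellR_def)
  qed
  then show ?thesis by (simp add: complete_E_def)
qed

lemma am_K: "am (complete_K m) m = pi / 2" and am_2K: "am (2 * complete_K m) m = pi"
  using am_ellF[of "pi/2"] am_ellF[of pi] ellF_pi by (simp_all add: complete_K_def)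

lemma complete_K_pos: "0 < complete_K m"
  using ellF_expanding[of 0 "pi/2"] pi_gt_zero unfolding complete_K_def ellF_0 by linarith

lemma complete_K_has_integral: "((\<lambda>x. 1 / ellR m x) has_integral complete_K m) {0..pi/2}"
  using has_integral_DERIV[OF _ DERIV_ellF[OF m], of 0 "pi/2"] by (simp add: complete_K_def)

lemma complete_E_has_integral: "((\<lambda>x. ellR m x) has_integral complete_E m) {0..pi/2}"
  using has_integral_DERIV[OF _ DERIV_ellE, of 0 "pi/2"] by (simp add: complete_E_def)

end

section \<open>The functions 2 E - K and E - (1 - m) K\<close>

definition ellW :: "real \<Rightarrow> real" where
  "ellW m = 2 * complete_E m - complete_K m"

text \<open>This is \<open>E - (1 - m) K\<close>, see \<open>ellH_eq\<close>, in a form suited to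
  differentiation under the integral sign. On a half period of scale \<open>c\<close> the squared
  curvature integrates to \<open>8 c ellH m\<close>, and the displacement along \<open>P\<close> is
  \<open>2 ellW m / c\<close>.\<close>

definition ellH :: "real \<Rightarrow> real" where
  "ellH m = integral {0..pi/2} (\<lambda>x. m * (cos x)\<^sup>2 / ellR m x)"

lemma ellW_has_integral:
  assumes "0 < m" "m < 1"
  shows "((\<lambda>x. 2 * ellR m x - 1 / ellR m x) has_integral ellW m) {0..pi/2}"
  unfolding ellW_def
  by (intro has_integral_diff has_integral_mult_right complete_E_has_integral
      complete_K_has_integral assms)

lemma ellH_eq:
  assumes "0 < m" "m < 1"
  shows "ellH m = complete_E m - (1 - m) * complete_K m"
proof -
  have "((\<lambda>x. ellR m x - (1 - m) * (1 / ellR m x)) has_integral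
      complete_E m - (1 - m) * complete_K m) {0..pi/2}"
    by (intro has_integral_diff has_integral_mult_right complete_E_has_integral
      complete_K_has_integral assms)
  moreover have "ellR m x - (1 - m) * (1 / ellR m x) = m * (cos x)\<^sup>2 / ellR m x" for x
    using ellR_bounds[OF assms, of x]
    by (simp add: field_simps cos_squared_eq flip: power2_eq_square)
  ultimately show ?thesis unfolding ellH_def by (simp add: integral_unique)
qed

lemma continuous_on_ellR_inverse:
  assumes "0 < m" "m < 1"
  shows "continuous_on S (\<lambda>x. 1 / ellR m x)"
  using ellR_bounds(1)[OF assms] by (intro continuous_intros) (auto simp: less_imp_neq[symmetric])

lemma ellW_strict_antimono:
  assumes "0 < m" "m < m'" "m' < 1"
  shows "ellW m' < ellW m"
proof -
  have m: "0 < m" "m < 1" and m': "0 < m'" "m' < 1" using assms by auto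
  have "integral {0..pi/2} (\<lambda>x. 2 * ellR m' x - 1 / ellR m' x)
      < integral {0..pi/2} (\<lambda>x. 2 * ellR m x - 1 / ellR m x)"
  proof (rule integral_less_real)
    show "{0<..<pi/2} \<noteq> {}" unfolding greaterThanLessThan_empty_iff using pi_half_gt_zero by linarith
    fix x assume x: "x \<in> {0<..<pi/2}"
    then have "0 < sin x" by (intro sin_gt_zero) auto
    then have "ellR m' x < ellR m x" unfolding ellR_def using assms by simp
    moreover from this have "1 / ellR m x < 1 / ellR m' x"
      using ellR_bounds(1)[OF m', of x] by (simp add: frac_less2)
    ultimately show "2 * ellR m' x - 1 / ellR m' x < 2 * ellR m x - 1 / ellR m x" by linarith
  qed (auto intro!: continuous_intros continuous_on_ellR_inverse m m' continuous_on_ellR)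
  then show ?thesis
    using ellW_has_integral[OF m] ellW_has_integral[OF m'] by (simp add: integral_unique)
qed

lemma continuous_on_ellR2:
  assumes "\<And>m. m \<in> U \<Longrightarrow> 0 < m \<and> m < 1"
  shows "continuous_on (U \<times> S) (\<lambda>(m, x). ellR m x)" "continuous_on (U \<times> S) (\<lambda>(m, x). 1 / ellR m x)"
proof -
  show *: "continuous_on (U \<times> S) (\<lambda>(m, x). ellR m x)"
    unfolding ellR_def split_beta by (intro continuous_intros)
  show "continuous_on (U \<times> S) (\<lambda>(m, x). 1 / ellR m x)"
    unfolding split_beta
    using * assms ellR_bounds(1) by (intro continuous_intros) (auto simp: split_beta less_imp_neq[symmetric])
qed

lemma continuous_on_ellW: "continuous_on {0<..<1} ellW"
proof -
  have "continuous_on {0<..<1} (\<lambda>m. integral (cbox 0 (pi/2)) (\<lambda>x. 2 * ellR m x - 1 / ellR m x))"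
  proof (rule integral_continuous_on_param)
    show "continuous_on ({0<..<1} \<times> cbox 0 (pi / 2)) (\<lambda>(m, x). 2 * ellR m x - 1 / ellR m x)"
      unfolding split_beta
      by (intro continuous_on_diff continuous_on_mult continuous_on_const
          continuous_on_ellR2[unfolded split_beta]) auto
  qed
  then show ?thesis
    by (rule continuous_on_eq) (use ellW_has_integral in \<open>auto simp: integral_unique\<close>)
qed

text \<open>At \<open>m = 1/2\<close> the integrand is the square of cos divided by Delta. With
  monotonicity this places every \<open>m\<close> with \<open>ellW m \<le> 0\<close> above 1/2,
  which makes \<open>lam\<close> positive in the wavelike case.\<close>

lemma ellW_half_pos: "0 < ellW (1/2)"
proof -
  have m: "0 < (1/2::real)" "(1/2::real) < 1" by auto
  have "integral {0..pi/2} (\<lambda>x. 0) < integral {0..pi/2} (\<lambda>x. 2 * ellR (1/2) x - 1 / ellR (1/2) x)"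
  proof (rule integral_less_real)
    show "{0<..<pi/2} \<noteq> {}" unfolding greaterThanLessThan_empty_iff using pi_half_gt_zero by linarith
    fix x assume x: "x \<in> {0<..<pi/2}"
    then have "0 < cos x" by (intro cos_gt_zero) auto
    then have "1 < 2 * (ellR (1/2) x)\<^sup>2"
      using ellR_bounds(3)[OF m, of x] by (simp add: sin_squared_eq)
    then show "0 < 2 * ellR (1/2) x - 1 / ellR (1/2) x"
      using ellR_bounds(1)[OF m, of x] by (simp add: field_simps power2_eq_square)
  qed (auto intro!: continuous_intros continuous_on_ellR_inverse m continuous_on_ellR)
  then show ?thesis using ellW_has_integral[OF m] by (simp add: integral_unique)
qed

text \<open>K diverges logarithmically at 1 while E stays below pi/2. For
  \<open>m = 1 - \<epsilon>\<^sup>2\<close>, Delta is at most \<open>cos x + \<epsilon>\<close>,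
  hence at most \<open>pi/2 - x + \<epsilon>\<close>, whose reciprocal integrates to a
  logarithm.\<close>

lemma ellW_neg_near_1: "\<exists>m. 1/2 < m \<and> m < 1 \<and> ellW m < 0"
proof -
  \<comment> \<open>The exponent makes K exceed 4, which is larger than pi, an upper bound for 2
    E.\<close>
  define \<epsilon> :: real where "\<epsilon> = exp (-4)"
  have \<epsilon>: "0 < \<epsilon>" "\<epsilon> < 1/2"
  proof -
    have "exp (4::real) \<ge> 1 + 4" by (rule exp_ge_add_one_self)
    then show "\<epsilon> < 1/2" unfolding \<epsilon>_def by (simp add: exp_minus field_simps)
  qed (simp add: \<epsilon>_def)
  define m where "m = 1 - \<epsilon>\<^sup>2"
  have "\<epsilon>\<^sup>2 < 1/2"
    using \<epsilon> by (simp add: power2_eq_square) (use mult_strict_mono[of \<epsilon> "1/2" \<epsilon> 1] in auto)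
  then have m: "0 < m" "m < 1" "1/2 < m" using \<epsilon> by (auto simp: m_def)
  define F where "F x = - ln (pi/2 - x + \<epsilon>)" for x
  have "((\<lambda>x. 1 / (pi/2 - x + \<epsilon>)) has_integral (F (pi/2) - F 0)) {0..pi/2}"
    by (rule has_integral_DERIV) (use \<epsilon> in \<open>auto intro!: derivative_eq_intros simp: F_def divide_simps\<close>)
  then have "F (pi/2) - F 0 \<le> complete_K m"
  proof (rule has_integral_le[OF _ complete_K_has_integral[OF m(1,2)]])
    fix x assume x: "x \<in> {0..pi/2}"
    have c: "0 \<le> cos x" using x by (intro cos_ge_zero) auto
    have "cos x = sin (pi/2 - x)" by (simp add: sin_diff)
    also have "\<dots> \<le> pi/2 - x" using x by (intro sin_x_le_x) auto
    finally have "cos x \<le> pi/2 - x" .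
    have "(sin x)\<^sup>2 \<le> 1" by (simp add: abs_square_le_1)
    then have "1 - m * (sin x)\<^sup>2 \<le> (cos x)\<^sup>2 + \<epsilon>\<^sup>2"
      using mult_left_mono[of "(sin x)\<^sup>2" 1 "\<epsilon>\<^sup>2"] by (simp add: m_def cos_squared_eq algebra_simps)
    also have "\<dots> \<le> (cos x + \<epsilon>)\<^sup>2" using c \<epsilon> by (simp add: power2_sum)
    finally have "ellR m x \<le> cos x + \<epsilon>"
      unfolding ellR_def using c \<epsilon> by (intro real_le_lsqrt) auto
    also have "\<dots> \<le> pi/2 - x + \<epsilon>" using \<open>cos x \<le> pi/2 - x\<close> by simp
    finally show "1 / (pi/2 - x + \<epsilon>) \<le> 1 / ellR m x"
      using ellR_bounds(1)[OF m(1,2), of x] by (simp add: frac_le)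
  qed
  moreover have "F (pi/2) - F 0 > 4"
  proof -
    have "0 < ln (pi/2 + \<epsilon>)" using pi_gt3 \<epsilon> by (intro ln_gt_zero) auto
    then show ?thesis by (simp add: F_def \<epsilon>_def)
  qed
  moreover have "complete_E m \<le> pi/2"
    using has_integral_le[OF complete_E_has_integral[OF m(1,2)] has_integral_const_real[of 1 0 "pi/2"]]
      ellR_bounds(2)[OF m(1,2)] by simp
  ultimately have "ellW m < 0" using pi_less_4 by (simp add: ellW_def)
  then show ?thesis using m by blast
qed

text \<open>The bridge from \<open>m0\<close> to the sign of \<open>ellW\<close>: the intermediate
  value theorem and strict monotonicity show that the definite description in \<open>m0\<close>
  denotes the root.\<close>

lemma ellW_pos_imp_less_m0:
  assumes "0 < m" "m < 1" "0 < ellW m"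
  shows "m < m0"
proof -
  obtain b where b: "1/2 < b" "b < 1" "ellW b < 0" using ellW_neg_near_1 by blast
  have "continuous_on {1/2..b} ellW"
    using b by (intro continuous_on_subset[OF continuous_on_ellW]) auto
  then obtain z where z: "1/2 \<le> z" "z \<le> b" "ellW z = 0"
    using IVT2'[of ellW b 0 "1/2"] b ellW_half_pos by auto
  have "m0 = z"
    unfolding m0_def
  proof (rule the_equality)
    fix y assume y: "0 < y \<and> y < 1 \<and> 2 * complete_E y - complete_K y = 0"
    then show "y = z"
      using ellW_strict_antimono[of y z] ellW_strict_antimono[of z y] z b
      by (cases y z rule: linorder_cases) (auto simp: ellW_def)
  qed (use z b in \<open>auto simp: ellW_def\<close>)
  moreover have "m < z"
    using ellW_strict_antimono[of z m] assms z b by (cases m z rule: linorder_cases) auto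
  ultimately show ?thesis by simp
qed

text \<open>The integrand \<open>fx\<close> obtained by differentiating in \<open>m\<close> is not
  half of 1/Delta, but twice it differs from 1/Delta by the \<open>x\<close>-derivative of sin x cos
  x / Delta, a function that vanishes at both ends.\<close>

lemma DERIV_ellH:
  assumes "0 < m" "m < 1"
  shows "(ellH has_real_derivative complete_K m / 2) (at m)"
proof -
  define fx where "fx m x = (cos x)\<^sup>2 * (2 - m * (sin x)\<^sup>2) / (2 * ellR m x ^ 3)" for m x :: real
  have d: "((\<lambda>m. m * (cos x)\<^sup>2 / ellR m x) has_real_derivative fx m x) (at m within {0<..<1})"
    if "m \<in> {0<..<1}" for m x
  proof -
    have p: "0 < 1 - m * (sin x)\<^sup>2" using ellR_radicand_pos[of m x] that by auto
    have r: "0 < ellR m x" "(ellR m x)\<^sup>2 = 1 - m * (sin x)\<^sup>2" using ellR_bounds[of m x] that by auto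
    have dR: "((\<lambda>m. ellR m x) has_real_derivative - ((sin x)\<^sup>2) / (2 * ellR m x)) (at m within {0<..<1})"
      unfolding ellR_def using p
      by (auto intro!: derivative_eq_intros simp: divide_simps)
    have "((\<lambda>m. m * (cos x)\<^sup>2 / ellR m x) has_real_derivative
       ((cos x)\<^sup>2 * ellR m x - (m * (cos x)\<^sup>2) * (- ((sin x)\<^sup>2) / (2 * ellR m x))) / (ellR m x * ellR m x))
       (at m within {0<..<1})"
      by (rule derivative_eq_intros dR refl | use r in simp)+
    moreover have "((cos x)\<^sup>2 * ellR m x - (m * (cos x)\<^sup>2) * (- ((sin x)\<^sup>2) / (2 * ellR m x))) / (ellR m x * ellR m x)
       = (cos x)\<^sup>2 * (2 * (ellR m x)\<^sup>2 + m * (sin x)\<^sup>2) / (2 * ellR m x ^ 3)"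
      using r(1) by (simp add: field_simps power2_eq_square power3_eq_cube)
    ultimately show ?thesis unfolding fx_def r(2) by (simp add: algebra_simps)
  qed
  have c: "continuous_on ({0<..<1} \<times> cbox 0 (pi/2)) (\<lambda>(m, x). fx m x)"
    unfolding fx_def split_beta
    using continuous_on_ellR2(1)[of "{0<..<1}" "cbox 0 (pi/2)"] ellR_bounds(1)
    by (intro continuous_intros) (auto simp: split_beta less_imp_neq[symmetric])
  have i: "(\<lambda>x. m * (cos x)\<^sup>2 / ellR m x) integrable_on cbox 0 (pi/2)" if "m \<in> {0<..<1}" for m
    using ellR_bounds(1)[of m] that
    by (intro integrable_continuous continuous_intros) (auto simp: less_imp_neq[symmetric])
  have "((\<lambda>m. integral (cbox 0 (pi/2)) (\<lambda>x. m * (cos x)\<^sup>2 / ellR m x)) has_real_derivative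
      integral (cbox 0 (pi/2)) (fx m)) (at m within {0<..<1})"
    by (rule leibniz_rule_field_derivative[OF d i c]) (use assms in auto)
  moreover have "at m within {0<..<1} = at m"
    using assms by (intro at_within_open) auto
  moreover have "integral {0..pi/2} (fx m) = complete_K m / 2"
  proof -
    have "((\<lambda>x. 1 / ellR m x + (1 - 2 * (sin x)\<^sup>2 + m * (sin x)^4) / ellR m x ^ 3) has_integral
        complete_K m + (sin (pi/2) * cos (pi/2) / ellR m (pi/2) - sin 0 * cos 0 / ellR m 0)) {0..pi/2}"
    proof (intro has_integral_add complete_K_has_integral assms has_integral_DERIV)
      fix x :: real
      have r: "0 < ellR m x" "(ellR m x)\<^sup>2 = 1 - m * (sin x)\<^sup>2" using ellR_bounds[of m x] assms by auto
      have p: "0 < 1 - m * (sin x)\<^sup>2" using ellR_radicand_pos[of m x] assms by auto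
      have dR: "(ellR m has_real_derivative - (m * sin x * cos x) / ellR m x) (at x)"
        unfolding ellR_def using p by (auto intro!: derivative_eq_intros simp: divide_simps)
      have "((\<lambda>x. sin x * cos x / ellR m x) has_real_derivative
         ((cos x * cos x + sin x * (- sin x)) * ellR m x - (sin x * cos x) * (- (m * sin x * cos x) / ellR m x))
           / (ellR m x * ellR m x)) (at x)"
        by (rule derivative_eq_intros dR refl | use r in simp)+
      moreover have "((cos x * cos x + sin x * (- sin x)) * ellR m x - (sin x * cos x) * (- (m * sin x * cos x) / ellR m x))
           / (ellR m x * ellR m x) = (((cos x)\<^sup>2 - (sin x)\<^sup>2) * (ellR m x)\<^sup>2 + m * (sin x)\<^sup>2 * (cos x)\<^sup>2) / ellR m x ^ 3"
        using r(1) by (simp add: field_simps power2_eq_square power3_eq_cube)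
      moreover have "((cos x)\<^sup>2 - (sin x)\<^sup>2) * (ellR m x)\<^sup>2 + m * (sin x)\<^sup>2 * (cos x)\<^sup>2
          = 1 - 2 * (sin x)\<^sup>2 + m * (sin x)^4"
        unfolding r(2) cos_squared_eq by algebra
      ultimately show "((\<lambda>x. sin x * cos x / ellR m x) has_real_derivative
         (1 - 2 * (sin x)\<^sup>2 + m * (sin x)^4) / ellR m x ^ 3) (at x)" by simp
    qed auto
    moreover have "1 / ellR m x + (1 - 2 * (sin x)\<^sup>2 + m * (sin x)^4) / ellR m x ^ 3 = 2 * fx m x" for x
    proof -
      have r: "0 < ellR m x" "(ellR m x)\<^sup>2 = 1 - m * (sin x)\<^sup>2" using ellR_bounds[of m x] assms by auto
      have "1 / ellR m x = (ellR m x)\<^sup>2 / ellR m x ^ 3"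
        using r(1) by (simp add: power2_eq_square power3_eq_cube)
      then have "1 / ellR m x + (1 - 2 * (sin x)\<^sup>2 + m * (sin x)^4) / ellR m x ^ 3
          = ((ellR m x)\<^sup>2 + 1 - 2 * (sin x)\<^sup>2 + m * (sin x)^4) / ellR m x ^ 3"
        by (simp add: add_divide_distrib diff_divide_distrib)
      also have "(ellR m x)\<^sup>2 + 1 - 2 * (sin x)\<^sup>2 + m * (sin x)^4 = (cos x)\<^sup>2 * (2 - m * (sin x)\<^sup>2)"
        unfolding r(2) cos_squared_eq by algebra
      finally show ?thesis by (simp add: fx_def)
    qed
    ultimately have "((\<lambda>x. 2 * fx m x) has_integral complete_K m) {0..pi/2}" by simp
    then have "((\<lambda>x. (1/2) * (2 * fx m x)) has_integral (1/2) * complete_K m) {0..pi/2}"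
      by (rule has_integral_mult_right)
    then show ?thesis by (simp add: integral_unique)
  qed
  ultimately show ?thesis by (simp add: ellH_def[abs_def])
qed

text \<open>The integrand is at most cos x, since m cos x is at most Delta. The number 1 is the
  limit of \<open>ellH\<close> at \<open>m = 1\<close>.\<close>

lemma ellH_le_1:
  assumes "0 < m" "m < 1"
  shows "ellH m \<le> 1"
proof -
  have "((\<lambda>x. cos x) has_integral (sin (pi/2) - sin 0)) {0..pi/2}"
    by (rule has_integral_DERIV) (auto intro!: derivative_eq_intros)
  moreover have "((\<lambda>x. m * (cos x)\<^sup>2 / ellR m x) has_integral ellH m) {0..pi/2}"
    unfolding ellH_def using ellR_bounds(1)[OF assms]
    by (intro integrable_integral integrable_continuous_real continuous_intros)
       (auto simp: less_imp_neq[symmetric])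
  moreover have "m * (cos x)\<^sup>2 / ellR m x \<le> cos x" if x: "x \<in> {0..pi/2}" for x
  proof -
    have c: "0 \<le> cos x" using x by (intro cos_ge_zero) auto
    have "m\<^sup>2 \<le> m" "m\<^sup>2 \<le> 1" using assms by (auto simp: power2_eq_square mult_le_one)
    have "(m * cos x)\<^sup>2 \<le> 1 - m * (sin x)\<^sup>2"
    proof -
      have "(m * cos x)\<^sup>2 \<le> m * (cos x)\<^sup>2"
        using \<open>m\<^sup>2 \<le> m\<close> by (simp add: power_mult_distrib mult_right_mono)
      also have "\<dots> \<le> 1 - m * (sin x)\<^sup>2" using assms by (simp add: cos_squared_eq algebra_simps)
      finally show ?thesis .
    qed
    then have "m * cos x \<le> ellR m x" unfolding ellR_def by (rule real_le_rsqrt)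
    then have "m * (cos x)\<^sup>2 \<le> cos x * ellR m x"
      using mult_left_mono[OF _ c, of "m * cos x" "ellR m x"] by (simp add: power2_eq_square mult.left_commute)
    then show ?thesis using ellR_bounds(1)[OF assms, of x] by (simp add: field_simps)
  qed
  ultimately have "ellH m \<le> sin (pi/2) - sin 0" using has_integral_le by blast
  then show ?thesis by simp
qed

section \<open>The lower bound as a function of the largest angle\<close>

text \<open>Up to the factor \<open>16 sqrt (lam / 2)\<close>, the lower bound for the energy of a half period that reaches the
  angle \<open>2 arcsin (sqrt m)\<close>, subject to the displacement of the half period of parameter \<open>m1\<close>.\<close>

definition wave_bound :: "real \<Rightarrow> real \<Rightarrow> real" where
  "wave_bound m1 m = ellH m / sqrt (2 * m - 1) - ellW m1 * sqrt (2 * m1 - 1) / 4 / (2 * m - 1)"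

text \<open>The quotient rule produces \<open>ellH m - (2 * m - 1) * complete_K m / 2\<close>, which
  is \<open>ellW m / 2\<close>. Hence the derivative vanishes at \<open>m = m1\<close>.\<close>

lemma DERIV_wave_bound:
  assumes "1/2 < m" "m < 1"
  shows "(wave_bound m1 has_real_derivative
     (ellW m1 * sqrt (2 * m1 - 1) - ellW m * sqrt (2 * m - 1)) / (2 * (2 * m - 1)\<^sup>2)) (at m)"
proof -
  define r where "r = sqrt (2 * m - 1)"
  have r: "0 < r" "2 * m - 1 = r\<^sup>2" using assms by (auto simp: r_def)
  have dr: "((\<lambda>m. sqrt (2 * m - 1)) has_real_derivative 1 / r) (at m)"
    using assms by (auto intro!: derivative_eq_intros simp: r_def divide_simps)
  have dH: "(ellH has_real_derivative complete_K m / 2) (at m)" using DERIV_ellH assms by auto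
  have "((\<lambda>m. ellH m / sqrt (2 * m - 1)) has_real_derivative
      (complete_K m / 2 * r - ellH m * (1 / r)) / (r * r)) (at m)"
    using DERIV_divide[OF dH dr] r unfolding r_def[symmetric] by simp
  moreover have "((\<lambda>m. D / (2 * m - 1)) has_real_derivative (0 - D * 2) / (r\<^sup>2 * r\<^sup>2)) (at m)" for D
    using r by (auto intro!: derivative_eq_intros simp: power2_eq_square)
  ultimately have "(wave_bound m1 has_real_derivative
      (complete_K m / 2 * r - ellH m * (1 / r)) / (r * r)
      - (0 - (ellW m1 * sqrt (2 * m1 - 1) / 4) * 2) / (r\<^sup>2 * r\<^sup>2)) (at m)"
    unfolding wave_bound_def[abs_def] by (rule DERIV_diff)
  moreover have "(complete_K m / 2 * r - ellH m * (1 / r)) / (r * r) = - ellW m * r / (2 * (r\<^sup>2)\<^sup>2)"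
  proof -
    have m: "m = (r\<^sup>2 + 1) / 2" using r(2) by simp
    have "(complete_K m / 2 * r - ellH m * (1 / r)) = (complete_K m / 2 * r\<^sup>2 - ellH m) / r"
      using r by (simp add: field_simps power2_eq_square)
    also have "complete_K m / 2 * r\<^sup>2 - ellH m = - ellW m / 2"
      using assms by (simp add: ellH_eq ellW_def flip: r(2)) (simp add: field_simps)
    finally show ?thesis using r(1) by (simp add: divide_simps power2_eq_square)
  qed
  ultimately show ?thesis
    using r(1) unfolding r(2) by (simp add: diff_divide_distrib power2_eq_square)
qed

text \<open>The decreasing \<open>ellW\<close> times the increasing root need not be monotone; the
  sign of \<open>ellW m1\<close> decides. Above \<open>m1\<close> the factor \<open>ellW\<close> is
  negative, so a larger root lowers the product as well. Below \<open>m1\<close> the smaller root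
  raises the product at \<open>m1\<close>, and the larger \<open>ellW m\<close> raises it
  further.\<close>

lemma wave_bound_deriv_sign:
  assumes m1: "1/2 < m1" "m1 < 1" "ellW m1 \<le> 0" and m: "1/2 < m" "m < 1"
  shows "m1 < m \<Longrightarrow> ellW m * sqrt (2 * m - 1) < ellW m1 * sqrt (2 * m1 - 1)"
    "m < m1 \<Longrightarrow> ellW m1 * sqrt (2 * m1 - 1) < ellW m * sqrt (2 * m - 1)"
proof -
  have pos: "0 < sqrt (2 * m - 1)" "0 < sqrt (2 * m1 - 1)" using m m1 by auto
  show "ellW m * sqrt (2 * m - 1) < ellW m1 * sqrt (2 * m1 - 1)" if "m1 < m"
  proof -
    have W: "ellW m < ellW m1" using ellW_strict_antimono[of m1 m] m1 m that by auto
    have "ellW m * sqrt (2 * m - 1) \<le> ellW m * sqrt (2 * m1 - 1)"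
      using W m1 that by (intro mult_left_mono_neg) auto
    also have "\<dots> < ellW m1 * sqrt (2 * m1 - 1)" using W pos by simp
    finally show ?thesis .
  qed
  show "ellW m1 * sqrt (2 * m1 - 1) < ellW m * sqrt (2 * m - 1)" if "m < m1"
  proof -
    have W: "ellW m1 < ellW m" using ellW_strict_antimono[of m m1] m1 m that by auto
    show ?thesis
    \<comment> \<open>Strict monotonicity of the multiplication needs a nonzero factor; if it is
      zero, \<open>ellW m\<close> is positive.\<close>
    proof (cases "ellW m1 = 0")
      case True
      then show ?thesis using W pos by simp
    next
      case False
      have "ellW m1 * sqrt (2 * m1 - 1) < ellW m1 * sqrt (2 * m - 1)"
        using False m1 that by (intro mult_strict_left_mono_neg) auto
      also have "\<dots> < ellW m * sqrt (2 * m - 1)" using W pos by simp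
      finally show ?thesis .
    qed
  qed
qed

lemma wave_bound_strict_min:
  assumes m1: "1/2 < m1" "m1 < 1" "ellW m1 \<le> 0"
  shows "m1 \<le> a \<Longrightarrow> a < b \<Longrightarrow> b < 1 \<Longrightarrow> wave_bound m1 a < wave_bound m1 b"
    "1/2 < a \<Longrightarrow> a < b \<Longrightarrow> b \<le> m1 \<Longrightarrow> wave_bound m1 b < wave_bound m1 a"
proof -
  have mvt: "\<exists>z>a. z < b \<and> wave_bound m1 b - wave_bound m1 a = (b - a) *
     ((ellW m1 * sqrt (2 * m1 - 1) - ellW z * sqrt (2 * z - 1)) / (2 * (2 * z - 1)\<^sup>2))"
    if "1/2 < a" "a < b" "b < 1"
    using that by (intro MVT2 DERIV_wave_bound) auto
  show "wave_bound m1 a < wave_bound m1 b" if h: "m1 \<le> a" "a < b" "b < 1"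
  proof -
    obtain z where z: "a < z" "z < b" "wave_bound m1 b - wave_bound m1 a = (b - a) *
     ((ellW m1 * sqrt (2 * m1 - 1) - ellW z * sqrt (2 * z - 1)) / (2 * (2 * z - 1)\<^sup>2))"
      using mvt h m1 by auto
    have "ellW z * sqrt (2 * z - 1) < ellW m1 * sqrt (2 * m1 - 1)"
      using wave_bound_deriv_sign(1)[OF m1, of z] z h m1 by auto
    then have "0 < (b - a) * ((ellW m1 * sqrt (2 * m1 - 1) - ellW z * sqrt (2 * z - 1)) / (2 * (2 * z - 1)\<^sup>2))"
      using z h m1 by (intro mult_pos_pos divide_pos_pos) auto
    then show ?thesis using z(3) by linarith
  qed
  show "wave_bound m1 b < wave_bound m1 a" if h: "1/2 < a" "a < b" "b \<le> m1"
  proof -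
    obtain z where z: "a < z" "z < b" "wave_bound m1 b - wave_bound m1 a = (b - a) *
     ((ellW m1 * sqrt (2 * m1 - 1) - ellW z * sqrt (2 * z - 1)) / (2 * (2 * z - 1)\<^sup>2))"
      using mvt h m1 by auto
    have "ellW m1 * sqrt (2 * m1 - 1) < ellW z * sqrt (2 * z - 1)"
      using wave_bound_deriv_sign(2)[OF m1, of z] z h m1 by auto
    then have "(b - a) * ((ellW m1 * sqrt (2 * m1 - 1) - ellW z * sqrt (2 * z - 1)) / (2 * (2 * z - 1)\<^sup>2)) < 0"
      using z h m1 by (intro mult_pos_neg divide_neg_pos) auto
    then show ?thesis using z(3) by linarith
  qed
qed

text \<open>The right-hand side is the bound at \<open>m = 1\<close>, that is, for a competitor that
  reaches the angle pi, with \<open>ellH\<close> replaced by its limit 1.\<close>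

lemma wave_bound_limit:
  assumes m1: "1/2 < m1" "m1 < 1" "ellW m1 \<le> 0"
  shows "wave_bound m1 m1 < 1 - ellW m1 * sqrt (2 * m1 - 1) / 4"
proof -
  \<comment> \<open>The detour over \<open>a\<close> keeps the inequality strict, which the passage
    to the limit alone would not.\<close>
  define a where "a = (m1 + 1) / 2"
  have a: "m1 < a" "a < 1" using m1 by (auto simp: a_def)
  define D where "D = - ellW m1 * sqrt (2 * m1 - 1) / 4"
  have "wave_bound m1 m1 < wave_bound m1 a" using wave_bound_strict_min(1)[OF m1, of m1 a] a by auto
  also have "wave_bound m1 a \<le> 1 + D"
  proof (rule tendsto_lowerbound)
    have "isCont (\<lambda>m. 1 / sqrt (2 * m - 1) + D / (2 * m - 1)) 1"
      by (intro continuous_intros) auto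
    then show "((\<lambda>m. 1 / sqrt (2 * m - 1) + D / (2 * m - 1)) \<longlongrightarrow> 1 + D) (at_left 1)"
      by (auto simp: isCont_def filterlim_at_split)
    have "eventually (\<lambda>m. a < m \<and> m < (1::real)) (at_left 1)"
      using a by (auto simp: eventually_at_left intro!: exI[of _ a])
    then show "eventually (\<lambda>m. wave_bound m1 a \<le> 1 / sqrt (2 * m - 1) + D / (2 * m - 1)) (at_left 1)"
    proof eventually_elim
      case (elim m)
      have "wave_bound m1 a \<le> wave_bound m1 m"
        using wave_bound_strict_min(1)[OF m1, of a m] a elim by auto
      also have "\<dots> \<le> 1 / sqrt (2 * m - 1) + D / (2 * m - 1)"
        unfolding wave_bound_def D_def using ellH_le_1[of m] m1 a elim
        by (auto intro!: divide_right_mono)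
      finally show ?case .
    qed
  qed auto
  finally show ?thesis by (simp add: D_def)
qed

section \<open>The angle functional\<close>

definition h1_on :: "real \<Rightarrow> real \<Rightarrow> (real \<Rightarrow> real) \<Rightarrow> (real \<Rightarrow> real) \<Rightarrow> bool" where
  "h1_on a b u v \<longleftrightarrow> ac_on a b u v \<and> (\<lambda>t. (v t)\<^sup>2) integrable_on {a..b}"

lemma h1_on_ac_on: "h1_on a b u v \<Longrightarrow> ac_on a b u v"
  by (simp add: h1_on_def)

lemma h1_on_integrable:
  assumes "h1_on a b u v" "a \<le> s" "t \<le> b"
  shows "(\<lambda>t. (v t)\<^sup>2) integrable_on {s..t}"
  using assms integrable_on_subinterval[of "\<lambda>t. (v t)\<^sup>2" "{a..b}" s t] by (auto simp: h1_on_def)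

lemma h1_on_subinterval:
  assumes "h1_on a b u v" "a \<le> s" "t \<le> b"
  shows "h1_on s t u v"
  using ac_on_subinterval[OF h1_on_ac_on[OF assms(1)] assms(2,3)] h1_on_integrable[OF assms]
  by (simp add: h1_on_def)

lemma h1_on_minus: "h1_on a b u v \<Longrightarrow> h1_on a b (\<lambda>t. - u t) (\<lambda>t. - v t)"
  by (simp add: h1_on_def ac_on_minus)

lemma ac_on_reverse:
  assumes "ac_on 0 b u v"
  shows "ac_on 0 b (\<lambda>t. u (b - t)) (\<lambda>t. - v (b - t))"
proof -
  have "ac_on (-b + b) (-0 + b) (\<lambda>t. u (- (t - b))) (\<lambda>t. - v (- (t - b)))"
    by (intro ac_on_shift[of "-b" "-0" "\<lambda>t. u (-t)" "\<lambda>t. - v (-t)"] ac_on_reflect assms)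
  then show ?thesis by simp
qed

lemma integral_reverse:
  fixes f :: "real \<Rightarrow> real"
  shows "integral {0..b} (\<lambda>t. f (b - t)) = integral {0..b} f"
proof -
  have "integral {0..b} (\<lambda>t. f (b - t)) = integral {-b+b..0+b} (\<lambda>t. f (- (t - b)))" by simp
  also have "\<dots> = integral {-b..0} (\<lambda>t. f (-t))"
    by (rule integral_shift_real_interval[of "-b" b 0 "\<lambda>t. f (-t)"])
  also have "\<dots> = integral {0..b} f"
    using Henstock_Kurzweil_Integration.integral_reflect_real[of b 0 f] by simp
  finally show ?thesis .
qed

lemma integrable_reverse:
  fixes f :: "real \<Rightarrow> real"
  assumes "f integrable_on {0..b}"
  shows "(\<lambda>t. f (b - t)) integrable_on {0..b}"
proof (cases "0 \<le> b")
  case True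
  then show ?thesis
    using integrable_affinity[of f 0 b "-1" b] assms by auto
qed auto

lemma h1_on_reverse:
  assumes "h1_on 0 b u v"
  shows "h1_on 0 b (\<lambda>t. u (b - t)) (\<lambda>t. - v (b - t))"
  using assms ac_on_reverse integrable_reverse[of "\<lambda>t. (v t)\<^sup>2" b] by (auto simp: h1_on_def)

text \<open>The trick of Modica and Mortola: completing the square bounds the energy below by a function
  of the end points alone.\<close>

lemma modica_mortola:
  assumes h: "h1_on a b u v" and "a \<le> b"
    and F: "\<And>x. (F has_real_derivative f x) (at x)" and f: "continuous_on UNIV f"
    and \<sigma>: "\<sigma> = 1 \<or> \<sigma> = -1"
  shows "(\<lambda>t. (v t)\<^sup>2 + (f (u t))\<^sup>2) integrable_on {a..b}"
    and "2 * \<sigma> * (F (u b) - F (u a)) \<le> integral {a..b} (\<lambda>t. (v t)\<^sup>2 + (f (u t))\<^sup>2)"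
    and "integral {a..b} (\<lambda>t. (v t)\<^sup>2 + (f (u t))\<^sup>2) \<le> 2 * \<sigma> * (F (u b) - F (u a)) \<Longrightarrow>
      ac_on a b u (\<lambda>t. \<sigma> * f (u t))"
proof -
  note ac = h1_on_ac_on[OF h]
  have \<sigma>2: "\<sigma>\<^sup>2 = 1" using \<sigma> by auto
  have fu: "continuous_on {a..b} (\<lambda>t. f (u t))"
    using continuous_on_compose2[OF f ac_on_continuous[OF ac]] by auto
  have v2: "(\<lambda>t. (v t)\<^sup>2) integrable_on {a..b}" using h by (simp add: h1_on_def)
  have fu2: "(\<lambda>t. (f (u t))\<^sup>2) integrable_on {a..b}"
    by (intro integrable_continuous_real continuous_intros fu)
  show int: "(\<lambda>t. (v t)\<^sup>2 + (f (u t))\<^sup>2) integrable_on {a..b}"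
    by (intro integrable_add v2 fu2)
  have Fu: "ac_on a b (\<lambda>t. F (u t)) (\<lambda>t. f (u t) * v t)"
    by (rule ac_on_chain[OF ac F f])
  define q where "q t = (v t - \<sigma> * f (u t))\<^sup>2" for t
  have q_eq: "q = (\<lambda>t. ((v t)\<^sup>2 + (f (u t))\<^sup>2) - (2 * \<sigma>) * (f (u t) * v t))"
    unfolding q_def power2_diff power_mult_distrib \<sigma>2 by (auto simp: algebra_simps)
  have q_int: "q integrable_on {a..b}"
    unfolding q_eq using ac_on_integrable(2)[OF Fu, of a b] int
    by (intro integrable_diff integrable_on_mult_right) auto
  have "integral {a..b} q = integral {a..b} (\<lambda>t. (v t)\<^sup>2 + (f (u t))\<^sup>2) - 2 * \<sigma> * (F (u b) - F (u a))"
    unfolding q_eq using ac_on_integrable(2)[OF Fu, of a b] int ac_on_increment[OF Fu, of a b] \<open>a \<le> b\<close>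
    by (subst integral_diff) (auto intro!: integrable_on_mult_right)
  moreover have "0 \<le> integral {a..b} q"
    by (intro integral_nonneg q_int) (simp add: q_def)
  ultimately show "2 * \<sigma> * (F (u b) - F (u a)) \<le> integral {a..b} (\<lambda>t. (v t)\<^sup>2 + (f (u t))\<^sup>2)"
    by linarith
  \<comment> \<open>In the equality case the nonnegative square \<open>q\<close> has integral zero
    over every initial interval, so \<open>v t\<close> equals \<open>\<sigma> * f (u t)\<close>
    almost everywhere.\<close>
  assume "integral {a..b} (\<lambda>t. (v t)\<^sup>2 + (f (u t))\<^sup>2) \<le> 2 * \<sigma> * (F (u b) - F (u a))"
  then have q0: "integral {a..b} q \<le> 0"
    using \<open>integral {a..b} q = _\<close> by linarith
  have qt: "integral {a..t} q = 0" if t: "a \<le> t" "t \<le> b" for t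
  proof -
    have i: "q integrable_on {a..t}" "q integrable_on {t..b}"
      using q_int integrable_on_subinterval[OF q_int] t by auto
    have "0 \<le> integral {a..t} q" "0 \<le> integral {t..b} q"
      by (intro integral_nonneg i; simp add: q_def)+
    moreover have "integral {a..t} q + integral {t..b} q = integral {a..b} q"
      using t q_int by (intro integral_split)
    ultimately show ?thesis using q0 by linarith
  qed
  have "q absolutely_integrable_on {a..b}"
    by (intro nonnegative_absolutely_integrable_1 q_int) (simp add: q_def)
  then have neg: "negligible {x \<in> {a..b}. q x \<noteq> 0}"
    using negligible_of_integral_zero[of a b q] qt by auto
  show "ac_on a b u (\<lambda>t. \<sigma> * f (u t))"
  proof (rule ac_onI_increment)
    show "(\<lambda>t. \<sigma> * f (u t)) absolutely_integrable_on {a..b}"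
      by (intro absolutely_integrable_continuous_real continuous_intros fu)
    fix t assume t: "a \<le> t" "t \<le> b"
    have "integral {a..t} (\<lambda>t. \<sigma> * f (u t)) = integral {a..t} v"
      by (rule integral_spike[OF neg]) (use t in \<open>auto simp: q_def\<close>)
    then show "u t - u a = integral {a..t} (\<lambda>t. \<sigma> * f (u t))"
      using ac_on_increment[OF ac order_refl t] by simp
  qed
qed

lemma ac_on_mono:
  fixes u v :: "real \<Rightarrow> real"
  assumes "ac_on a b u v" "\<And>t. a \<le> t \<Longrightarrow> t \<le> b \<Longrightarrow> 0 \<le> v t" "a \<le> s" "s \<le> t" "t \<le> b"
  shows "u s \<le> u t"
proof -
  have "0 \<le> integral {s..t} v"
    using assms by (intro integral_nonneg ac_on_integrable[OF assms(1)]) auto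
  then show ?thesis using ac_on_increment[OF assms(1,3-5)] by simp
qed

text \<open>For a decreasing right-hand side \<open>(u - w)\<^sup>2\<close> is nonincreasing, so forward uniqueness holds
  even where \<open>f\<close> fails to be Lipschitz.\<close>

lemma forward_uniqueness:
  fixes u w f :: "real \<Rightarrow> real"
  assumes u: "ac_on a b u (\<lambda>t. f (u t))" and w: "ac_on a b w (\<lambda>t. f (w t))"
    and anti: "\<And>x y. x \<in> I \<Longrightarrow> y \<in> I \<Longrightarrow> x \<le> y \<Longrightarrow> f y \<le> f x"
    and I: "\<And>t. a \<le> t \<Longrightarrow> t \<le> b \<Longrightarrow> u t \<in> I \<and> w t \<in> I"
    and init: "u a = w a" and t: "a \<le> t" "t \<le> b"
  shows "u t = w t"
proof -
  have d: "ac_on a b (\<lambda>t. u t - w t) (\<lambda>t. f (u t) - f (w t))" by (intro ac_on_diff u w)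
  define D where "D t = (f (u t) - f (w t)) * (u t - w t) + (u t - w t) * (f (u t) - f (w t))" for t
  have D: "ac_on a b (\<lambda>t. (u t - w t) * (u t - w t)) D"
    unfolding D_def by (rule ac_on_mult[OF d d])
  have "D s \<le> 0" if "a \<le> s" "s \<le> b" for s
  proof -
    have "(f (u s) - f (w s)) * (u s - w s) \<le> 0"
      using anti[of "u s" "w s"] anti[of "w s" "u s"] I[OF that]
      by (cases "u s \<le> w s") (auto intro: mult_nonneg_nonpos mult_nonpos_nonneg)
    then show ?thesis by (simp add: D_def algebra_simps)
  qed
  then have "integral {a..t} D \<le> integral {a..t} (\<lambda>_. 0)"
    using t by (intro integral_le ac_on_integrable[OF D]) auto
  then have "(u t - w t) * (u t - w t) \<le> 0"
    using ac_on_increment[OF D order_refl t] init by simp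
  then have "u t - w t = 0" by (metis less_eq_real_def mult_eq_0_iff not_square_less_zero)
  then show ?thesis by simp
qed

section \<open>The potential and its primitive\<close>

definition primitive :: "(real \<Rightarrow> real) \<Rightarrow> real \<Rightarrow> real" where
  "primitive f x = (LBINT y=0..ereal x. f y)"

lemma DERIV_primitive: "continuous_on UNIV f \<Longrightarrow> (primitive f has_real_derivative f x) (at x)"
  using DERIV_interval_integral[of f x] by (simp add: primitive_def[abs_def])

lemma primitive_0 [simp]: "primitive f 0 = 0"
  by (simp add: primitive_def flip: zero_ereal_def)

text \<open>\<open>sqrt\<close> is odd in HOL, so the potential has to be truncated explicitly.\<close>

definition pot :: "real \<Rightarrow> real \<Rightarrow> real \<Rightarrow> real" where
  "pot lam q x = sqrt (max 0 (lam + q * cos x))"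

abbreviation pot_prim :: "real \<Rightarrow> real \<Rightarrow> real \<Rightarrow> real" where
  "pot_prim lam q \<equiv> primitive (pot lam q)"

lemma continuous_on_pot: "continuous_on UNIV (pot lam q)"
  unfolding pot_def[abs_def] by (intro continuous_intros)

lemma pot_nonneg [simp]: "0 \<le> pot lam q x"
  by (simp add: pot_def)

lemma pot_sq: "0 \<le> lam + q * cos x \<Longrightarrow> (pot lam q x)\<^sup>2 = lam + q * cos x"
  by (simp add: pot_def)

lemma pot_antimono:
  assumes "0 \<le> q" "x \<in> {0..pi}" "y \<in> {0..pi}" "x \<le> y"
  shows "pot lam q y \<le> pot lam q x"
proof -
  have "cos y \<le> cos x" using assms by (intro cos_monotone_0_pi_le) auto
  then have "q * cos y \<le> q * cos x" using assms by (intro mult_left_mono)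
  then show ?thesis unfolding pot_def by (intro real_sqrt_le_mono) auto
qed

lemma DERIV_prim_pot: "(pot_prim lam q has_real_derivative pot lam q x) (at x)"
  by (rule DERIV_primitive[OF continuous_on_pot])

lemma prim_pot_mono: "x \<le> y \<Longrightarrow> pot_prim lam q x \<le> pot_prim lam q y"
  by (rule DERIV_nonneg_imp_nondecreasing) (use DERIV_prim_pot pot_nonneg in blast)+

lemma prim_pot_minus: "pot_prim lam q (- x) = - pot_prim lam q x"
proof -
  have "pot_prim lam q (-x) + pot_prim lam q x
     = pot_prim lam q (-0) + pot_prim lam q 0"
  proof (rule DERIV_isconst_all[of "\<lambda>x. pot_prim lam q (-x) + pot_prim lam q x"], rule allI)
    fix x
    have "((\<lambda>x. pot_prim lam q (-x) + pot_prim lam q x) has_real_derivative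
       pot lam q (-x) * (-1) + pot lam q x) (at x)"
      by (rule derivative_eq_intros DERIV_chain2[OF DERIV_prim_pot] DERIV_prim_pot refl | simp)+
    then show "((\<lambda>x. pot_prim lam q (-x) + pot_prim lam q x) has_real_derivative 0) (at x)"
      by (simp add: pot_def)
  qed
  then show ?thesis by simp
qed

lemma prim_pot_shift: "pot_prim lam q (x + 2 * pi) = pot_prim lam q x + 2 * pot_prim lam q pi"
proof -
  have "pot_prim lam q (x + 2 * pi) - pot_prim lam q x
     = pot_prim lam q (- pi + 2 * pi) - pot_prim lam q (- pi)"
  proof (rule DERIV_isconst_all[of "\<lambda>x. pot_prim lam q (x + 2 * pi) - pot_prim lam q x"], rule allI)
    fix x
    have "((\<lambda>x. pot_prim lam q (x + 2 * pi) - pot_prim lam q x) has_real_derivative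
       pot lam q (x + 2 * pi) * 1 - pot lam q x) (at x)"
      by (rule derivative_eq_intros DERIV_chain2[OF DERIV_prim_pot] DERIV_prim_pot refl | simp)+
    then show "((\<lambda>x. pot_prim lam q (x + 2 * pi) - pot_prim lam q x) has_real_derivative 0) (at x)"
      by (simp add: pot_def)
  qed
  then show ?thesis by (simp add: prim_pot_minus)
qed

text \<open>The potential is even and \<open>2 * pi\<close>-periodic, so a full turn adds twice the
  primitive at pi. This evaluates the lower bound for every winding number of a competitor.\<close>

lemma prim_pot_shift_int:
  "pot_prim lam q (x + 2 * pi * of_int n) = pot_prim lam q x + 2 * of_int n * pot_prim lam q pi"
proof (induction n rule: int_induct[of _ 0])
  case (step1 i)
  have "x + 2 * pi * of_int (i + 1) = (x + 2 * pi * of_int i) + 2 * pi" by (simp add: algebra_simps)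
  then have "pot_prim lam q (x + 2 * pi * of_int (i + 1))
      = pot_prim lam q (x + 2 * pi * of_int i) + 2 * pot_prim lam q pi"
    by (metis prim_pot_shift)
  then show ?case unfolding step1.IH by (simp add: algebra_simps)
next
  case (step2 i)
  have "x + 2 * pi * of_int i = (x + 2 * pi * of_int (i - 1)) + 2 * pi" by (simp add: algebra_simps)
  then have "pot_prim lam q (x + 2 * pi * of_int i)
      = pot_prim lam q (x + 2 * pi * of_int (i - 1)) + 2 * pot_prim lam q pi"
    by (metis prim_pot_shift)
  then show ?case unfolding step2.IH by (simp add: algebra_simps)
qed auto

definition path_energy :: "real \<Rightarrow> real \<Rightarrow> (real \<Rightarrow> real) \<Rightarrow> real" where
  "path_energy lam M v = integral {0..M} (\<lambda>t. (v t)\<^sup>2) + lam * M"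

text \<open>\<open>q\<close> acts as a Lagrange multiplier for the displacement: two curves with the
  same integral of cos may be compared through the right-hand sides.\<close>

lemma path_energy_pot:
  assumes h: "h1_on 0 M u v" and "0 \<le> M" and W: "\<And>t. 0 \<le> t \<Longrightarrow> t \<le> M \<Longrightarrow> 0 \<le> lam + q * cos (u t)"
  shows "path_energy lam M v + q * integral {0..M} (\<lambda>t. cos (u t))
     = integral {0..M} (\<lambda>t. (v t)\<^sup>2 + (pot lam q (u t))\<^sup>2)"
proof -
  have c: "continuous_on {0..M} u" using ac_on_continuous h1_on_ac_on h by blast
  have ci: "(\<lambda>t. cos (u t)) integrable_on {0..M}"
    by (intro integrable_continuous_real continuous_intros c)
  have "integral {0..M} (\<lambda>t. (v t)\<^sup>2 + (pot lam q (u t))\<^sup>2)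
      = integral {0..M} (\<lambda>t. (v t)\<^sup>2 + (lam + q * cos (u t)))"
    using W by (intro integral_cong) (auto simp: pot_sq)
  also have "\<dots> = integral {0..M} (\<lambda>t. (v t)\<^sup>2) + integral {0..M} (\<lambda>t. lam + q * cos (u t))"
    using h ci by (intro integral_add integrable_on_mult_right integrable_add)
      (auto simp: h1_on_def intro: integrable_on_mult_right)
  also have "integral {0..M} (\<lambda>t. lam + q * cos (u t)) = lam * M + q * integral {0..M} (\<lambda>t. cos (u t))"
    using ci \<open>0 \<le> M\<close> by (subst integral_add) (auto intro: integrable_on_mult_right)
  finally show ?thesis by (simp add: path_energy_def)
qed

text \<open>The orbit follows \<open>\<theta>' = pot lam p \<theta>\<close> and attains the value
  \<open>2 * x\<close> with \<open>x = F (\<theta> L) - F (\<theta> 0)\<close>, where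
  \<open>0 \<le> x \<le> F pi\<close>. A competitor of winding number \<open>n\<close> pays at least
  twice the modulus of \<open>x + 2 * n * F pi\<close>, which is at least \<open>x\<close>. Equality
  leaves \<open>n = 0\<close>, or \<open>n = -1\<close> with \<open>x = F pi\<close>, which is the
  mirror image of a half turn from 0 to pi.\<close>

lemma orbit_minimal_increasing:
  assumes p: "0 < p" "p \<le> lam" and L: "0 < L" and M: "0 < M"
    and \<theta>: "ac_on 0 L \<theta> k" "continuous_on {0..L} k"
    and ode: "\<And>t. t \<in> {0..L} \<Longrightarrow> (k t)\<^sup>2 = lam + p * cos (\<theta> t)"
    and kpos: "\<And>t. t \<in> {0..L} \<Longrightarrow> 0 < k t"
    and rng: "\<And>t. t \<in> {0..L} \<Longrightarrow> \<theta> t \<in> {0..pi}"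
    and \<phi>: "h1_on 0 M \<phi> g" "\<phi> 0 = \<theta> 0" "\<phi> M = \<theta> L + 2 * pi * of_int n"
    and X: "integral {0..M} (\<lambda>t. cos (\<phi> t)) = integral {0..L} (\<lambda>t. cos (\<theta> t))"
    and Y: "integral {0..M} (\<lambda>t. sin (\<phi> t)) = integral {0..L} (\<lambda>t. sin (\<theta> t))"
  shows "path_energy lam L k \<le> path_energy lam M g"
    and "path_energy lam M g \<le> path_energy lam L k \<Longrightarrow> M = L \<and> (\<forall>t\<in>{0..L}. \<phi> t = \<theta> t)"
proof -
  define F where "F = pot_prim lam p"
  have F: "(F has_real_derivative pot lam p x) (at x)" for x
    unfolding F_def by (rule DERIV_prim_pot)
  have Wnn: "0 \<le> lam + p * cos x" for x
    using mult_left_mono[OF cos_ge_minus_one[of x], of p] p by simp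
  have \<theta>h: "h1_on 0 L \<theta> k"
    using \<theta> by (auto simp: h1_on_def intro!: integrable_continuous_real continuous_intros)
  have kw: "k t = pot lam p (\<theta> t)" if "t \<in> {0..L}" for t
    using ode[OF that] kpos[OF that] Wnn by (simp add: pot_def real_sqrt_unique[symmetric])
  have \<theta>ac: "ac_on 0 L \<theta> (\<lambda>t. pot lam p (\<theta> t))"
    by (rule ac_on_cong[OF \<theta>(1)]) (use kw in auto)
  have \<theta>strict: "\<theta> s < \<theta> t" if "0 \<le> s" "s < t" "t \<le> L" for s t
  proof -
    have "integral {s..t} (\<lambda>_. 0) < integral {s..t} k"
      by (rule integral_less_real) (use that kpos in \<open>auto intro!: continuous_on_subset[OF \<theta>(2)]\<close>)
    then show ?thesis using ac_on_increment[OF \<theta>(1), of s t] that by simp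
  qed
  have e\<theta>: "path_energy lam L k + p * integral {0..L} (\<lambda>t. cos (\<theta> t)) = 2 * (F (\<theta> L) - F (\<theta> 0))"
  proof -
    have ch: "ac_on 0 L (\<lambda>t. F (\<theta> t)) (\<lambda>t. pot lam p (\<theta> t) * k t)"
      by (rule ac_on_chain[OF \<theta>(1) F continuous_on_pot])
    have "integral {0..L} (\<lambda>t. (k t)\<^sup>2 + (pot lam p (\<theta> t))\<^sup>2) = integral {0..L} (\<lambda>t. 2 * (pot lam p (\<theta> t) * k t))"
      by (intro integral_cong) (use kw in \<open>auto simp: power2_eq_square\<close>)
    also have "\<dots> = 2 * (F (\<theta> L) - F (\<theta> 0))"
      using ac_on_increment[OF ch, of 0 L] L by simp
    finally show ?thesis using path_energy_pot[OF \<theta>h, of lam p] L Wnn by simp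
  qed
  define x where "x = F (\<theta> L) - F (\<theta> 0)"
  have Fmono: "F a \<le> F b" if "a \<le> b" for a b
    unfolding F_def by (rule prim_pot_mono[OF that])
  have Fstrict: "F a < F b" if "a < b" "0 \<le> a" "b \<le> pi" for a b
  proof (rule DERIV_pos_imp_increasing_open[OF that(1)])
    fix z assume z: "a < z" "z < b"
    then have "cos pi < cos z" using that by (intro cos_monotone_0_pi) auto
    then have "p * (- 1) < p * cos z" using p by (intro mult_strict_left_mono) auto
    then have "0 < pot lam p z" using p by (simp add: pot_def)
    then show "\<exists>y. (F has_real_derivative y) (at z) \<and> 0 < y" using F by blast
  qed (use F in \<open>auto intro!: continuous_at_imp_continuous_on DERIV_isCont\<close>)
  have F0: "F 0 = 0" by (simp add: F_def)
  have Fpi: "0 < F pi" using Fstrict[of 0 pi] F0 by simp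
  have x: "0 \<le> x" "x \<le> F pi"
    using Fmono[of 0 "\<theta> 0"] Fmono[of "\<theta> L" pi] Fmono[of "\<theta> 0" "\<theta> L"] rng[of 0] rng[of L] \<theta>strict[of 0 L] L
    by (auto simp: x_def F0)
  define y where "y = x + 2 * (of_int n * F pi)"
  have \<phi>x: "F (\<phi> M) - F (\<phi> 0) = y"
    unfolding \<phi> x_def y_def F_def prim_pot_shift_int by simp
  have e\<phi>: "path_energy lam M g + p * integral {0..L} (\<lambda>t. cos (\<theta> t))
      = integral {0..M} (\<lambda>t. (g t)\<^sup>2 + (pot lam p (\<phi> t))\<^sup>2)"
    using path_energy_pot[OF \<phi>(1), of lam p] M Wnn X by simp
  note mm = modica_mortola[OF \<phi>(1) less_imp_le[OF M] F continuous_on_pot]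
  have mmp: "2 * y \<le> integral {0..M} (\<lambda>t. (g t)\<^sup>2 + (pot lam p (\<phi> t))\<^sup>2)"
    using mm(2)[of 1] \<phi>x by simp
  have mmm: "- 2 * y \<le> integral {0..M} (\<lambda>t. (g t)\<^sup>2 + (pot lam p (\<phi> t))\<^sup>2)"
    using mm(2)[of "-1"] \<phi>x by simp
  have npos: "x < y" if "n \<ge> 1"
    using that Fpi by (simp add: y_def)
  have nneg: "2 * F pi - x \<le> - y" if "n \<le> -1"
  proof -
    have "of_int n * F pi \<le> (-1) * F pi" using that Fpi by (intro mult_right_mono) auto
    then show ?thesis unfolding y_def by linarith
  qed
  have nneg2: "2 * F pi - x < - y" if "n < -1"
  proof -
    have "n \<le> -2" using that by simp
    then have "of_int n \<le> (-2::real)" by linarith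
    then have "of_int n * F pi \<le> (-2) * F pi" using Fpi by (intro mult_right_mono) auto
    then show ?thesis using Fpi unfolding y_def by linarith
  qed
  have yx: "y = x" if "n = 0" using that by (simp add: y_def)
  show "path_energy lam L k \<le> path_energy lam M g"
  proof -
    consider "n \<ge> 1" | "n \<le> -1" | "n = 0" by linarith
    then show ?thesis
      using e\<theta> e\<phi> mmp mmm npos nneg yx x unfolding x_def[symmetric] by cases linarith+
  qed
  assume eq: "path_energy lam M g \<le> path_energy lam L k"
  have concl: "M = L \<and> (\<forall>t\<in>{0..L}. u t = \<theta> t)"
    if u: "ac_on 0 M u (\<lambda>t. pot lam p (u t))" "u 0 = \<theta> 0" "u M = \<theta> L" for u
  proof -
    have umono: "u s \<le> u t" if "0 \<le> s" "s \<le> t" "t \<le> M" for s t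
      by (rule ac_on_mono[OF u(1) _ that]) simp
    have ur: "u t \<in> {0..pi}" if "0 \<le> t" "t \<le> M" for t
      using umono[of 0 t] umono[of t M] that u rng[of 0] rng[of L] L by auto
    have eqT: "u t = \<theta> t" if "0 \<le> t" "t \<le> min M L" for t
    proof (rule forward_uniqueness[of 0 "min M L" u "pot lam p" \<theta> "{0..pi}"])
      show "ac_on 0 (min M L) u (\<lambda>t. pot lam p (u t))" "ac_on 0 (min M L) \<theta> (\<lambda>t. pot lam p (\<theta> t))"
        using ac_on_subinterval[OF u(1)] ac_on_subinterval[OF \<theta>ac] by auto
    qed (use that ur rng u p pot_antimono[of p] in auto)
    have "M = L"
    proof (rule ccontr)
      \<comment> \<open>If \<open>M < L\<close>, the orbit would reach its final angle too early; if
        \<open>L < M\<close>, \<open>u\<close> would rest at an angle where its speed is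
        positive.\<close>
      assume "M \<noteq> L"
      then consider "M < L" | "L < M" by linarith
      then show False
      proof cases
        case 1
        then show ?thesis using eqT[of M] u \<theta>strict[of M L] M by auto
      next
        case 2
        have c: "u t = \<theta> L" if "L \<le> t" "t \<le> M" for t
          using eqT[of L] umono[of L t] umono[of t M] u that L 2 by auto
        have "integral {L..M} (\<lambda>t. pot lam p (u t)) = integral {L..M} (\<lambda>t. pot lam p (\<theta> L))"
          by (intro integral_cong) (use c in auto)
        then have "u M - u L = (M - L) * pot lam p (\<theta> L)"
          using ac_on_increment[OF u(1), of L M] L 2 by simp
        moreover have "0 < pot lam p (\<theta> L)" using kw[of L] kpos[of L] L by simp
        ultimately show ?thesis using c[of L] c[of M] 2 by simp
      qed
    qed
    then show ?thesis using eqT by auto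
  qed
  have n0: "n = 0 \<or> (n = -1 \<and> x = F pi)"
  proof (rule ccontr)
    assume "\<not> ?thesis"
    then consider "n \<ge> 1" | "n < -1" | "n = -1" "x < F pi" using x by force
    then show False
    proof cases
      case 1
      then show ?thesis using npos[OF 1] mmp e\<theta> e\<phi> eq unfolding x_def[symmetric] by linarith
    next
      case 2
      then show ?thesis using nneg2[OF 2] mmm e\<theta> e\<phi> eq x unfolding x_def[symmetric] by linarith
    next
      case 3
      have "2 * F pi - x \<le> - y" using nneg 3 by simp
      then show ?thesis using 3 mmm e\<theta> e\<phi> eq x unfolding x_def[symmetric] by linarith
    qed
  qed
  then show "M = L \<and> (\<forall>t\<in>{0..L}. \<phi> t = \<theta> t)"
  proof
    assume "n = 0"
    have "ac_on 0 M \<phi> (\<lambda>t. 1 * pot lam p (\<phi> t))"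
      by (rule mm(3)) (use \<open>n = 0\<close> \<phi>x yx e\<theta> e\<phi> eq in \<open>auto simp: x_def\<close>)
    then show ?thesis using concl[of \<phi>] \<phi> \<open>n = 0\<close> by simp
  next
    assume n: "n = -1 \<and> x = F pi"
    have "F (\<theta> L) \<le> F pi" "0 \<le> F (\<theta> 0)"
      using Fmono[of "\<theta> L" pi] Fmono[of 0 "\<theta> 0"] rng[of 0] rng[of L] L F0 by auto
    then have "F (\<theta> L) = F pi" "F (\<theta> 0) = 0" using n by (auto simp: x_def)
    then have \<theta>e: "\<theta> L = pi" "\<theta> 0 = 0"
      using Fstrict[of "\<theta> L" pi] Fstrict[of 0 "\<theta> 0"] rng[of 0] rng[of L] L F0 by force+
    have "ac_on 0 M \<phi> (\<lambda>t. (-1) * pot lam p (\<phi> t))"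
      by (rule mm(3)) (use n \<phi>x e\<theta> e\<phi> eq in \<open>auto simp: x_def y_def\<close>)
    then have "ac_on 0 M (\<lambda>t. - \<phi> t) (\<lambda>t. - ((-1) * pot lam p (\<phi> t)))"
      by (rule ac_on_minus)
    then have "ac_on 0 M (\<lambda>t. - \<phi> t) (\<lambda>t. pot lam p (- \<phi> t))"
      by (simp add: pot_def)
    moreover have "- \<phi> 0 = \<theta> 0" unfolding \<phi>(2) \<theta>e by simp
    moreover have "- \<phi> M = \<theta> L" unfolding \<phi>(3) \<theta>e using n by simp
    ultimately have "M = L \<and> (\<forall>t\<in>{0..L}. - \<phi> t = \<theta> t)"
      by (rule concl[of "\<lambda>t. - \<phi> t"])
    then have c: "M = L" "\<forall>t\<in>{0..L}. - \<phi> t = \<theta> t"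
      by blast+
    \<comment> \<open>The mirror image is displaced across the axis by the opposite amount, and that
      amount is positive for the orbit.\<close>
    have "integral {0..M} (\<lambda>t. sin (\<phi> t)) = integral {0..L} (\<lambda>t. - sin (\<theta> t))"
      unfolding c(1)
    proof (rule integral_cong)
      fix t assume "t \<in> {0..L}"
      then have "\<theta> t = - \<phi> t" using c(2) by simp
      then show "sin (\<phi> t) = - sin (\<theta> t)" by simp
    qed
    then have "integral {0..L} (\<lambda>t. sin (\<theta> t)) = 0" using Y by simp
    moreover have "integral {0..L} (\<lambda>_. 0) < integral {0..L} (\<lambda>t. sin (\<theta> t))"
    proof (rule integral_less_real)
      show "continuous_on {0..L} (\<lambda>t. sin (\<theta> t))"
        by (intro continuous_intros ac_on_continuous[OF \<theta>(1)])
      fix t assume "t \<in> {0<..<L}"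
      then show "0 < sin (\<theta> t)"
        using \<theta>strict[of 0 t] \<theta>strict[of t L] \<theta>e by (intro sin_gt_zero) auto
    qed (use L in auto)
    ultimately show ?thesis by simp
  qed
qed

text \<open>A curvature without zeros has one sign. If it is negative, both curves are traversed
  backwards; subtracting \<open>2 * pi * n\<close> lets the competitor start at the angle of the
  reversed orbit, and its winding number becomes \<open>- n\<close>.\<close>

lemma orbit_minimal:
  assumes p: "0 < p" "p \<le> lam" and L: "0 < L" and M: "0 < M"
    and \<theta>: "ac_on 0 L \<theta> k" "continuous_on {0..L} k"
    and ode: "\<And>t. t \<in> {0..L} \<Longrightarrow> (k t)\<^sup>2 = lam + p * cos (\<theta> t)"
    and knz: "\<And>t. t \<in> {0..L} \<Longrightarrow> k t \<noteq> 0"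
    and rng: "\<And>t. t \<in> {0..L} \<Longrightarrow> \<theta> t \<in> {0..pi}"
    and \<phi>: "h1_on 0 M \<phi> g" "\<phi> 0 = \<theta> 0" "\<phi> M = \<theta> L + 2 * pi * of_int n"
    and X: "integral {0..M} (\<lambda>t. cos (\<phi> t)) = integral {0..L} (\<lambda>t. cos (\<theta> t))"
    and Y: "integral {0..M} (\<lambda>t. sin (\<phi> t)) = integral {0..L} (\<lambda>t. sin (\<theta> t))"
  shows "path_energy lam L k \<le> path_energy lam M g \<and>
    (path_energy lam M g \<le> path_energy lam L k \<longrightarrow> M = L \<and> (\<forall>t\<in>{0..L}. \<phi> t = \<theta> t))"
proof (cases "0 < k 0")
  case True
  have kpos: "0 < k t" if "t \<in> {0..L}" for t
  proof (rule ccontr)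
    assume "\<not> 0 < k t"
    then have "\<exists>s\<ge>0. s \<le> t \<and> k s = 0"
      using that True continuous_on_subset[OF \<theta>(2), of "{0..t}"] by (intro IVT2') auto
    then show False using knz that by force
  qed
  show ?thesis
    using orbit_minimal_increasing[OF p L M \<theta> ode kpos rng \<phi> X Y] by blast
next
  case False
  have kneg: "k t < 0" if "t \<in> {0..L}" for t
  proof (rule ccontr)
    assume "\<not> k t < 0"
    then have "\<exists>s\<ge>0. s \<le> t \<and> k s = 0"
      using that False continuous_on_subset[OF \<theta>(2), of "{0..t}"] by (intro IVT') auto
    then show False using knz that by force
  qed
  define \<psi> where "\<psi> t = \<phi> (M - t) - 2 * pi * of_int n" for t
  have per: "cos (x - 2 * pi * of_int n) = cos x" "sin (x - 2 * pi * of_int n) = sin x" for x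
    using cos_int_2pin[of n] sin_int_2pin[of n] by (simp_all add: cos_diff sin_diff)
  have h: "h1_on 0 M \<psi> (\<lambda>t. - g (M - t))"
    using h1_on_reverse[OF \<phi>(1)] ac_on_add_const[of 0 M "\<lambda>t. \<phi> (M - t)" "\<lambda>t. - g (M - t)" "- (2 * pi * of_int n)"]
    by (simp add: h1_on_def \<psi>_def[abs_def])
  have e: "path_energy lam L (\<lambda>t. - k (L - t)) = path_energy lam L k"
    "path_energy lam M (\<lambda>t. - g (M - t)) = path_energy lam M g"
    using integral_reverse[of L "\<lambda>t. (k t)\<^sup>2"] integral_reverse[of M "\<lambda>t. (g t)\<^sup>2"] by (simp_all add: path_energy_def)
  have c: "continuous_on {0..L} (\<lambda>t. - k (L - t))"
    by (intro continuous_intros continuous_on_compose2[OF \<theta>(2)]) auto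
  have "path_energy lam L (\<lambda>t. - k (L - t)) \<le> path_energy lam M (\<lambda>t. - g (M - t)) \<and>
    (path_energy lam M (\<lambda>t. - g (M - t)) \<le> path_energy lam L (\<lambda>t. - k (L - t)) \<longrightarrow>
      M = L \<and> (\<forall>t\<in>{0..L}. \<psi> t = \<theta> (L - t)))"
    using orbit_minimal_increasing[OF p L M ac_on_reverse[OF \<theta>(1)] c _ _ _ h, of "-n"]
      ode kneg rng \<phi> X Y integral_reverse[of L "\<lambda>t. cos (\<theta> t)"] integral_reverse[of L "\<lambda>t. sin (\<theta> t)"]
      integral_reverse[of M "\<lambda>t. cos (\<phi> t)"] integral_reverse[of M "\<lambda>t. sin (\<phi> t)"]
    by (auto simp: \<psi>_def per)
  moreover have "\<forall>t\<in>{0..L}. \<phi> t = \<theta> t" if eq: "M = L" "\<forall>t\<in>{0..L}. \<psi> t = \<theta> (L - t)"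
  proof -
    have "\<phi> t = \<theta> t + 2 * pi * of_int n" if "t \<in> {0..L}" for t
      using eq(2)[rule_format, of "L - t"] that eq(1) by (simp add: \<psi>_def)
    from this[of 0] this show ?thesis using \<phi>(2) L by auto
  qed
  ultimately show ?thesis unfolding e by blast
qed

section \<open>Half periods of wavelike elasticae\<close>

text \<open>Tangent angle \<open>wth\<close> and curvature \<open>wk\<close> of \<open>wave_curve\<close> rescaled by \<open>1 / c\<close>, as functions of arc length.\<close>

definition warc :: "real \<Rightarrow> real \<Rightarrow> real" where
  "warc m x = 2 * arcsin (sqrt m * sin x)"

definition wth :: "real \<Rightarrow> real \<Rightarrow> real \<Rightarrow> real" where
  "wth c m s = warc m (am (c * s) m)"

definition wk :: "real \<Rightarrow> real \<Rightarrow> real \<Rightarrow> real" where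
  "wk c m s = 2 * c * sqrt m * cos (am (c * s) m)"

section \<open>The wave as a solution of the pendulum equation\<close>

context
  fixes m :: real
  assumes m: "0 < m" "m < 1"
begin

lemma sqrt_m_sin_bounds: "-1 < sqrt m * sin x" "sqrt m * sin x < 1"
proof -
  have "\<bar>sqrt m * sin x\<bar> \<le> sqrt m * 1"
    unfolding abs_mult using m by (intro mult_mono) auto
  also have "\<dots> < 1" using m by simp
  finally show "-1 < sqrt m * sin x" "sqrt m * sin x < 1" by auto
qed

lemma sin_half_warc: "sin (warc m x / 2) = sqrt m * sin x"
  using sqrt_m_sin_bounds[of x] by (simp add: warc_def)

lemma cos_half_warc: "cos (warc m x / 2) = ellR m x"
  using sqrt_m_sin_bounds[of x] m by (simp add: warc_def cos_arcsin ellR_def power_mult_distrib)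

lemma warc_bounds: "- pi < warc m x" "warc m x < pi"
  using arcsin_lt_bounded[OF sqrt_m_sin_bounds[of x]] by (auto simp: warc_def)

lemma cos_warc: "cos (warc m x) = 1 - 2 * m * (sin x)\<^sup>2"
  using cos_double_sin[of "warc m x / 2"] m by (simp add: sin_half_warc power_mult_distrib)

lemma sin_warc: "sin (warc m x) = 2 * sqrt m * sin x * ellR m x"
  using sin_double[of "warc m x / 2"] by (simp add: sin_half_warc cos_half_warc)

lemma DERIV_warc: "(warc m has_real_derivative 2 * sqrt m * cos x / ellR m x) (at x)"
proof -
  have e: "sqrt (1 - (sqrt m * sin x)\<^sup>2) = ellR m x"
    using m by (simp add: ellR_def power_mult_distrib)
  have "((\<lambda>x. arcsin (sqrt m * sin x)) has_real_derivative
      inverse (sqrt (1 - (sqrt m * sin x)\<^sup>2)) * (sqrt m * cos x)) (at x)"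
    by (rule DERIV_chain2[OF DERIV_arcsin]) (use sqrt_m_sin_bounds in \<open>auto intro!: derivative_eq_intros\<close>)
  from DERIV_cmult[OF this, of 2] show ?thesis
    unfolding warc_def[abs_def] e by (simp add: field_simps)
qed

lemma warc_0 [simp]: "warc m 0 = 0" and warc_pi [simp]: "warc m pi = 0"
  by (simp_all add: warc_def)

lemma DERIV_am_scaled: "((\<lambda>s. am (c * s) m) has_real_derivative ellR m (am (c * s) m) * c) (at s)"
  by (rule DERIV_chain2[OF DERIV_am[OF m]]) (auto intro!: derivative_eq_intros)

lemma DERIV_wth: "(wth c m has_real_derivative wk c m s) (at s)"
proof -
  have "((\<lambda>s. warc m (am (c * s) m)) has_real_derivative
     2 * sqrt m * cos (am (c * s) m) / ellR m (am (c * s) m) * (ellR m (am (c * s) m) * c)) (at s)"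
    by (rule DERIV_chain2[OF DERIV_warc DERIV_am_scaled])
  then show ?thesis
    using ellR_bounds(1)[OF m, of "am (c * s) m"] by (simp add: wth_def[abs_def] wk_def mult_ac)
qed

text \<open>The first integral of the pendulum. It identifies \<open>lam\<close> with
  \<open>2 * c\<^sup>2 * (2 * m - 1)\<close> and \<open>p\<close> with
  \<open>2 * c\<^sup>2\<close>.\<close>

lemma wk_sq: "(wk c m s)\<^sup>2 = 2 * c\<^sup>2 * (2 * m - 1) + 2 * c\<^sup>2 * cos (wth c m s)"
  using m by (simp add: wk_def wth_def cos_warc power_mult_distrib cos_squared_eq algebra_simps)

lemma DERIV_wk: "(wk c m has_real_derivative - c\<^sup>2 * sin (wth c m s)) (at s)"
proof -
  have "((\<lambda>s. 2 * c * sqrt m * cos (am (c * s) m)) has_real_derivative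
     2 * c * sqrt m * (- sin (am (c * s) m) * (ellR m (am (c * s) m) * c))) (at s)"
    by (intro DERIV_cmult DERIV_chain2[OF DERIV_cos] DERIV_am_scaled)
  then show ?thesis
    by (simp add: wk_def[abs_def] wth_def sin_warc power2_eq_square mult_ac)
qed

lemma continuous_on_wth: "continuous_on S (wth c m)"
  by (intro continuous_at_imp_continuous_on ballI DERIV_isCont[OF DERIV_wth])

lemma continuous_on_wk: "continuous_on S (wk c m)"
  by (intro continuous_at_imp_continuous_on ballI DERIV_isCont[OF DERIV_wk])

lemma ac_on_wth: "ac_on a b (wth c m) (wk c m)"
  by (rule ac_on_DERIV[OF DERIV_wth continuous_on_wk])

lemma h1_on_wth: "h1_on a b (wth c m) (wk c m)"
  unfolding h1_on_def
  by (intro conjI ac_on_wth integrable_continuous_real continuous_intros continuous_on_wk)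

lemma wth_0 [simp]: "wth c m 0 = 0"
  by (simp add: wth_def am_0[OF m])

lemma integral_cos_wth:
  assumes "c \<noteq> 0" "a \<le> b"
  shows "((\<lambda>s. cos (wth c m s)) has_integral
     (2 * ellE (am (c * b) m) m - c * b) / c - (2 * ellE (am (c * a) m) m - c * a) / c) {a..b}"
proof (rule has_integral_DERIV[OF assms(2)])
  fix s
  have "((\<lambda>s. (2 * ellE (am (c * s) m) m - c * s) / c) has_real_derivative
      (2 * (ellR m (am (c * s) m) * (ellR m (am (c * s) m) * c)) - c * 1) / c) (at s)"
    by (intro DERIV_cdivide DERIV_diff DERIV_cmult DERIV_chain2[OF DERIV_ellE] DERIV_am_scaled DERIV_ident)
  moreover have "(2 * (ellR m (am (c * s) m) * (ellR m (am (c * s) m) * c)) - c * 1) / c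
      = 2 * (ellR m (am (c * s) m))\<^sup>2 - 1"
    using assms by (simp add: field_simps power2_eq_square)
  moreover have "2 * (ellR m (am (c * s) m))\<^sup>2 - 1 = cos (wth c m s)"
    using ellR_bounds(3)[OF m, of "am (c * s) m"] by (simp add: wth_def cos_warc)
  ultimately show "((\<lambda>s. (2 * ellE (am (c * s) m) m - c * s) / c) has_real_derivative cos (wth c m s)) (at s)"
    by (simp only:)
qed

lemma integral_sin_wth:
  assumes "c \<noteq> 0" "a \<le> b"
  shows "((\<lambda>s. sin (wth c m s)) has_integral
     (- 2 * sqrt m * cos (am (c * b) m)) / c - (- 2 * sqrt m * cos (am (c * a) m)) / c) {a..b}"
proof (rule has_integral_DERIV[OF assms(2)])
  fix s
  have "((\<lambda>s. (- 2 * sqrt m * cos (am (c * s) m)) / c) has_real_derivative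
      (- 2 * sqrt m * (- sin (am (c * s) m) * (ellR m (am (c * s) m) * c))) / c) (at s)"
    by (intro DERIV_cdivide DERIV_cmult DERIV_chain2[OF DERIV_cos] DERIV_am_scaled)
  then show "((\<lambda>s. (- 2 * sqrt m * cos (am (c * s) m)) / c) has_real_derivative sin (wth c m s)) (at s)"
    using assms by (simp add: wth_def sin_warc mult_ac)
qed

lemma integral_wk_sq:
  assumes "0 < c"
  shows "integral {0..2 * complete_K m / c} (\<lambda>s. (wk c m s)\<^sup>2) = 8 * c * ellH m"
proof -
  define S where "S = 2 * complete_K m / c"
  have S: "0 \<le> S" "c * S = 2 * complete_K m" using assms complete_K_pos[OF m] by (auto simp: S_def)
  have i: "((\<lambda>s. 2 * c\<^sup>2 * (2 * m - 1) + 2 * c\<^sup>2 * cos (wth c m s)) has_integral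
     S * (2 * c\<^sup>2 * (2 * m - 1)) +
     2 * c\<^sup>2 * ((2 * ellE (am (c * S) m) m - c * S) / c - (2 * ellE (am (c * 0) m) m - c * 0) / c)) {0..S}"
    using has_integral_const_real[of "2 * c\<^sup>2 * (2 * m - 1)" 0 S] S assms
    by (intro has_integral_add has_integral_mult_right integral_cos_wth) auto
  have "integral {0..S} (\<lambda>s. (wk c m s)\<^sup>2) = S * (2 * c\<^sup>2 * (2 * m - 1)) +
     2 * c\<^sup>2 * ((2 * (2 * complete_E m) - c * S) / c)"
    unfolding wk_sq using integral_unique[OF i] by (simp add: S am_2K[OF m] ellE_pi[OF m] am_0[OF m])
  also have "\<dots> = (c * S) * (2 * c * (2 * m - 1)) + 2 * c * (4 * complete_E m - c * S)"
    using assms by (simp add: power2_eq_square)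
  also have "\<dots> = 8 * c * ellH m"
    unfolding S(2) by (simp add: ellH_eq[OF m] algebra_simps)
  finally show ?thesis by (simp add: S_def)
qed

text \<open>Substituting \<open>warc m x\<close> for the angle turns the potential into
  \<open>2 * C * sqrt m * cos x\<close> and the integral into that of \<open>ellH\<close>. In the
  application \<open>m\<close> encodes the largest angle of the competitor and \<open>C\<close> its
  multiplier.\<close>

lemma prim_pot_warc:
  assumes "0 < C"
  shows "pot_prim (2 * C\<^sup>2 * (2 * m - 1)) (2 * C\<^sup>2) (warc m (pi / 2)) = 4 * C * ellH m"
proof -
  let ?w = "pot (2 * C\<^sup>2 * (2 * m - 1)) (2 * C\<^sup>2)"
  have "((\<lambda>x. (4 * C) * (m * (cos x)\<^sup>2 / ellR m x)) has_integral
      primitive ?w (warc m (pi/2)) - primitive ?w (warc m 0)) {0..pi/2}"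
  proof (rule has_integral_DERIV)
    fix x assume x: "0 \<le> x" "x \<le> pi/2"
    have c: "0 \<le> cos x" using x by (intro cos_ge_zero) auto
    have "2 * C\<^sup>2 * (2 * m - 1) + 2 * C\<^sup>2 * cos (warc m x) = (2 * C * sqrt m * cos x)\<^sup>2"
      using m by (simp add: cos_warc power_mult_distrib cos_squared_eq algebra_simps)
    then have w: "?w (warc m x) = 2 * C * sqrt m * cos x"
      using c assms m unfolding pot_def by simp
    have "((\<lambda>x. primitive ?w (warc m x)) has_real_derivative
        ?w (warc m x) * (2 * sqrt m * cos x / ellR m x)) (at x)"
      by (rule DERIV_chain2[OF DERIV_prim_pot DERIV_warc])
    moreover have "?w (warc m x) * (2 * sqrt m * cos x / ellR m x) = (4 * C) * (m * (cos x)\<^sup>2 / ellR m x)"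
      unfolding w using m by (simp add: power2_eq_square)
    ultimately show "((\<lambda>x. primitive ?w (warc m x)) has_real_derivative
       (4 * C) * (m * (cos x)\<^sup>2 / ellR m x)) (at x)" by (simp only:)
  qed auto
  moreover have "((\<lambda>x. (4 * C) * (m * (cos x)\<^sup>2 / ellR m x)) has_integral (4 * C) * ellH m) {0..pi/2}"
    unfolding ellH_def using ellR_bounds(1)[OF m]
    by (intro has_integral_mult_right integrable_integral integrable_continuous_real continuous_intros)
       (auto simp: less_imp_neq[symmetric])
  ultimately have "primitive ?w (warc m (pi/2)) - primitive ?w (warc m 0) = (4 * C) * ellH m"
    by (rule has_integral_unique)
  then show ?thesis by simp
qed

lemma am_reflect: "am (2 * complete_K m - u) m = pi - am u m"
proof -
  have "2 * complete_K m - u = ellF (pi - am u m) m"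
    using ellF_reflect[OF m, of "am u m"] by (simp add: ellF_am[OF m])
  then show ?thesis by (simp add: am_ellF[OF m])
qed

end

text \<open>On the separatrix, where \<open>lam\<close> equals the multiplier, the half-angle
  formula makes the radicand a square and the primitive elementary.\<close>

lemma prim_pot_critical:
  assumes "0 \<le> s"
  shows "pot_prim (2 * s\<^sup>2) (2 * s\<^sup>2) pi = 4 * s"
proof -
  let ?w = "pot (2 * s\<^sup>2) (2 * s\<^sup>2)"
  have "((\<lambda>x. 2 * s * cos (x / 2)) has_integral primitive ?w pi - primitive ?w 0) {0..pi}"
  proof (rule has_integral_DERIV)
    fix x assume x: "0 \<le> x" "x \<le> pi"
    have c: "0 \<le> cos (x/2)" using x by (intro cos_ge_zero) auto
    have "2 * s\<^sup>2 + 2 * s\<^sup>2 * cos x = (2 * s * cos (x/2))\<^sup>2"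
    proof -
      have "cos x = 2 * (cos (x/2))\<^sup>2 - 1" using cos_double_cos[of "x/2"] by simp
      then show ?thesis by algebra
    qed
    then have "?w x = 2 * s * cos (x/2)" using c assms unfolding pot_def by simp
    then show "(primitive ?w has_real_derivative 2 * s * cos (x / 2)) (at x)"
      using DERIV_prim_pot[of "2 * s\<^sup>2" "2 * s\<^sup>2" x] by (simp only:)
  qed auto
  moreover have "((\<lambda>x. 2 * s * cos (x / 2)) has_integral 4 * s * sin (pi/2) - 4 * s * sin (0/2)) {0..pi}"
    by (rule has_integral_DERIV) (auto intro!: derivative_eq_intros)
  ultimately have "primitive ?w pi - primitive ?w 0 = 4 * s * sin (pi/2) - 4 * s * sin (0/2)"
    by (rule has_integral_unique)
  then show ?thesis by simp
qed

section \<open>The half period against its competitors\<close>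

context
  fixes c m S \<omega> X lam p :: real
  assumes c: "0 < c" and m: "1/2 < m" "m < 1" and W: "ellW m \<le> 0"
  defines "S \<equiv> 2 * complete_K m / c" and "\<omega> \<equiv> warc m (pi / 2)" and "X \<equiv> 2 * ellW m / c"
    and "lam \<equiv> 2 * c\<^sup>2 * (2 * m - 1)" and "p \<equiv> 2 * c\<^sup>2"
begin

lemma wave_param_bounds: "0 < m" "m < 1" using m by auto

lemma half_period_pos: "0 < S" using complete_K_pos[OF wave_param_bounds] c by (simp add: S_def)

lemma multiplier_pos: "0 < p" using c by (simp add: p_def)

lemma omega_bounds: "0 < \<omega>" "\<omega> < pi" "cos \<omega> < 0"
proof -
  show "cos \<omega> < 0" using m by (simp add: \<omega>_def cos_warc[OF wave_param_bounds])
  show "\<omega> < pi" using warc_bounds(2)[OF wave_param_bounds] by (simp add: \<omega>_def)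
  show "0 < \<omega>" using m arcsin_less_arcsin[of 0 "sqrt m"] by (simp add: \<omega>_def warc_def)
qed

lemma wth_half: "wth c m (S/2) = \<omega>"
proof -
  have "c * (S/2) = complete_K m" using c by (simp add: S_def)
  then show ?thesis unfolding wth_def \<omega>_def by (simp only: am_K[OF wave_param_bounds])
qed

lemma wth_S [simp]: "wth c m S = 0"
  using c am_2K[OF wave_param_bounds] warc_pi[OF wave_param_bounds] by (simp add: wth_def S_def)

lemma wth_symmetric: "wth c m (S - t) = wth c m t"
  using am_reflect[OF wave_param_bounds, of "c * t"] c by (simp add: wth_def S_def warc_def right_diff_distrib)

lemma am_range:
  assumes "0 \<le> t" "t \<le> S/2"
  shows "0 \<le> am (c * t) m" "am (c * t) m \<le> pi / 2" "t < S/2 \<Longrightarrow> am (c * t) m < pi / 2"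
proof -
  have "c * t \<le> complete_K m" "t < S/2 \<Longrightarrow> c * t < complete_K m" "0 \<le> c * t"
    using assms c by (auto simp: S_def field_simps)
  then show "0 \<le> am (c * t) m" "am (c * t) m \<le> pi / 2" "t < S/2 \<Longrightarrow> am (c * t) m < pi / 2"
    using am_strict_mono[OF wave_param_bounds, of 0 "c * t"] am_strict_mono[OF wave_param_bounds, of "c * t" "complete_K m"]
      am_0[OF wave_param_bounds] am_K[OF wave_param_bounds] by (auto simp: order_le_less)
qed

lemma wth_range:
  assumes "0 \<le> t" "t \<le> S/2"
  shows "0 \<le> wth c m t" "wth c m t \<le> \<omega>" "t < S/2 \<Longrightarrow> wth c m t < \<omega>"
proof -
  note a = am_range[OF assms]
  have s0: "0 \<le> sin (am (c * t) m)" using a by (intro sin_ge_zero) auto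
  have b: "-1 \<le> sqrt m * sin (am (c * t) m)" "sqrt m * sin (am (c * t) m) \<le> 1"
    using sqrt_m_sin_bounds[OF wave_param_bounds, of "am (c * t) m"] by auto
  show "0 \<le> wth c m t"
    unfolding wth_def warc_def using s0 b m arcsin_le_arcsin[of 0 "sqrt m * sin (am (c * t) m)"] by simp
  have sm: "sqrt m \<le> 1" using m by simp
  have "sqrt m * sin (am (c * t) m) \<le> sqrt m * 1" using m by (intro mult_left_mono) auto
  then show "wth c m t \<le> \<omega>"
    unfolding wth_def warc_def \<omega>_def using b sm by (auto intro!: arcsin_le_arcsin)
  assume "t < S/2"
  then have "sin (am (c * t) m) < sin (pi/2)" using a by (intro sin_monotone_2pi) auto
  then have "sqrt m * sin (am (c * t) m) < sqrt m * 1" using m by (intro mult_strict_left_mono) auto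
  then show "wth c m t < \<omega>"
    unfolding wth_def warc_def \<omega>_def using b sm by (auto intro!: arcsin_less_arcsin)
qed

lemma wk_eq_pot:
  assumes "0 \<le> t" "t \<le> S/2"
  shows "wk c m t = pot lam p (wth c m t)"
proof -
  have "0 \<le> cos (am (c * t) m)" using am_range[OF assms] by (intro cos_ge_zero) auto
  then have "0 \<le> wk c m t" using c m by (simp add: wk_def)
  then show ?thesis
    unfolding pot_def lam_def p_def wk_sq[OF wave_param_bounds, symmetric] by simp
qed

lemma pot_omega: "pot lam p \<omega> = 0"
  unfolding pot_def lam_def p_def \<omega>_def cos_warc[OF wave_param_bounds] by (simp add: algebra_simps)

text \<open>The potential has a square-root zero at \<open>\<omega>\<close>, so an orbit can arrive
  there in finite time and rest. \<open>wstop\<close> starts at 0 and rests from its arrival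
  on.\<close>

definition wstop :: "real \<Rightarrow> real" where
  "wstop t = wth c m (min t (S/2))"

lemma ac_on_wstop:
  assumes "0 \<le> T"
  shows "ac_on 0 T wstop (\<lambda>t. pot lam p (wstop t))"
proof -
  define T1 where "T1 = max T (S/2)"
  have "ac_on 0 (S/2) wstop (\<lambda>t. pot lam p (wstop t))"
    by (rule ac_on_cong[OF ac_on_wth[OF wave_param_bounds, of 0 "S/2" c]]) (auto simp: wstop_def wk_eq_pot)
  moreover have "ac_on (S/2) T1 wstop (\<lambda>t. pot lam p (wstop t))"
    by (rule ac_on_cong[OF ac_on_const[of _ _ \<omega>]]) (auto simp: wstop_def wth_half pot_omega)
  ultimately have "ac_on 0 T1 wstop (\<lambda>t. pot lam p (wstop t))"
    by (rule ac_on_combine) (use half_period_pos in \<open>auto simp: T1_def\<close>)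
  then show ?thesis by (rule ac_on_subinterval) (auto simp: T1_def)
qed

text \<open>The potential decreases on \<open>{0..\<omega>}\<close>, so
  \<open>forward_uniqueness\<close> applies despite the square-root zero. The lower bound for
  \<open>T\<close> holds because the wave stays below \<open>\<omega>\<close> before the time
  \<open>S/2\<close>.\<close>

lemma follow_wstop:
  assumes u: "ac_on 0 T u (\<lambda>t. pot lam p (u t))" "u 0 = 0" "u T = \<omega>" and T: "0 \<le> T"
  shows "S/2 \<le> T" "\<And>t. 0 \<le> t \<Longrightarrow> t \<le> T \<Longrightarrow> u t = wstop t"
proof -
  have r: "u t \<in> {0..\<omega>}" if "0 \<le> t" "t \<le> T" for t
    using ac_on_mono[OF u(1), of 0 t] ac_on_mono[OF u(1), of t T] that u by auto
  show eq: "u t = wstop t" if "0 \<le> t" "t \<le> T" for t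
  proof (rule forward_uniqueness[OF u(1) ac_on_wstop[OF T], of "{0..\<omega>}"])
    show "pot lam p y \<le> pot lam p x" if "x \<in> {0..\<omega>}" "y \<in> {0..\<omega>}" "x \<le> y" for x y
      using that omega_bounds multiplier_pos by (intro pot_antimono) auto
    show "u t \<in> {0..\<omega>} \<and> wstop t \<in> {0..\<omega>}" if "0 \<le> t" "t \<le> T" for t
      using r[OF that] wth_range[of "min t (S/2)"] that half_period_pos by (auto simp: wstop_def)
  qed (use that u half_period_pos in \<open>auto simp: wstop_def wth_0[OF wave_param_bounds]\<close>)
  show "S/2 \<le> T"
  proof (rule ccontr)
    assume "\<not> S/2 \<le> T"
    then have "wth c m T < \<omega>" using wth_range(3)[of T] T by auto
    then show False using eq[of T] T u(3) \<open>\<not> S/2 \<le> T\<close> by (auto simp: wstop_def min_def)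
  qed
qed

text \<open>Resting for the time \<open>T - S/2\<close> changes the displacement at the rate
  \<open>cos \<omega>\<close>, which is negative; this is how the prescribed displacement excludes
  rest.\<close>

lemma integral_cos_wstop:
  assumes "S/2 \<le> T"
  shows "((\<lambda>t. cos (wstop t)) has_integral X / 2 + (T - S/2) * cos \<omega>) {0..T}"
proof -
  have "((\<lambda>t. cos (wth c m t)) has_integral X / 2) {0..S/2}"
  proof -
    have cS: "c * (S/2) = complete_K m" using c by (simp add: S_def)
    have e: "(2 * ellE (pi / 2) m - complete_K m) / c - (2 * ellE (am (c * 0) m) m - c * 0) / c = X / 2"
      using c by (simp add: am_0[OF wave_param_bounds] X_def ellW_def complete_E_def field_simps)
    show ?thesis
      using integral_cos_wth[OF wave_param_bounds, of c 0 "S/2", unfolded cS am_K[OF wave_param_bounds] e] c half_period_pos by simp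
  qed
  then have "((\<lambda>t. cos (wstop t)) has_integral X / 2) {0..S/2}"
    by (rule has_integral_eq[rotated]) (auto simp: wstop_def)
  moreover have "((\<lambda>t. cos (wstop t)) has_integral (T - S/2) * cos \<omega>) {S/2..T}"
  proof (rule has_integral_eq)
    show "((\<lambda>t. cos \<omega>) has_integral (T - S/2) * cos \<omega>) {S/2..T}"
      using has_integral_const_real[of "cos \<omega>" "S/2" T] assms by simp
  qed (auto simp: wstop_def min_def wth_half[symmetric])
  ultimately show ?thesis
    using half_period_pos assms by (intro has_integral_combine[of 0 "S/2"]) auto
qed

lemma integral_cos_full: "integral {0..S} (\<lambda>t. cos (wth c m t)) = X"
proof -
  have "c * S = 2 * complete_K m" using c by (simp add: S_def)
  then show ?thesis
    using integral_unique[OF integral_cos_wth[OF wave_param_bounds, of c 0 S]] c half_period_pos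
    by (simp add: am_2K[OF wave_param_bounds] am_0[OF wave_param_bounds] ellE_pi[OF wave_param_bounds] X_def ellW_def diff_divide_distrib)
qed

lemma integral_sin_full: "0 < integral {0..S} (\<lambda>t. sin (wth c m t))"
proof -
  have "c * S = 2 * complete_K m" using c by (simp add: S_def)
  then have "integral {0..S} (\<lambda>t. sin (wth c m t)) = 4 * sqrt m / c"
    using integral_unique[OF integral_sin_wth[OF wave_param_bounds, of c 0 S]] c half_period_pos
    by (simp add: am_2K[OF wave_param_bounds] am_0[OF wave_param_bounds])
  then show ?thesis using c m by simp
qed

text \<open>\<open>C\<close> is the scale at which the wave of parameter \<open>M\<close> has the
  same \<open>lam\<close> as the given one, and \<open>2 * C\<^sup>2\<close> is the multiplier for a
  competitor of parameter \<open>M\<close>. The left-hand side is the energy bound: four times the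
  primitive at the largest angle, minus the multiplier times \<open>X\<close>.\<close>

lemma wave_bound_scaled:
  assumes M: "1/2 < M" and C: "C = c * sqrt (2 * m - 1) / sqrt (2 * M - 1)"
  shows "16 * C * ellH M - 2 * C\<^sup>2 * X = 16 * (c * sqrt (2 * m - 1)) * wave_bound m M"
    and "lam = 2 * C\<^sup>2 * (2 * M - 1)"
proof -
  define r where "r = sqrt (2 * m - 1)"
  define R where "R = sqrt (2 * M - 1)"
  have r: "0 < r" "0 < R" "2 * M - 1 = R\<^sup>2" "2 * m - 1 = r\<^sup>2" using m M by (auto simp: r_def R_def)
  have CR: "C = c * r / R" using C by (simp add: r_def R_def)
  have "2 * C\<^sup>2 * X = 4 * c * r\<^sup>2 * ellW m / R\<^sup>2"
    unfolding CR X_def using c r by (simp add: power_mult_distrib power_divide power2_eq_square)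
  moreover have "16 * (c * r) * (ellW m * r / 4 / R\<^sup>2) = 4 * c * r\<^sup>2 * ellW m / R\<^sup>2"
    by (simp add: power2_eq_square)
  moreover have "16 * C * ellH M = 16 * (c * r) * (ellH M / R)" unfolding CR by simp
  moreover have "wave_bound m M = ellH M / R - ellW m * r / 4 / R\<^sup>2"
    using M by (simp add: wave_bound_def r_def R_def)
  ultimately show "16 * C * ellH M - 2 * C\<^sup>2 * X = 16 * (c * sqrt (2 * m - 1)) * wave_bound m M"
    unfolding r_def[symmetric] by (simp only: right_diff_distrib)
  show "lam = 2 * C\<^sup>2 * (2 * M - 1)"
    unfolding lam_def CR r(3,4) using r by (simp add: power_mult_distrib power_divide)
qed

text \<open>The squared curvature of the wave equals its potential, so the wave attains the bound at
  its own parameter, where \<open>C = c\<close>.\<close>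

lemma energy_full: "path_energy lam S (wk c m) = 16 * (c * sqrt (2 * m - 1)) * wave_bound m m"
proof -
  have "path_energy lam S (wk c m) + p * integral {0..S} (\<lambda>t. cos (wth c m t))
     = integral {0..S} (\<lambda>t. (wk c m t)\<^sup>2 + (pot lam p (wth c m t))\<^sup>2)"
    by (rule path_energy_pot[OF h1_on_wth[OF wave_param_bounds]])
       (use half_period_pos wk_sq[OF wave_param_bounds, of c] zero_le_power2[of "wk c m _"] in \<open>auto simp: lam_def p_def\<close>)
  also have "\<dots> = integral {0..S} (\<lambda>t. 2 * (wk c m t)\<^sup>2)"
  proof (rule integral_cong)
    fix t
    have "0 \<le> lam + p * cos (wth c m t)"
      using wk_sq[OF wave_param_bounds, of c t] zero_le_power2[of "wk c m t"] by (simp add: lam_def p_def)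
    then show "(wk c m t)\<^sup>2 + (pot lam p (wth c m t))\<^sup>2 = 2 * (wk c m t)\<^sup>2"
      using wk_sq[OF wave_param_bounds, of c t] by (simp add: pot_sq lam_def p_def)
  qed
  also have "\<dots> = 16 * c * ellH m"
    using integral_wk_sq[OF wave_param_bounds, of c] c by (simp add: S_def)
  finally show ?thesis
    using wave_bound_scaled(1)[of m c] m integral_cos_full by (simp add: p_def)
qed

text \<open>Rising from 0 to the largest angle and returning cost at least
  \<open>2 * F \<alpha>\<close> each, which yields \<open>wave_bound m M\<close>, and this has its
  strict minimum at \<open>M = m\<close>. In the equality case both branches are orbits that may
  rest at the top; comparing displacements shows that they do not.\<close>

lemma wave_full_positive:
  assumes \<Phi>: "h1_on 0 R \<Phi> G" "\<Phi> 0 = 0" "\<Phi> R = 0" and R: "0 < R"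
    and XR: "integral {0..R} (\<lambda>t. cos (\<Phi> t)) = X"
    and t1: "0 \<le> t1" "t1 \<le> R" and top: "\<And>t. 0 \<le> t \<Longrightarrow> t \<le> R \<Longrightarrow> \<bar>\<Phi> t\<bar> \<le> \<Phi> t1" and "\<Phi> t1 < pi"
  shows "path_energy lam S (wk c m) \<le> path_energy lam R G"
    and "path_energy lam R G \<le> path_energy lam S (wk c m) \<Longrightarrow>
      R = S \<and> (\<forall>t\<in>{0..S}. \<Phi> t = wth c m t)"
proof -
  define \<alpha> where "\<alpha> = \<Phi> t1"
  have cont: "continuous_on {0..R} (\<lambda>t. cos (\<Phi> t))"
    by (intro continuous_intros ac_on_continuous[OF h1_on_ac_on[OF \<Phi>(1)]])
  \<comment> \<open>If the angle stayed within pi/2, cos would be nonnegative along the competitor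
    and equal to 1 at its start, against \<open>X \<le> 0\<close>.\<close>
  have \<alpha>: "pi / 2 < \<alpha>" "\<alpha> < pi"
  proof (rule ccontr)
    assume "\<not> pi / 2 < \<alpha>"
    then have nn: "0 \<le> cos (\<Phi> t)" if "t \<in> {0..R}" for t
      using top[of t] that unfolding \<alpha>_def by (intro cos_ge_zero) auto
    then have "0 \<le> integral {0..R} (\<lambda>t. cos (\<Phi> t))"
      by (rule integral_nonneg[OF integrable_continuous_real[OF cont]])
    moreover have "X \<le> 0" using W c by (simp add: X_def divide_nonpos_pos)
    ultimately have "integral {0..R} (\<lambda>t. cos (\<Phi> t)) = 0" using XR by simp
    then have "((\<lambda>t. cos (\<Phi> t)) has_integral 0) (cbox 0 R)"
      using integrable_integral[OF integrable_continuous_real[OF cont]] by simp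
    then have "cos (\<Phi> 0) = 0"
      using has_integral_0_cbox_imp_0[of 0 R "\<lambda>t. cos (\<Phi> t)" 0] cont nn R by auto
    then show False using \<Phi> by simp
  qed (use assms in \<open>auto simp: \<alpha>_def\<close>)
  define M where "M = (sin (\<alpha> / 2))\<^sup>2"
  have M: "1/2 < M" "M < 1" "cos \<alpha> = 1 - 2 * M"
  proof -
    show c2: "cos \<alpha> = 1 - 2 * M" using cos_double_sin[of "\<alpha> / 2"] by (simp add: M_def)
    have "cos \<alpha> < 0" using \<alpha> cos_monotone_0_pi[of "pi/2" \<alpha>] by simp
    then show "1/2 < M" using c2 by simp
    have "cos pi < cos \<alpha>" using \<alpha> by (intro cos_monotone_0_pi) auto
    then show "M < 1" using c2 by simp
  qed
  have \<alpha>w: "\<alpha> = warc M (pi / 2)"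
  proof -
    have "0 \<le> sin (\<alpha>/2)" using \<alpha> by (intro sin_ge_zero) auto
    then show ?thesis using \<alpha> by (simp add: warc_def M_def arcsin_sin)
  qed
  \<comment> \<open>This choice makes \<open>lam + q * cos \<alpha> = 0\<close>, so the radicand is
    nonnegative at all angles of modulus at most \<open>\<alpha>\<close>.\<close>
  define C where "C = c * sqrt (2 * m - 1) / sqrt (2 * M - 1)"
  have C: "0 < C" using c m M by (simp add: C_def)
  define q where "q = 2 * C\<^sup>2"
  note wb = wave_bound_scaled[OF M(1) C_def]
  have q: "0 < q" "lam = q * (2 * M - 1)" using C wb(2) by (auto simp: q_def)
  have Wnn: "0 \<le> lam + q * cos (\<Phi> t)" if "0 \<le> t" "t \<le> R" for t
  proof -
    have "cos \<alpha> \<le> cos \<bar>\<Phi> t\<bar>"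
      using top[OF that] \<alpha> unfolding \<alpha>_def by (intro cos_monotone_0_pi_le) auto
    then have "q * (1 - 2 * M) \<le> q * cos (\<Phi> t)"
      unfolding M(3) cos_abs_real using q by (intro mult_left_mono) auto
    then show ?thesis using q(2) by (simp add: algebra_simps)
  qed
  define F where "F = pot_prim lam q"
  have F: "(F has_real_derivative pot lam q x) (at x)" for x
    unfolding F_def by (rule DERIV_prim_pot)
  have F0: "F 0 = 0" by (simp add: F_def)
  have F\<alpha>: "F \<alpha> = 4 * C * ellH M"
    unfolding F_def \<alpha>w using prim_pot_warc[of M C] M C wb(2) by (simp add: q_def)
  define I where "I a b = integral {a..b} (\<lambda>t. (G t)\<^sup>2 + (pot lam q (\<Phi> t))\<^sup>2)" for a b
  have I: "path_energy lam R G + q * X = I 0 R"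
    unfolding I_def using path_energy_pot[OF \<Phi>(1) _ Wnn] R XR by simp
  have h1: "h1_on 0 t1 \<Phi> G" and h2: "h1_on t1 R \<Phi> G"
    using h1_on_subinterval[OF \<Phi>(1)] t1 by auto
  note mm = modica_mortola[OF \<Phi>(1) less_imp_le[OF R] F continuous_on_pot, of 1]
  note mm1 = modica_mortola[OF h1 t1(1) F continuous_on_pot, of 1]
  note mm2 = modica_mortola[OF h2 t1(2) F continuous_on_pot, of "-1"]
  have split: "I 0 R = I 0 t1 + I t1 R"
    unfolding I_def
    by (rule integral_split[symmetric]) (use t1 mm(1) in auto)
  have b1: "2 * F \<alpha> \<le> I 0 t1" unfolding I_def using mm1(2) \<Phi> F0 by (simp add: \<alpha>_def)
  have b2: "2 * F \<alpha> \<le> I t1 R" unfolding I_def using mm2(2) \<Phi> F0 by (simp add: \<alpha>_def)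
  have lower: "16 * (c * sqrt (2 * m - 1)) * wave_bound m M \<le> path_energy lam R G"
    using b1 b2 split I F\<alpha> wb(1) by (simp add: q_def)
  have kpos: "0 < 16 * (c * sqrt (2 * m - 1))" using c m by simp
  have wmin: "wave_bound m m < wave_bound m M" if "M \<noteq> m"
    using wave_bound_strict_min[OF m W] M m that by (cases "M < m") auto
  show "path_energy lam S (wk c m) \<le> path_energy lam R G"
  proof (cases "M = m")
    case True
    then show ?thesis using lower energy_full by simp
  next
    case False
    then have "16 * (c * sqrt (2 * m - 1)) * wave_bound m m \<le> 16 * (c * sqrt (2 * m - 1)) * wave_bound m M"
      using wmin kpos by (intro mult_left_mono) auto
    then show ?thesis using lower energy_full by simp
  qed
  assume eq: "path_energy lam R G \<le> path_energy lam S (wk c m)"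
  have Mm: "M = m"
  proof (rule ccontr)
    assume "M \<noteq> m"
    then have "16 * (c * sqrt (2 * m - 1)) * wave_bound m m < 16 * (c * sqrt (2 * m - 1)) * wave_bound m M"
      using wmin kpos by (intro mult_strict_left_mono) auto
    then show False using lower energy_full eq by simp
  qed
  have Cc: "C = c" using m by (simp add: C_def Mm)
  have qp: "q = p" by (simp add: q_def p_def Cc)
  have \<alpha>\<omega>: "\<alpha> = \<omega>" by (simp add: \<alpha>w \<omega>_def Mm)
  have "I 0 t1 + I t1 R \<le> 4 * F \<alpha>"
    using eq energy_full split I F\<alpha> wb(1) by (simp add: q_def Mm)
  then have e1: "I 0 t1 \<le> 2 * F \<alpha>" and e2: "I t1 R \<le> 2 * F \<alpha>" using b1 b2 by auto
  have f1: "ac_on 0 t1 \<Phi> (\<lambda>t. pot lam p (\<Phi> t))"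
    using mm1(3) e1 \<Phi> F0 unfolding I_def qp by (simp add: \<alpha>_def)
  have f2: "ac_on t1 R \<Phi> (\<lambda>t. - pot lam p (\<Phi> t))"
    using mm2(3) e2 \<Phi> F0 unfolding I_def qp by (simp add: \<alpha>_def)
  have f3: "ac_on 0 (R - t1) (\<lambda>t. \<Phi> (R - t)) (\<lambda>t. pot lam p (\<Phi> (R - t)))"
    using ac_on_shift[OF ac_on_reflect[OF f2], of R] by simp
  have g1: "S/2 \<le> t1" "\<And>t. 0 \<le> t \<Longrightarrow> t \<le> t1 \<Longrightarrow> \<Phi> t = wstop t"
    using follow_wstop[OF f1 \<Phi>(2) _ t1(1)] \<alpha>\<omega> by (auto simp: \<alpha>_def)
  have g2: "S/2 \<le> R - t1" "\<And>t. 0 \<le> t \<Longrightarrow> t \<le> R - t1 \<Longrightarrow> \<Phi> (R - t) = wstop t"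
    using follow_wstop[OF f3] \<Phi>(3) t1 \<alpha>\<omega> by (auto simp: \<alpha>_def)
  have "integral {0..t1} (\<lambda>t. cos (\<Phi> t)) = X / 2 + (t1 - S/2) * cos \<omega>"
    using integral_unique[OF integral_cos_wstop[OF g1(1)]] g1(2)
      integral_cong[of "{0..t1}" "\<lambda>t. cos (\<Phi> t)" "\<lambda>t. cos (wstop t)"] by simp
  moreover have "integral {t1..R} (\<lambda>t. cos (\<Phi> t)) = X / 2 + (R - t1 - S/2) * cos \<omega>"
  proof -
    have "integral {t1..R} (\<lambda>t. cos (\<Phi> t)) = integral {-R..-t1} (\<lambda>t. cos (\<Phi> (-t)))"
      using Henstock_Kurzweil_Integration.integral_reflect_real[of R t1 "\<lambda>t. cos (\<Phi> t)"] by simp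
    also have "\<dots> = integral {-R+R..-t1+R} (\<lambda>t. cos (\<Phi> (-(t-R))))"
      by (rule integral_shift_real_interval[symmetric])
    also have "\<dots> = integral {0..R-t1} (\<lambda>t. cos (\<Phi> (R - t)))" by simp
    also have "\<dots> = integral {0..R-t1} (\<lambda>t. cos (wstop t))"
      using g2(2) by (intro integral_cong) auto
    also have "\<dots> = X / 2 + (R - t1 - S/2) * cos \<omega>"
      using integral_unique[OF integral_cos_wstop[OF g2(1)]] .
    finally show ?thesis .
  qed
  moreover have "integral {0..t1} (\<lambda>t. cos (\<Phi> t)) + integral {t1..R} (\<lambda>t. cos (\<Phi> t)) = X"
    using integral_split[OF t1 integrable_continuous_real[OF cont]] XR by simp
  \<comment> \<open>The resting times of the two branches add up to \<open>R - S\<close>.\<close>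
  ultimately have "(R - S) * cos \<omega> = 0" unfolding left_diff_distrib by linarith
  then have RS: "R = S" using omega_bounds by simp
  then have t1S: "t1 = S/2" using g1(1) g2(1) by simp
  show "R = S \<and> (\<forall>t\<in>{0..S}. \<Phi> t = wth c m t)"
  proof (intro conjI ballI RS)
    fix t assume t: "t \<in> {0..S}"
    show "\<Phi> t = wth c m t"
    proof (cases "t \<le> S/2")
      case True
      then show ?thesis using g1(2)[of t] t t1S by (simp add: wstop_def)
    next
      case False
      then have "\<Phi> (R - (S - t)) = wth c m (S - t)"
        using g2(2)[of "S - t"] t t1S RS by (simp add: wstop_def)
      then show ?thesis using RS by (simp add: wth_symmetric)
    qed
  qed
qed

text \<open>If the largest modulus is below pi, then \<open>n = 0\<close>, and a reflection makes
  the extreme angle positive. Otherwise the competitor reaches \<open>\<sigma> * pi\<close>. Its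
  start and its end are odd multiples of pi away from there, so each of the two parts costs at least
  \<open>2 * F pi\<close>, and by \<open>wave_bound_limit\<close> the total is strictly too
  large.\<close>

lemma wave_full:
  assumes \<Phi>: "h1_on 0 R \<Phi> G" "\<Phi> 0 = 0" "\<Phi> R = 2 * pi * of_int n" and R: "0 < R"
    and XR: "integral {0..R} (\<lambda>t. cos (\<Phi> t)) = integral {0..S} (\<lambda>t. cos (wth c m t))"
    and YR: "integral {0..R} (\<lambda>t. sin (\<Phi> t)) = integral {0..S} (\<lambda>t. sin (wth c m t))"
  shows "path_energy lam S (wk c m) \<le> path_energy lam R G \<and>
    (path_energy lam R G \<le> path_energy lam S (wk c m) \<longrightarrow>
      R = S \<and> (\<forall>t\<in>{0..S}. \<Phi> t = wth c m t))"
proof -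
  have cont: "continuous_on {0..R} \<Phi>" using ac_on_continuous[OF h1_on_ac_on[OF \<Phi>(1)]] .
  have "\<exists>t1\<in>{0..R}. \<forall>t\<in>{0..R}. \<bar>\<Phi> t\<bar> \<le> \<bar>\<Phi> t1\<bar>"
    using R by (intro continuous_attains_sup continuous_intros cont) auto
  then obtain t1 where t1: "0 \<le> t1" "t1 \<le> R" "\<And>t. 0 \<le> t \<Longrightarrow> t \<le> R \<Longrightarrow> \<bar>\<Phi> t\<bar> \<le> \<bar>\<Phi> t1\<bar>"
    by auto
  have reflected: "h1_on 0 R (\<lambda>t. \<sigma> * \<Phi> t) (\<lambda>t. \<sigma> * G t)" if "\<sigma> = 1 \<or> \<sigma> = -1" for \<sigma>
    using \<Phi>(1) h1_on_minus[OF \<Phi>(1)] that by auto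
  have e: "path_energy lam R (\<lambda>t. \<sigma> * G t) = path_energy lam R G" if "\<sigma> = 1 \<or> \<sigma> = -1" for \<sigma>
    using that by (auto simp: path_energy_def power_mult_distrib)
  show ?thesis
  proof (cases "\<bar>\<Phi> t1\<bar> < pi")
    case True
    obtain \<sigma> :: real where \<sigma>: "\<sigma> = 1 \<or> \<sigma> = -1" "\<sigma> * \<Phi> t1 = \<bar>\<Phi> t1\<bar>"
      by (metis abs_if mult_1 mult_minus1)
    have "n = 0"
    proof (rule ccontr)
      assume "n \<noteq> 0"
      then have "1 \<le> \<bar>of_int n :: real\<bar>" by linarith
      then have "2 * pi * 1 \<le> 2 * pi * \<bar>of_int n\<bar>" by (intro mult_left_mono) auto
      also have "\<dots> = \<bar>\<Phi> R\<bar>" using \<Phi>(3) by (simp add: abs_mult)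
      also have "\<dots> < pi" using t1(3)[of R] R True by simp
      finally show False by simp
    qed
    have sc: "cos (\<sigma> * x) = cos x" "sin (\<sigma> * x) = \<sigma> * sin x" "\<bar>\<sigma> * x\<bar> = \<bar>x\<bar>" for x using \<sigma> by auto
    have "\<sigma> * \<Phi> 0 = 0" "\<sigma> * \<Phi> R = 0" using \<Phi> \<open>n = 0\<close> by auto
    note w = wave_full_positive[OF reflected[OF \<sigma>(1)] this R _ t1(1,2), unfolded sc \<sigma>(2) e[OF \<sigma>(1)],
        OF XR[unfolded integral_cos_full] t1(3) True]
    have "\<sigma> = 1" if "R = S" "\<forall>t\<in>{0..S}. \<sigma> * \<Phi> t = wth c m t"
    proof (rule ccontr)
      assume "\<sigma> \<noteq> 1"
      then have \<sigma>': "\<sigma> = -1" using \<sigma> by simp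
      have "integral {0..S} (\<lambda>t. sin (\<Phi> t)) = integral {0..S} (\<lambda>t. - sin (wth c m t))"
      proof (rule integral_cong)
        fix t assume "t \<in> {0..S}"
        then have "wth c m t = - \<Phi> t" using that(2) \<sigma>' by simp
        then show "sin (\<Phi> t) = - sin (wth c m t)" by simp
      qed
      then show False using YR integral_sin_full that(1) by simp
    qed
    then show ?thesis using w by force
  next
    case False
    \<comment> \<open>Chosen so that \<open>lam = 2 * s\<^sup>2\<close>, the form that
      \<open>prim_pot_critical\<close> expects.\<close>
    define s where "s = c * sqrt (2 * m - 1)"
    have s: "0 < s" "lam = 2 * s\<^sup>2" using c m by (auto simp: s_def lam_def power_mult_distrib)
    define F where "F = pot_prim lam lam"
    have F: "(F has_real_derivative pot lam lam x) (at x)" for x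
      unfolding F_def by (rule DERIV_prim_pot)
    have Fpi: "F pi = 4 * s" unfolding F_def s(2) using s(1) by (intro prim_pot_critical) auto
    have Wnn: "0 \<le> lam + lam * cos x" for x
    proof -
      have "0 \<le> lam" using s by simp
      then show ?thesis using mult_left_mono[OF cos_ge_minus_one[of x], of lam] by simp
    qed
    have "\<exists>\<sigma> t2. (\<sigma> = 1 \<or> \<sigma> = (-1::real)) \<and> 0 \<le> t2 \<and> t2 \<le> R \<and> \<Phi> t2 = \<sigma> * pi"
    proof (cases "0 \<le> \<Phi> t1")
      case True
      then have "\<exists>t2\<ge>0. t2 \<le> t1 \<and> \<Phi> t2 = pi"
        using False \<Phi> t1 continuous_on_subset[OF cont, of "{0..t1}"] by (intro IVT') auto
      then obtain t2 where "0 \<le> t2" "t2 \<le> t1" "\<Phi> t2 = pi" by blast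
      then show ?thesis using t1 by (intro exI[of _ 1] exI[of _ t2]) auto
    next
      case n: False
      then have "\<exists>t2\<ge>0. t2 \<le> t1 \<and> \<Phi> t2 = - pi"
        using False \<Phi> t1 continuous_on_subset[OF cont, of "{0..t1}"] by (intro IVT2') auto
      then obtain t2 where "0 \<le> t2" "t2 \<le> t1" "\<Phi> t2 = - pi" by blast
      then show ?thesis using t1 by (intro exI[of _ "-1"] exI[of _ t2]) auto
    qed
    then obtain \<sigma> t2 where \<sigma>: "\<sigma> = 1 \<or> \<sigma> = (-1::real)" and t2: "0 \<le> t2" "t2 \<le> R" "\<Phi> t2 = \<sigma> * pi"
      by blast
    have F2: "F (\<Phi> t2) = \<sigma> * F pi" using \<sigma> by (auto simp: t2 F_def prim_pot_minus)
    have F0: "F (\<Phi> 0) = 0" by (simp add: \<Phi> F_def)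
    have FR: "F (\<Phi> R) = 2 * of_int n * F pi"
      unfolding \<Phi> F_def using prim_pot_shift_int[of lam lam 0 n] by simp
    define I where "I a b = integral {a..b} (\<lambda>t. (G t)\<^sup>2 + (pot lam lam (\<Phi> t))\<^sup>2)" for a b
    have I: "path_energy lam R G + lam * X = I 0 R"
      unfolding I_def using path_energy_pot[OF \<Phi>(1), of lam lam] R XR Wnn integral_cos_full by simp
    have h1: "h1_on 0 t2 \<Phi> G" and h2: "h1_on t2 R \<Phi> G"
      using h1_on_subinterval[OF \<Phi>(1)] t2 by auto
    have split: "I 0 R = I 0 t2 + I t2 R"
      unfolding I_def
      by (rule integral_split[symmetric])
         (use t2 modica_mortola(1)[OF \<Phi>(1) less_imp_le[OF R] F continuous_on_pot, of 1] in auto)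
    have b1: "2 * F pi \<le> I 0 t2"
      using modica_mortola(2)[OF h1 t2(1) F continuous_on_pot \<sigma>] \<sigma> F2 F0 by (auto simp: I_def)
    have b2: "2 * F pi \<le> I t2 R"
    proof -
      have b: "2 * \<tau> * (2 * of_int n * F pi - \<sigma> * F pi) \<le> I t2 R" if "\<tau> = 1 \<or> \<tau> = -1" for \<tau>
        using modica_mortola(2)[OF h2 t2(2) F continuous_on_pot that] F2 FR by (simp add: I_def)
      have "(1::real) \<le> \<bar>2 * of_int n - \<sigma>\<bar>"
      proof -
        have "(1::int) \<le> \<bar>2 * n - 1\<bar>" "(1::int) \<le> \<bar>2 * n + 1\<bar>" by presburger+
        then have "(1::real) \<le> \<bar>2 * of_int n - 1\<bar>" "(1::real) \<le> \<bar>2 * of_int n + 1\<bar>" by linarith+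
        then show ?thesis using \<sigma> by auto
      qed
      then have "1 * F pi \<le> \<bar>2 * of_int n - \<sigma>\<bar> * F pi" using Fpi s by (intro mult_right_mono) auto
      moreover have "2 * (\<bar>2 * of_int n - \<sigma>\<bar> * F pi) \<le> I t2 R"
        using b[of 1] b[of "-1"] by (cases "0 \<le> 2 * of_int n - \<sigma>") (auto simp: algebra_simps)
      ultimately show ?thesis by linarith
    qed
    have "16 * s \<le> path_energy lam R G + lam * X" using b1 b2 split I Fpi by simp
    moreover have "lam * X = 16 * s * (ellW m * sqrt (2 * m - 1) / 4)"
    proof -
      have "2 * m - 1 = (sqrt (2 * m - 1))\<^sup>2" using m by simp
      then show ?thesis unfolding lam_def X_def s_def using c by (simp add: power2_eq_square)
    qed
    ultimately have "16 * s * (1 - ellW m * sqrt (2 * m - 1) / 4) \<le> path_energy lam R G"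
      by (simp add: right_diff_distrib)
    moreover have "16 * s * wave_bound m m < 16 * s * (1 - ellW m * sqrt (2 * m - 1) / 4)"
      using wave_bound_limit[OF m W] s by (intro mult_strict_left_mono) auto
    ultimately show ?thesis using energy_full by (simp add: s_def)
  qed
qed

end

section \<open>Arcs of wavelike elasticae\<close>

text \<open>Exchanges the piece of length \<open>L\<close> that begins at \<open>a\<close> for
  \<open>f2\<close> on an interval of length \<open>M\<close>; \<open>f3\<close> resumes at
  \<open>a + L\<close>.\<close>

definition paste :: "real \<Rightarrow> real \<Rightarrow> real \<Rightarrow> (real \<Rightarrow> 'a) \<Rightarrow> (real \<Rightarrow> 'a) \<Rightarrow> (real \<Rightarrow> 'a) \<Rightarrow> real \<Rightarrow> 'a" where
  "paste a M L f1 f2 f3 t = (if t \<le> a then f1 t else if t \<le> a + M then f2 (t - a) else f3 (t - M + L))"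

lemma paste_comp: "h (paste a M L f1 f2 f3 t) = paste a M L (\<lambda>t. h (f1 t)) (\<lambda>t. h (f2 t)) (\<lambda>t. h (f3 t)) t"
  by (simp add: paste_def)

lemma has_integral_shift_real:
  fixes f :: "real \<Rightarrow> real"
  assumes "(f has_integral I) {a..b}"
  shows "((\<lambda>t. f (t - c)) has_integral I) {a+c..b+c}"
proof (cases "a \<le> b")
  case True
  then show ?thesis
    using has_integral_affinity[of f I a b 1 "-c"] assms by auto
next
  case False
  then show ?thesis using assms by (auto simp: has_integral_iff)
qed

lemma has_integral_paste:
  fixes f1 f2 f3 :: "real \<Rightarrow> real"
  assumes 1: "(f1 has_integral I1) {0..a}" and 2: "(f2 has_integral I2) {0..M}"
    and 3: "(f3 has_integral I3) {a+L..S}" and le: "0 \<le> a" "0 \<le> M" "a + L \<le> S"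
  shows "(paste a M L f1 f2 f3 has_integral I1 + I2 + I3) {0..S - L + M}"
proof -
  have neg: "negligible {a, a + M}" by simp
  have "(paste a M L f1 f2 f3 has_integral I1) {0..a}"
    by (rule has_integral_spike[OF neg _ 1]) (auto simp: paste_def)
  moreover have "(paste a M L f1 f2 f3 has_integral I2) {a..a+M}"
    by (rule has_integral_spike[OF neg _ has_integral_shift_real[OF 2, of a, simplified, folded add.commute[of a]]])
       (auto simp: paste_def)
  moreover have "(paste a M L f1 f2 f3 has_integral I3) {a+M..S-L+M}"
  proof -
    have e: "a + L + (M - L) = a + M" "S + (M - L) = S - L + M" by simp_all
    have "((\<lambda>t. f3 (t - (M - L))) has_integral I3) {a+M..S-L+M}"
      using has_integral_shift_real[OF 3, of "M - L"] unfolding e .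
    then show ?thesis
      by (rule has_integral_spike[OF neg, rotated]) (use le in \<open>auto simp: paste_def algebra_simps\<close>)
  qed
  ultimately have "(paste a M L f1 f2 f3 has_integral I1 + I2) {0..a+M}"
    "(paste a M L f1 f2 f3 has_integral I3) {a+M..S-L+M}"
    using le has_integral_combine[of 0 a "a+M"] by auto
  then show ?thesis
    using le has_integral_combine[of 0 "a+M" "S - L + M"] by auto
qed

lemma ac_on_paste:
  fixes u1 u2 u3 :: "real \<Rightarrow> real"
  assumes 1: "ac_on 0 a u1 v1" and 2: "ac_on 0 M u2 v2" and 3: "ac_on (a+L) S u3 v3"
    and le: "0 \<le> a" "0 \<le> M" "a + L \<le> S" and j: "u1 a = u2 0" "u2 M = u3 (a + L)"
  shows "ac_on 0 (S - L + M) (paste a M L u1 u2 u3) (paste a M L v1 v2 v3)"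
proof -
  have "ac_on 0 a (paste a M L u1 u2 u3) (paste a M L v1 v2 v3)"
    by (rule ac_on_cong[OF 1]) (auto simp: paste_def)
  moreover have "ac_on a (a+M) (paste a M L u1 u2 u3) (paste a M L v1 v2 v3)"
    by (rule ac_on_cong[OF ac_on_shift[OF 2, of a, simplified, folded add.commute[of a]]])
       (auto simp: paste_def j)
  moreover have "ac_on (a+M) (S-L+M) (paste a M L u1 u2 u3) (paste a M L v1 v2 v3)"
  proof -
    have e: "a + L + (M - L) = a + M" "S + (M - L) = S - L + M" by simp_all
    have s: "t - (M - L) = t - M + L" for t :: real by simp
    have "ac_on (a+M) (S-L+M) (\<lambda>t. u3 (t - M + L)) (\<lambda>t. v3 (t - M + L))"
      using ac_on_shift[OF 3, of "M - L"] unfolding e s .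
    then show ?thesis
    proof (rule ac_on_cong)
      fix t assume "a + M \<le> t"
      then show "paste a M L u1 u2 u3 t = u3 (t - M + L)"
        using le j by (cases "t = a + M") (auto simp: paste_def)
    qed (use le in \<open>auto simp: paste_def\<close>)
  qed
  ultimately have "ac_on 0 (a+M) (paste a M L u1 u2 u3) (paste a M L v1 v2 v3)"
    "ac_on (a+M) (S-L+M) (paste a M L u1 u2 u3) (paste a M L v1 v2 v3)"
    using le ac_on_combine[of 0 a _ _ "a+M"] by auto
  then show ?thesis by (rule ac_on_combine) (use le in auto)
qed

lemma integral_paste_same:
  fixes f f2 :: "real \<Rightarrow> real"
  assumes f: "continuous_on UNIV f" and f2: "f2 integrable_on {0..M}"
    and le: "0 \<le> a" "0 \<le> M" "0 \<le> L" "a + L \<le> S"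
  shows "paste a M L f f2 f integrable_on {0..S - L + M}"
    and "integral {0..S - L + M} (paste a M L f f2 f) - integral {0..S} f
      = integral {0..M} f2 - integral {0..L} (\<lambda>t. f (a + t))"
proof -
  have i: "f integrable_on {b..d}" for b d
    by (intro integrable_continuous_real continuous_on_subset[OF f]) auto
  have p: "(paste a M L f f2 f has_integral integral {0..a} f + integral {0..M} f2 + integral {a + L..S} f)
      {0..S - L + M}"
    by (intro has_integral_paste integrable_integral i f2 le)
  then show "paste a M L f f2 f integrable_on {0..S - L + M}" by blast
  have "integral {0..S} f = integral {0..a} f + (integral {a..a+L} f + integral {a + L..S} f)"
    using integral_split[of 0 a S f] integral_split[of a "a+L" S f] i le by auto
  moreover have "integral {a..a+L} f = integral {0..L} (\<lambda>t. f (a + t))"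
    using integral_shift_real_interval[of 0 a L "\<lambda>t. f (a + t)"] by (simp add: add.commute)
  ultimately show "integral {0..S - L + M} (paste a M L f f2 f) - integral {0..S} f
      = integral {0..M} f2 - integral {0..L} (\<lambda>t. f (a + t))"
    using p by (simp add: integral_unique)
qed

text \<open>Completing both curves to a full half period by the same arcs reduces the claim for an arc to
  the one for the half period.\<close>

lemma wave_minimal:
  assumes c: "0 < c" and m: "1/2 < m" "m < 1" and W: "ellW m \<le> 0"
    and s0: "0 \<le> s0" "s0 + L \<le> 2 * complete_K m / c" and L: "0 < L" and M: "0 < M"
    and \<phi>: "h1_on 0 M \<phi> g" "\<phi> 0 = wth c m s0" "\<phi> M = wth c m (s0 + L) + 2 * pi * of_int n"
    and X: "integral {0..M} (\<lambda>t. cos (\<phi> t)) = integral {0..L} (\<lambda>t. cos (wth c m (s0 + t)))"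
    and Y: "integral {0..M} (\<lambda>t. sin (\<phi> t)) = integral {0..L} (\<lambda>t. sin (wth c m (s0 + t)))"
    and lam: "lam = 2 * c\<^sup>2 * (2 * m - 1)"
  shows "path_energy lam L (\<lambda>t. wk c m (s0 + t)) \<le> path_energy lam M g \<and>
    (path_energy lam M g \<le> path_energy lam L (\<lambda>t. wk c m (s0 + t)) \<longrightarrow>
      M = L \<and> (\<forall>t\<in>{0..L}. \<phi> t = wth c m (s0 + t)))"
proof -
  have m01: "0 < m" "m < 1" using m by auto
  define S where "S = 2 * complete_K m / c"
  define R where "R = S - L + M"
  \<comment> \<open>The last arc is shifted by the winding that the competitor has accumulated, so
    that the pieces join continuously.\<close>
  define \<Phi> where "\<Phi> = paste s0 M L (wth c m) \<phi> (\<lambda>t. wth c m t + 2 * pi * of_int n)"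
  define G where "G = paste s0 M L (wk c m) g (wk c m)"
  have le: "0 \<le> s0" "0 \<le> M" "s0 + L \<le> S" "0 < R" using s0 L M by (auto simp: S_def R_def)
  have \<phi>c: "continuous_on {0..M} \<phi>" using ac_on_continuous[OF h1_on_ac_on[OF \<phi>(1)]] .
  have wc: "continuous_on A (wth c m)" "continuous_on A (wk c m)" for A
    using continuous_on_wth[OF m01] continuous_on_wk[OF m01] by auto
  have pasted: "integral {0..R} (\<lambda>t. h (\<Phi> t)) - integral {0..S} (\<lambda>t. h (wth c m t))
      = integral {0..M} (\<lambda>t. h (\<phi> t)) - integral {0..L} (\<lambda>t. h (wth c m (s0 + t)))"
    if h: "continuous_on UNIV h" "\<And>x. h (x + 2 * pi * of_int n) = h x" for h :: "real \<Rightarrow> real"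
    unfolding \<Phi>_def paste_comp[of h] R_def h(2) using le L
    by (intro integral_paste_same integrable_continuous_real continuous_on_compose2[OF h(1)] \<phi>c wc) auto
  have "(\<lambda>t. (g t)\<^sup>2) integrable_on {0..M}" using \<phi>(1) by (simp add: h1_on_def)
  note sq = integral_paste_same[OF continuous_on_power[OF wc(2)] this le(1,2) less_imp_le[OF L] le(3)]
  have energy: "(\<lambda>t. (G t)\<^sup>2) integrable_on {0..R}"
    "integral {0..R} (\<lambda>t. (G t)\<^sup>2) - integral {0..S} (\<lambda>t. (wk c m t)\<^sup>2)
      = integral {0..M} (\<lambda>t. (g t)\<^sup>2) - integral {0..L} (\<lambda>t. (wk c m (s0 + t))\<^sup>2)"
    unfolding G_def paste_comp[of "\<lambda>x. x\<^sup>2"] R_def by (rule sq)+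
  have "ac_on 0 R \<Phi> G"
    unfolding R_def \<Phi>_def G_def
    by (rule ac_on_paste[OF ac_on_wth[OF m01] h1_on_ac_on[OF \<phi>(1)] ac_on_add_const[OF ac_on_wth[OF m01]] le(1-3) \<phi>(2)[symmetric] \<phi>(3)])
  then have h: "h1_on 0 R \<Phi> G" using energy by (simp add: h1_on_def)
  have \<Phi>0: "\<Phi> 0 = 0" using le \<phi> wth_0[OF m01] by (simp add: \<Phi>_def paste_def)
  have wS: "wth c m S = 0"
    unfolding S_def by (rule wth_S[OF c m W])
  have \<Phi>R: "\<Phi> R = 2 * pi * of_int n"
  \<comment> \<open>If the arc ends together with the half period, \<open>R\<close> still falls into
    the middle branch of \<open>paste\<close>, and the value is \<open>\<phi> M\<close>.\<close>
  proof (cases "S = s0 + L")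
    case True
    then show ?thesis using wS \<phi>(3) M unfolding \<Phi>_def R_def paste_def by auto
  next
    case False
    then show ?thesis using wS le M unfolding \<Phi>_def R_def paste_def by auto
  qed
  have per: "cos (x + 2 * pi * of_int n) = cos x" "sin (x + 2 * pi * of_int n) = sin x" for x
    using cos_int_2pin[of n] sin_int_2pin[of n] by (simp_all add: cos_add sin_add)
  have "integral {0..R} (\<lambda>t. cos (\<Phi> t)) = integral {0..S} (\<lambda>t. cos (wth c m t))"
    using pasted[OF continuous_on_cos[OF continuous_on_id] per(1)] X by simp
  moreover have "integral {0..R} (\<lambda>t. sin (\<Phi> t)) = integral {0..S} (\<lambda>t. sin (wth c m t))"
    using pasted[OF continuous_on_sin[OF continuous_on_id] per(2)] Y by simp
  ultimately have "path_energy lam S (wk c m) \<le> path_energy lam R G \<and>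
    (path_energy lam R G \<le> path_energy lam S (wk c m) \<longrightarrow>
      R = S \<and> (\<forall>t\<in>{0..S}. \<Phi> t = wth c m t))"
    unfolding S_def lam
    by (rule wave_full[OF c m W h \<Phi>0 \<Phi>R le(4)])
  moreover have "path_energy lam R G - path_energy lam S (wk c m)
      = path_energy lam M g - path_energy lam L (\<lambda>t. wk c m (s0 + t))"
    using energy(2) by (simp add: path_energy_def R_def algebra_simps)
  moreover have "M = L \<and> (\<forall>t\<in>{0..L}. \<phi> t = wth c m (s0 + t))"
    if RS: "R = S" "\<forall>t\<in>{0..S}. \<Phi> t = wth c m t"
  proof -
    have MeqL: "M = L" using RS(1) by (simp add: R_def)
    have "\<phi> t = wth c m (s0 + t)" if t: "t \<in> {0..L}" for t
    proof -
      have "\<Phi> (s0 + t) = \<phi> t" using t \<phi>(2) MeqL by (auto simp: \<Phi>_def paste_def)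
      then show ?thesis using RS(2) t le by auto
    qed
    then show ?thesis using MeqL by blast
  qed
  ultimately show ?thesis by fastforce
qed

section \<open>Identification of an orbit with an arc of a wave\<close>

lemma gronwall_zero:
  fixes D :: "real \<Rightarrow> real"
  assumes D: "continuous_on {0..L} D" "\<And>t. t \<in> {0..L} \<Longrightarrow> 0 \<le> D t"
    and le: "\<And>t. t \<in> {0..L} \<Longrightarrow> D t \<le> C * integral {0..t} D" and t: "t \<in> {0..L}"
  shows "D t = 0"
proof -
  define E where "E t = integral {0..t} D" for t
  have i: "D integrable_on {0..t}" if "t \<in> {0..L}" for t
    using that by (intro integrable_continuous_real continuous_on_subset[OF D(1)]) auto
  have "ac_on 0 L E D"
    by (rule ac_onI_increment) (auto simp: E_def intro: absolutely_integrable_continuous_real D)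
  moreover have "ac_on 0 L (\<lambda>t. exp (- C * t)) (\<lambda>t. - C * exp (- C * t))"
    by (rule ac_on_DERIV) (auto intro!: derivative_eq_intros continuous_intros)
  ultimately have p: "ac_on 0 L (\<lambda>t. E t * exp (- C * t)) (\<lambda>t. D t * exp (- C * t) + E t * (- C * exp (- C * t)))"
    by (rule ac_on_mult)
  have "integral {0..t} (\<lambda>t. D t * exp (- C * t) + E t * (- C * exp (- C * t))) \<le> integral {0..t} (\<lambda>_. 0)"
  proof (rule integral_le)
    fix s assume "s \<in> {0..t}"
    then have "D s \<le> C * E s" using le[of s] t by (auto simp: E_def)
    then have "(D s - C * E s) * exp (- C * s) \<le> 0" by (intro mult_nonpos_nonneg) auto
    then show "D s * exp (- C * s) + E s * (- C * exp (- C * s)) \<le> 0" by (simp add: algebra_simps)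
  qed (use ac_on_integrable[OF p] t in auto)
  then have "E t * exp (- C * t) \<le> 0"
    using ac_on_increment[OF p, of 0 t] t by (simp add: E_def)
  then have "E t \<le> 0" by (simp add: mult_le_0_iff)
  moreover have "0 \<le> E t"
    unfolding E_def using t D(2) by (intro integral_nonneg i) auto
  ultimately have "E t = 0" by simp
  then show ?thesis using le[OF t] D(2)[OF t] by (simp add: E_def)
qed

text \<open>The squared distance \<open>D\<close> in the phase plane satisfies
  \<open>D' \<le> (1 + \<bar>a\<bar>) * D\<close>, because sin is Lipschitz with constant 1;
  Gronwall's lemma applies.\<close>

lemma pendulum_unique:
  fixes \<theta> k \<psi> l :: "real \<Rightarrow> real"
  assumes \<theta>: "ac_on 0 L \<theta> k" "ac_on 0 L k (\<lambda>t. - a * sin (\<theta> t))"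
    and \<psi>: "ac_on 0 L \<psi> l" "ac_on 0 L l (\<lambda>t. - a * sin (\<psi> t))"
    and init: "\<theta> 0 = \<psi> 0" "k 0 = l 0" and t: "t \<in> {0..L}"
  shows "\<theta> t = \<psi> t \<and> k t = l t"
proof -
  define D where "D t = (\<theta> t - \<psi> t) * (\<theta> t - \<psi> t) + (k t - l t) * (k t - l t)" for t
  define D' where "D' t = ((k t - l t) * (\<theta> t - \<psi> t) + (\<theta> t - \<psi> t) * (k t - l t)) +
     ((- a * sin (\<theta> t) - (- a * sin (\<psi> t))) * (k t - l t) + (k t - l t) * (- a * sin (\<theta> t) - (- a * sin (\<psi> t))))" for t
  have D: "ac_on 0 L D D'"
    unfolding D_def[abs_def] D'_def[abs_def]
    by (intro ac_on_add ac_on_mult ac_on_diff \<theta> \<psi>)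
  have cD: "continuous_on {0..L} D" by (rule ac_on_continuous[OF D])
  have bound: "D' t \<le> (1 + \<bar>a\<bar>) * D t" for t
  proof -
    define x where "x = \<theta> t - \<psi> t"
    define y where "y = k t - l t"
    define z where "z = sin (\<theta> t) - sin (\<psi> t)"
    have z: "\<bar>z\<bar> \<le> \<bar>x\<bar>"
    proof -
      have "z = 2 * sin ((\<theta> t - \<psi> t) / 2) * cos ((\<theta> t + \<psi> t) / 2)"
        unfolding z_def by (rule sin_diff_sin)
      then have "\<bar>z\<bar> = 2 * \<bar>sin (x / 2)\<bar> * \<bar>cos ((\<theta> t + \<psi> t) / 2)\<bar>" by (simp add: x_def abs_mult)
      also have "\<dots> \<le> 2 * \<bar>x / 2\<bar> * 1"
        by (intro mult_mono abs_sin_x_le_abs_x) auto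
      finally show ?thesis by simp
    qed
    have "- 2 * a * z * y \<le> \<bar>a\<bar> * (x\<^sup>2 + y\<^sup>2)"
    proof -
      have "- 2 * a * z * y \<le> \<bar>- 2 * a * z * y\<bar>" by simp
      also have "\<dots> = \<bar>a\<bar> * (2 * \<bar>z\<bar> * \<bar>y\<bar>)" by (simp add: abs_mult)
      also have "\<dots> \<le> \<bar>a\<bar> * (2 * \<bar>x\<bar> * \<bar>y\<bar>)"
        using z by (intro mult_left_mono mult_right_mono) auto
      also have "\<dots> \<le> \<bar>a\<bar> * (x\<^sup>2 + y\<^sup>2)"
        using sum_squares_bound[of "\<bar>x\<bar>" "\<bar>y\<bar>"] by (intro mult_left_mono) auto
      finally show ?thesis .
    qed
    moreover have "2 * x * y \<le> x\<^sup>2 + y\<^sup>2" by (rule sum_squares_bound)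
    moreover have "D' t = 2 * x * y + (- 2 * a * z * y)" by (simp add: D'_def x_def y_def z_def algebra_simps)
    moreover have "(1 + \<bar>a\<bar>) * D t = (x\<^sup>2 + y\<^sup>2) + \<bar>a\<bar> * (x\<^sup>2 + y\<^sup>2)"
      by (simp add: D_def x_def y_def power2_eq_square algebra_simps)
    ultimately show ?thesis by linarith
  qed
  have D0: "D 0 = 0" using init by (simp add: D_def)
  have "D t = 0"
  proof (rule gronwall_zero[OF cD _ _ t, of "1 + \<bar>a\<bar>"])
    fix s assume s: "s \<in> {0..L}"
    have "D s - D 0 = integral {0..s} D'" using ac_on_increment[OF D, of 0 s] s by auto
    also have "\<dots> \<le> integral {0..s} (\<lambda>t. (1 + \<bar>a\<bar>) * D t)"
      using s bound by (intro integral_le ac_on_integrable[OF D] integrable_on_mult_right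
          integrable_continuous_real continuous_on_subset[OF cD]) auto
    finally show "D s \<le> (1 + \<bar>a\<bar>) * integral {0..s} D"
      using D0 by simp
  qed (simp add: D_def)
  then show ?thesis by (simp add: D_def sum_squares_eq_zero_iff)
qed

text \<open>By the first integral the point with coordinates \<open>k / (2 * c * sqrt m)\<close> and
  \<open>sin (\<theta> / 2) / sqrt m\<close> lies on the unit circle, and its polar angle is the
  amplitude sought. The bounds on \<open>\<theta>\<close> let arcsin recover the angle.\<close>

lemma wave_phase:
  assumes m: "0 < m" "m < 1" and c: "0 < c" and \<theta>: "- pi < \<theta>" "\<theta> < pi"
    and k: "k\<^sup>2 = 2 * c\<^sup>2 * (2 * m - 1) + 2 * c\<^sup>2 * cos \<theta>"
  obtains s0 where "0 \<le> s0" "am (c * s0) m < 2 * pi" "wth c m s0 = \<theta>" "wk c m s0 = k"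
proof -
  have "(k / (2 * c * sqrt m))\<^sup>2 + (sin (\<theta> / 2) / sqrt m)\<^sup>2 = 1"
  proof -
    have "cos \<theta> = 1 - 2 * (sin (\<theta> / 2))\<^sup>2" using cos_double_sin[of "\<theta>/2"] by simp
    then have "k\<^sup>2 = 4 * c\<^sup>2 * (m - (sin (\<theta> / 2))\<^sup>2)" using k by algebra
    then show ?thesis using m c by (simp add: power_divide power_mult_distrib field_simps)
  qed
  then obtain a where a: "0 \<le> a" "a < 2 * pi" "k / (2 * c * sqrt m) = cos a" "sin (\<theta> / 2) / sqrt m = sin a"
    using sincos_total_2pi by metis
  define s0 where "s0 = ellF a m / c"
  have am: "am (c * s0) m = a" using c by (simp add: s0_def am_ellF[OF m])
  show thesis
  proof (rule that)
    show "0 \<le> s0" using ellF_expanding[OF m a(1)] a(1) c by (simp add: s0_def)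
    show "am (c * s0) m < 2 * pi" using am a by simp
    have "sqrt m * sin a = sin (\<theta> / 2)" using a(4) m by (simp add: field_simps)
    then show "wth c m s0 = \<theta>" using \<theta> by (simp add: wth_def warc_def am arcsin_sin)
    show "wk c m s0 = k" using a(3) m c by (simp add: wk_def am field_simps)
  qed
qed

text \<open>The angle has the sign of the sine of the amplitude. Passing the end of the half period
  would carry the amplitude beyond pi, where the sine turns negative.\<close>

lemma wave_half_period:
  assumes m: "0 < m" "m < 1" and c: "0 < c" and L: "0 < L" and s0: "am (c * s0) m < 2 * pi"
    and rng: "\<And>t. t \<in> {0..L} \<Longrightarrow> wth c m (s0 + t) \<in> {0..pi}"
  shows "s0 + L \<le> 2 * complete_K m / c"
proof (rule ccontr)
  assume "\<not> ?thesis"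
  then have "2 * complete_K m < c * (s0 + L)" using c by (simp add: field_simps)
  then have top: "pi < am (c * (s0 + L)) m"
    using am_strict_mono[OF m, of "2 * complete_K m"] am_2K[OF m] by simp
  have sn: "0 \<le> sin (am (c * (s0 + t)) m)" if "t \<in> {0..L}" for t
  proof -
    have "0 \<le> sin (wth c m (s0 + t) / 2)" using rng[OF that] by (intro sin_ge_zero) auto
    then show ?thesis using m by (simp add: wth_def sin_half_warc[OF m] zero_le_mult_iff)
  qed
  show False
  proof (cases "am (c * s0) m \<le> pi")
    case True
    \<comment> \<open>An amplitude strictly between pi and 2 pi that the arc reaches.\<close>
    define y where "y = min (am (c * (s0 + L)) m) (3 * pi / 2)"
    have y: "pi < y" "y < 2 * pi" "y \<le> am (c * (s0 + L)) m" using top pi_gt_zero by (simp_all add: y_def min_def)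
    define t where "t = ellF y m / c - s0"
    have ct: "c * (s0 + t) = ellF y m" using c by (simp add: t_def)
    have "c * s0 \<le> c * (s0 + t)"
      unfolding ct using ellF_expanding[OF m, of "am (c * s0) m" y] True y by (simp add: ellF_am[OF m])
    moreover have "c * (s0 + t) \<le> c * (s0 + L)"
      unfolding ct using ellF_expanding[OF m y(3)] y by (simp add: ellF_am[OF m])
    ultimately have "t \<in> {0..L}" using c by simp
    from sn[OF this] have "0 \<le> sin y" unfolding ct by (simp add: am_ellF[OF m])
    moreover have "sin y < 0" using y by (intro sin_lt_zero) auto
    ultimately show False by simp
  next
    case False
    then have "sin (am (c * s0) m) < 0" using s0 by (intro sin_lt_zero) auto
    then show False using sn[of 0] L by simp
  qed
qed

section \<open>Test functions\<close>

definition smooth :: "(real \<Rightarrow> real) \<Rightarrow> bool" where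
  "smooth f \<longleftrightarrow> (\<forall>n x. (deriv ^^ n) f field_differentiable at x)"

text \<open>Smoothness is shown by exhibiting a class of differentiable functions closed under
  \<open>deriv\<close>, instead of a formula for the n-th derivative.\<close>

lemma smooth_coinduct:
  assumes "P f" and step: "\<And>f. P f \<Longrightarrow> (\<forall>x. f field_differentiable at x) \<and> P (deriv f)"
  shows "smooth f"
proof -
  have "P ((deriv ^^ n) f)" for n
    by (induction n) (use assms in auto)
  then show ?thesis using step by (auto simp: smooth_def)
qed

lemma smooth_deriv: "smooth f \<Longrightarrow> smooth (deriv f)"
  unfolding smooth_def by (metis comp_apply funpow_Suc_right)

lemma smooth_has_derivative: "smooth f \<Longrightarrow> (f has_real_derivative deriv f x) (at x)"
  unfolding smooth_def by (metis field_differentiable_derivI funpow_0)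

lemma smooth_continuous_on: "smooth f \<Longrightarrow> continuous_on S f"
  by (intro continuous_at_imp_continuous_on ballI DERIV_isCont[OF smooth_has_derivative])

lemma smooth_antiderivative:
  assumes "smooth f" "\<And>x. (F has_real_derivative f x) (at x)"
  shows "smooth F"
  unfolding smooth_def
proof (intro allI)
  fix n x
  have "deriv F = f" using assms(2) by (auto simp: DERIV_imp_deriv)
  then show "(deriv ^^ n) F field_differentiable at x"
  proof (cases n)
    case 0
    then show ?thesis using assms(2) field_differentiable_def by auto
  next
    case (Suc k)
    then show ?thesis
      using assms(1) \<open>deriv F = f\<close> by (simp add: smooth_def funpow_Suc_right del: funpow.simps)
  qed
qed

lemma smooth_lincomb:
  assumes "smooth f" "smooth g"
  shows "smooth (\<lambda>x. a * f x + b * g x)"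
proof (rule smooth_coinduct[where P = "\<lambda>h. \<exists>f g. smooth f \<and> smooth g \<and> h = (\<lambda>x. a * f x + b * g x)"])
  fix h assume "\<exists>f g. smooth f \<and> smooth g \<and> h = (\<lambda>x. a * f x + b * g x)"
  then obtain f g where fg: "smooth f" "smooth g" and h: "h = (\<lambda>x. a * f x + b * g x)" by blast
  have d: "(h has_real_derivative a * deriv f x + b * deriv g x) (at x)" for x
    unfolding h by (intro DERIV_add DERIV_cmult smooth_has_derivative fg)
  then have "deriv h = (\<lambda>x. a * deriv f x + b * deriv g x)" by (auto simp: DERIV_imp_deriv)
  then show "(\<forall>x. h field_differentiable at x) \<and>
      (\<exists>f g. smooth f \<and> smooth g \<and> deriv h = (\<lambda>x. a * f x + b * g x))"
    using d fg smooth_deriv field_differentiable_def by blast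
qed (use assms in blast)

lemma smooth_affine:
  assumes "smooth f"
  shows "smooth (\<lambda>x. f (a * x + b))"
proof (rule smooth_coinduct[where P = "\<lambda>h. \<exists>c f. smooth f \<and> h = (\<lambda>x. c * f (a * x + b))"])
  fix h assume "\<exists>c f. smooth f \<and> h = (\<lambda>x. c * f (a * x + b))"
  then obtain c f where f: "smooth f" and h: "h = (\<lambda>x. c * f (a * x + b))" by blast
  have d: "(h has_real_derivative (c * a) * deriv f (a * x + b)) (at x)" for x
  proof -
    have "((\<lambda>x. f (a * x + b)) has_real_derivative deriv f (a * x + b) * a) (at x)"
      by (rule DERIV_chain2[OF smooth_has_derivative[OF f]]) (auto intro!: derivative_eq_intros)
    from DERIV_cmult[OF this, of c] show ?thesis unfolding h by (simp add: mult_ac)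
  qed
  then have "deriv h = (\<lambda>x. (c * a) * deriv f (a * x + b))" by (auto simp: DERIV_imp_deriv)
  then show "(\<forall>x. h field_differentiable at x) \<and>
      (\<exists>c f. smooth f \<and> deriv h = (\<lambda>x. c * f (a * x + b)))"
    using d f smooth_deriv field_differentiable_def by blast
qed (use assms in \<open>auto intro!: exI[of _ 1]\<close>)

section \<open>Bump functions and smooth steps\<close>

text \<open>The functions \<open>p(x) u\<^sup>-\<^sup>k exp(-1/u)\<close> with \<open>u = x(1-x)\<close>, cut off outside \<open>(0,1)\<close>, form a class
  closed under differentiation.\<close>

definition bump_fun :: "real poly \<Rightarrow> nat \<Rightarrow> real \<Rightarrow> real" where
  "bump_fun p k x = (if 0 < x \<and> x < 1
     then poly p x / (x * (1 - x)) ^ k * exp (- 1 / (x * (1 - x))) else 0)"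

text \<open>The numerator of the derivative, with \<open>[:0, 1, -1:]\<close> for
  \<open>u = x (1 - x)\<close> and \<open>[:1, -2:]\<close> for \<open>u'\<close>. The exponential
  contributes the factor \<open>u' / u\<^sup>2\<close>, which raises the exponent of the denominator
  by 2.\<close>

definition bump_next :: "real poly \<Rightarrow> nat \<Rightarrow> real poly" where
  "bump_next p k = pderiv p * [:0, 1, -1:]\<^sup>2 - smult (real k) (p * [:1, -2:] * [:0, 1, -1:]) + p * [:1, -2:]"

text \<open>Quadratic decay at 0 and 1 gives differentiability there. The inequality
  \<open>(1 + y / n) ^ n \<le> exp y\<close> with \<open>y = 1 / u\<close> bounds the exponential
  factor by \<open>(n * u) ^ n\<close>.\<close>

lemma bump_fun_quadratic_bound:
  obtains B where "\<And>x. \<bar>bump_fun p k x\<bar> \<le> B * (x * (1 - x))\<^sup>2"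
proof -
  have "bounded (poly p ` {0..1})"
    by (intro compact_imp_bounded compact_continuous_image continuous_intros) auto
  then obtain A where "\<forall>y\<in>poly p ` {0..1}. norm y \<le> A"
    unfolding bounded_iff by blast
  then have A: "\<bar>poly p x\<bar> \<le> A" if "x \<in> {0..1}" for x
    using that by simp
  \<comment> \<open>Of the \<open>n\<close> powers of \<open>u\<close>, \<open>k\<close> cancel the
    denominator and two remain.\<close>
  define n where "n = k + 2"
  have A0: "0 \<le> A" using A[of 0] by simp
  have "\<bar>bump_fun p k x\<bar> \<le> (A * real n ^ n) * (x * (1 - x))\<^sup>2" for x
  proof (cases "0 < x \<and> x < 1")
    case True
    define u where "u = x * (1 - x)"
    have u: "0 < u" using True by (simp add: u_def)
    have "(1 / (u * real n)) ^ n \<le> (1 + (1 / u) / real n) ^ n"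
      using u by (intro power_mono) auto
    also have "\<dots> \<le> exp (1 / u)"
    proof (rule exp_ge_one_plus_x_over_n_power_n)
      have "0 < 1 / u" using u by simp
      then show "- real n \<le> 1 / u" by linarith
    qed (simp add: n_def)
    finally have "1 / exp (1 / u) \<le> 1 / (1 / (u * real n)) ^ n"
      using u by (intro divide_left_mono) (auto simp: n_def)
    then have "exp (- 1 / u) \<le> (u * real n) ^ n"
      by (simp add: exp_minus power_one_over inverse_eq_divide)
    moreover have "(u * real n) ^ n = real n ^ n * (u ^ k * u\<^sup>2)"
      unfolding power_mult_distrib by (simp add: n_def power_add power2_eq_square)
    ultimately have e: "exp (- 1 / u) \<le> real n ^ n * (u ^ k * u\<^sup>2)" by simp
    have "\<bar>bump_fun p k x\<bar> = \<bar>poly p x\<bar> / u ^ k * exp (- 1 / u)"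
      using True u by (simp add: bump_fun_def u_def abs_mult)
    also have "\<dots> \<le> A / u ^ k * (real n ^ n * (u ^ k * u\<^sup>2))"
      using A[of x] A0 True u e by (intro mult_mono divide_right_mono) auto
    also have "\<dots> = (A * real n ^ n) * u\<^sup>2" using u by simp
    finally show ?thesis by (simp add: u_def)
  qed (use A0 in \<open>auto simp: bump_fun_def\<close>)
  then show thesis by (rule that)
qed

lemma DERIV_zero_quadratic:
  fixes f :: "real \<Rightarrow> real"
  assumes "f a = 0" "\<And>x. \<bar>x - a\<bar> < 1 \<Longrightarrow> \<bar>f x\<bar> \<le> B * (x - a)\<^sup>2"
  shows "(f has_real_derivative 0) (at a)"
  unfolding has_field_derivative_iff
proof (rule Lim_null_comparison)
  show "((\<lambda>x. B * \<bar>x - a\<bar>) \<longlongrightarrow> 0) (at a)"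
    by (auto intro!: tendsto_eq_intros)
  have "eventually (\<lambda>x. x \<in> ball a 1 - {a}) (at a)"
    by (intro eventually_at_in_open) auto
  then show "eventually (\<lambda>x. norm ((f x - f a) / (x - a)) \<le> B * \<bar>x - a\<bar>) (at a)"
  proof eventually_elim
    case (elim x)
    then have "\<bar>f x\<bar> \<le> B * (x - a)\<^sup>2" using assms(2)[of x] by (auto simp: dist_real_def)
    then have "\<bar>f x\<bar> \<le> B * \<bar>x - a\<bar> * \<bar>x - a\<bar>" by (simp add: power2_eq_square)
    then show ?case using elim assms(1) by (simp add: divide_le_eq)
  qed
qed

lemma DERIV_bump_fun: "(bump_fun p k has_real_derivative bump_fun (bump_next p k) (k + 2) x) (at x)"
proof -
  consider "0 < x" "x < 1" | "x \<in> - {0..1}" | "x = 0 \<or> x = 1" by fastforce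
  then show ?thesis
  proof cases
    case 1
    define u where "u = x * (1 - x)"
    have u: "0 < u" using 1 by (simp add: u_def)
    have du: "((\<lambda>x. x * (1 - x)) has_real_derivative 1 - 2 * x) (at x)"
      by (auto intro!: derivative_eq_intros)
    have dk: "((\<lambda>x. (x * (1 - x)) ^ k) has_real_derivative real k * u ^ (k - 1) * (1 - 2 * x)) (at x)"
      using DERIV_power[OF du, of k] by (simp add: u_def mult_ac)
    have dE: "((\<lambda>x. exp (- 1 / (x * (1 - x)))) has_real_derivative exp (- 1 / u) * ((1 - 2 * x) / u\<^sup>2)) (at x)"
    proof -
      have "((\<lambda>y. exp (- 1 / y)) has_real_derivative exp (- 1 / u) * (1 / u\<^sup>2)) (at u)"
        using u by (auto intro!: derivative_eq_intros simp: power2_eq_square)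
      from DERIV_chain2[OF this[unfolded u_def] du] show ?thesis by (simp add: u_def)
    qed
    have "((\<lambda>x. poly p x / (x * (1 - x)) ^ k * exp (- 1 / (x * (1 - x)))) has_real_derivative
       (poly (pderiv p) x * u ^ k - poly p x * (real k * u ^ (k - 1) * (1 - 2 * x))) / (u ^ k * u ^ k) * exp (- 1 / u)
       + exp (- 1 / u) * ((1 - 2 * x) / u\<^sup>2) * (poly p x / u ^ k)) (at x)"
      using u DERIV_mult[OF DERIV_divide[OF poly_DERIV[of p x] dk] dE] unfolding u_def[symmetric] by simp
    moreover have "(poly (pderiv p) x * u ^ k - poly p x * (real k * u ^ (k - 1) * (1 - 2 * x))) / (u ^ k * u ^ k) * exp (- 1 / u)
       + exp (- 1 / u) * ((1 - 2 * x) / u\<^sup>2) * (poly p x / u ^ k) = bump_fun (bump_next p k) (k + 2) x"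
    proof -
      have kk: "real k * u ^ (k - 1) = real k * u ^ k / u"
        using u by (cases k) auto
      have "(poly (pderiv p) x * u ^ k - poly p x * (real k * u ^ (k - 1) * (1 - 2 * x))) / (u ^ k * u ^ k)
         = (poly (pderiv p) x * u\<^sup>2 - real k * poly p x * (1 - 2 * x) * u) / u ^ (k + 2)"
        unfolding kk using u by (simp add: field_simps power_add power2_eq_square)
      moreover have "((1 - 2 * x) / u\<^sup>2) * (poly p x / u ^ k) = poly p x * (1 - 2 * x) / u ^ (k + 2)"
        by (simp add: power_add power2_eq_square mult_ac)
      moreover have "poly (bump_next p k) x
          = (poly (pderiv p) x * u\<^sup>2 - real k * poly p x * (1 - 2 * x) * u) + poly p x * (1 - 2 * x)"
        by (simp add: bump_next_def u_def algebra_simps power2_eq_square)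
      moreover have "a * e + e * b * c = (a + b * c) * e" for a b c e :: real by (simp add: algebra_simps)
      ultimately show ?thesis
        using 1 unfolding bump_fun_def u_def[symmetric] by (simp only: add_divide_distrib) simp
    qed
    ultimately have "((\<lambda>x. poly p x / (x * (1 - x)) ^ k * exp (- 1 / (x * (1 - x)))) has_real_derivative
        bump_fun (bump_next p k) (k + 2) x) (at x)" by simp
    then show ?thesis
      by (rule has_field_derivative_transform_within_open[of _ _ _ "{0<..<1}"])
         (use 1 in \<open>auto simp: bump_fun_def\<close>)
  next
    case 2
    have "((\<lambda>_. 0) has_real_derivative bump_fun (bump_next p k) (k + 2) x) (at x)"
      using 2 by (auto simp: bump_fun_def)
    then show ?thesis
      by (rule has_field_derivative_transform_within_open[of _ _ _ "- {0..1}"])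
         (use 2 in \<open>auto simp: bump_fun_def\<close>)
  next
    case 3
    obtain B where B: "\<And>y. \<bar>bump_fun p k y\<bar> \<le> B * (y * (1 - y))\<^sup>2"
      using bump_fun_quadratic_bound by blast
    have "0 \<le> B" using B[of 2] by (simp add: bump_fun_def)
    have "(bump_fun p k has_real_derivative 0) (at x)"
    proof (rule DERIV_zero_quadratic)
      fix y assume y: "\<bar>y - x\<bar> < 1"
      have "\<bar>y * (1 - y)\<bar> \<le> 2 * \<bar>y - x\<bar>"
        using 3 y mult_right_mono[of "\<bar>1 - y\<bar>" 2 "\<bar>y\<bar>"] mult_right_mono[of "\<bar>y\<bar>" 2 "\<bar>1 - y\<bar>"]
        by (auto simp: abs_mult mult.commute abs_minus_commute)
      then have "\<bar>y * (1 - y)\<bar>\<^sup>2 \<le> (2 * \<bar>y - x\<bar>)\<^sup>2" by (rule power_mono) simp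
      then have "(y * (1 - y))\<^sup>2 \<le> (2 * \<bar>y - x\<bar>)\<^sup>2" by (simp only: power2_abs)
      then have "B * (y * (1 - y))\<^sup>2 \<le> B * (2 * \<bar>y - x\<bar>)\<^sup>2" using \<open>0 \<le> B\<close> by (rule mult_left_mono)
      then show "\<bar>bump_fun p k y\<bar> \<le> (4 * B) * (y - x)\<^sup>2"
        using B[of y] by (simp add: power_mult_distrib)
    qed (use 3 in \<open>auto simp: bump_fun_def\<close>)
    then show ?thesis using 3 by (auto simp: bump_fun_def)
  qed
qed

lemma smooth_bump_fun: "smooth (bump_fun p k)"
proof (rule smooth_coinduct[where P = "\<lambda>f. \<exists>p k. f = bump_fun p k"])
  fix f assume "\<exists>p k. f = bump_fun p k"
  then obtain p k where f: "f = bump_fun p k" by blast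
  have "deriv f = bump_fun (bump_next p k) (k + 2)"
    unfolding f by (rule ext) (rule DERIV_imp_deriv[OF DERIV_bump_fun])
  then show "(\<forall>x. f field_differentiable at x) \<and> (\<exists>p k. deriv f = bump_fun p k)"
    using DERIV_bump_fun f field_differentiable_def by blast
qed blast

abbreviation bump_prim :: "real \<Rightarrow> real" where
  "bump_prim \<equiv> primitive (bump_fun 1 0)"

definition bump :: "real \<Rightarrow> real" where
  "bump x = bump_fun 1 0 x / bump_prim 1"

definition bump_step :: "real \<Rightarrow> real" where
  "bump_step = primitive bump"

lemma bump_mass_pos: "0 < bump_prim 1"
proof -
  have "bump_prim 0 < bump_prim 1"
  proof (rule DERIV_pos_imp_increasing_open[of 0 1 bump_prim])
    fix x :: real assume "0 < x" "x < 1"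
    then show "\<exists>y. (bump_prim has_real_derivative y) (at x) \<and> 0 < y"
      using DERIV_primitive[OF smooth_continuous_on[OF smooth_bump_fun], of 1 0 x]
      by (auto simp: bump_fun_def)
  next
    show "continuous_on {0..1} bump_prim"
      by (intro continuous_at_imp_continuous_on ballI
        DERIV_isCont[OF DERIV_primitive[OF smooth_continuous_on[OF smooth_bump_fun]]])
  qed simp
  then show ?thesis by simp
qed

lemma smooth_bump: "smooth bump"
  using smooth_lincomb[OF smooth_bump_fun smooth_bump_fun, of "1 / bump_prim 1" 1 0 0 1 0]
  by (simp add: bump_def[abs_def])

lemma bump_nonneg: "0 \<le> bump x"
  using bump_mass_pos by (simp add: bump_def bump_fun_def)

lemma bump_support: "x \<le> 0 \<or> 1 \<le> x \<Longrightarrow> bump x = 0"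
  by (auto simp: bump_def bump_fun_def)

lemma DERIV_bump_step: "(bump_step has_real_derivative bump x) (at x)"
  unfolding bump_step_def by (intro DERIV_primitive smooth_continuous_on smooth_bump)

lemma smooth_bump_step: "smooth bump_step"
  by (rule smooth_antiderivative[OF smooth_bump DERIV_bump_step])

lemma bump_step_0: "x \<le> 0 \<Longrightarrow> bump_step x = 0"
proof -
  assume x: "x \<le> 0"
  have "bump_step x = bump_step 0"
  proof (cases "x = 0")
    case False
    then obtain z where "x < z" "z < 0" "bump_step 0 - bump_step x = (0 - x) * bump z"
      using MVT2[of x 0 bump_step bump] DERIV_bump_step x by auto
    then show ?thesis using bump_support[of z] by simp
  qed simp
  then show ?thesis by (simp add: bump_step_def)
qed

lemma bump_step_1: "1 \<le> x \<Longrightarrow> bump_step x = 1"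
proof -
  assume x: "1 \<le> x"
  have c: "continuous_on UNIV (bump_fun 1 0)" by (intro smooth_continuous_on smooth_bump_fun)
  have "bump_step x = bump_step 1"
  proof (cases "x = 1")
    case False
    then obtain z where "1 < z" "z < x" "bump_step x - bump_step 1 = (x - 1) * bump z"
      using MVT2[of 1 x bump_step bump] DERIV_bump_step x by auto
    then show ?thesis using bump_support[of z] by simp
  qed simp
  moreover have "bump_step 1 - bump_prim 1 / bump_prim 1
      = bump_step 0 - bump_prim 0 / bump_prim 1"
  proof (rule DERIV_isconst_all[of "\<lambda>x. bump_step x - bump_prim x / bump_prim 1"], rule allI)
    fix x
    show "((\<lambda>x. bump_step x - bump_prim x / bump_prim 1) has_real_derivative 0) (at x)"
      using DERIV_diff[OF DERIV_bump_step[of x] DERIV_cdivide[OF DERIV_primitive[OF c, of x]], of "bump_prim 1"]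
      by (simp add: bump_def)
  qed
  ultimately show ?thesis using bump_mass_pos bump_step_0[of 0] by simp
qed

section \<open>Test functions and du Bois-Reymond's lemma\<close>

lemma test_functionD:
  assumes "test_function L \<phi>"
  shows "smooth \<phi>" "\<phi> x \<noteq> 0 \<Longrightarrow> 0 < x \<and> x < L" "\<phi> 0 = 0" "\<phi> L = 0"
proof -
  obtain a b where ab: "0 < a" "b < L" "\<And>x. x \<notin> {a..b} \<Longrightarrow> \<phi> x = 0"
    using assms by (auto simp: test_function_def)
  show "\<phi> x \<noteq> 0 \<Longrightarrow> 0 < x \<and> x < L" using ab(1,2) ab(3)[of x] by (cases "x \<in> {a..b}") auto
  show "\<phi> 0 = 0" "\<phi> L = 0" using ab(1,2) ab(3)[of 0] ab(3)[of L] by auto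
  show "smooth \<phi>" using assms by (simp add: test_function_def smooth_def)
qed

lemma test_functionI:
  assumes "smooth \<phi>" "0 < a" "b < L" "\<And>x. x < a \<Longrightarrow> \<phi> x = 0" "\<And>x. b < x \<Longrightarrow> \<phi> x = 0"
  shows "test_function L \<phi>"
  using assms unfolding test_function_def smooth_def
  by (metis atLeastAtMost_iff not_le)

lemma test_function_deriv:
  assumes "test_function L \<phi>"
  shows "test_function L (deriv \<phi>)"
proof -
  obtain a b where ab: "0 < a" "b < L" "\<And>x. x \<notin> {a..b} \<Longrightarrow> \<phi> x = 0"
    using assms by (auto simp: test_function_def)
  have z: "deriv \<phi> x = 0" if "x \<in> A" "open A" "\<And>y. y \<in> A \<Longrightarrow> \<phi> y = 0" for x A
  proof (rule DERIV_imp_deriv)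
    show "(\<phi> has_real_derivative 0) (at x)"
      by (rule has_field_derivative_transform_within_open[of "\<lambda>_. 0" _ _ A]) (use that in auto)
  qed
  show ?thesis
  proof (rule test_functionI[OF smooth_deriv[OF test_functionD(1)[OF assms]] ab(1,2)])
    show "deriv \<phi> x = 0" if "x < a" for x using z[of x "{..<a}"] ab(3) that by auto
    show "deriv \<phi> x = 0" if "b < x" for x using z[of x "{b<..}"] ab(3) that by auto
  qed
qed

text \<open>The primitive from 0 vanishes to the left of the support by construction, and to its
  right because the mean is zero.\<close>

lemma test_function_antiderivative:
  assumes \<psi>: "test_function L \<psi>" and L: "0 < L" and z: "integral {0..L} \<psi> = 0"
  obtains \<phi> where "test_function L \<phi>" "deriv \<phi> = \<psi>"
proof -
  obtain a b where ab: "0 < a" "b < L" "\<And>x. x \<notin> {a..b} \<Longrightarrow> \<psi> x = 0"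
    using \<psi> by (auto simp: test_function_def)
  note s = test_functionD(1)[OF \<psi>]
  define \<phi> where "\<phi> = primitive \<psi>"
  have d: "(\<phi> has_real_derivative \<psi> x) (at x)" for x
    unfolding \<phi>_def by (intro DERIV_primitive smooth_continuous_on s)
  have "(\<psi> has_integral \<phi> L - \<phi> 0) {0..L}"
    using L by (intro has_integral_DERIV d) simp
  then have \<phi>L: "\<phi> L = 0" using z by (simp add: \<phi>_def integral_unique)
  have c: "\<phi> x = \<phi> y" if xy: "x < y" and n: "\<And>z. x < z \<Longrightarrow> z < y \<Longrightarrow> \<psi> z = 0" for x y
    using MVT2[OF xy, of \<phi> \<psi>] d n by force
  have "test_function L \<phi>"
  proof (rule test_functionI[OF smooth_antiderivative[OF s d] ab(1,2)])
    show "\<phi> x = 0" if "x < a" for x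
    proof -
      have "\<phi> x = \<phi> 0"
      proof (cases x "0::real" rule: linorder_cases)
        case less
        then show ?thesis by (rule c) (use ab in auto)
      next
        case greater
        then have "\<phi> 0 = \<phi> x" by (rule c) (use ab that in auto)
        then show ?thesis by simp
      qed simp
      then show ?thesis by (simp add: \<phi>_def)
    qed
    show "\<phi> x = 0" if "b < x" for x
      using c[of x L] c[of L x] ab that \<phi>L by (cases x L rule: linorder_cases) auto
  qed
  moreover have "deriv \<phi> = \<psi>" using d by (auto simp: DERIV_imp_deriv)
  ultimately show thesis by (rule that)
qed

text \<open>The fundamental lemma of the calculus of variations: if \<open>u s < u t\<close>, test with the difference
  of two bumps concentrated at \<open>s\<close> and \<open>t\<close>.\<close>

lemma du_Bois_Reymond:
  fixes u :: "real \<Rightarrow> real"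
  assumes L: "0 < L" and u: "continuous_on {0..L} u"
    and orth: "\<And>\<phi>. test_function L \<phi> \<Longrightarrow> integral {0..L} (\<lambda>x. deriv \<phi> x * u x) = 0"
    and t: "t \<in> {0..L}"
  shows "u t = u 0"
proof -
  have le: "\<not> u s < u t" if st: "0 < s" "s < L" "0 < t" "t < L" for s t
  proof
    assume lt: "u s < u t"
    \<comment> \<open>A third of the gap, so that \<open>u s + e < u t - e\<close> separates the two
      weighted means.\<close>
    define e where "e = (u t - u s) / 3"
    have e: "0 < e" using lt by (simp add: e_def)
    obtain d1 where d1: "0 < d1" "\<And>x. x \<in> {0..L} \<Longrightarrow> \<bar>x - s\<bar> < d1 \<Longrightarrow> \<bar>u x - u s\<bar> < e"
      using u st e unfolding continuous_on_iff dist_real_def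
      by (metis atLeastAtMost_iff less_imp_le)
    obtain d2 where d2: "0 < d2" "\<And>x. x \<in> {0..L} \<Longrightarrow> \<bar>x - t\<bar> < d2 \<Longrightarrow> \<bar>u x - u t\<bar> < e"
      using u st e unfolding continuous_on_iff dist_real_def
      by (metis atLeastAtMost_iff less_imp_le)
    \<comment> \<open>The bumps occupy intervals of length \<open>\<delta>\<close> to the right of
      \<open>s\<close> and \<open>t\<close>; these must stay inside the domain and within the reach
      of \<open>d1\<close> and \<open>d2\<close>.\<close>
    define \<mu> where "\<mu> = min (min d1 d2) (min (L - s) (L - t))"
    have "0 < \<mu>" "\<mu> \<le> d1" "\<mu> \<le> d2" "\<mu> \<le> L - s" "\<mu> \<le> L - t"
      using d1(1) d2(1) st by (auto simp: \<mu>_def)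
    moreover define \<delta> where "\<delta> = \<mu> / 2"
    ultimately     have \<delta>: "0 < \<delta>" "\<delta> < d1" "\<delta> < d2" "s + \<delta> < L" "t + \<delta> < L"
      by linarith+
    define B where "B r x = bump ((x - r) / \<delta>) / \<delta>" for r x
    define P where "P r x = bump_step ((x - r) / \<delta>)" for r x
    have dP: "(P r has_real_derivative B r x) (at x)" for r x
    proof -
      have "((\<lambda>x. bump_step ((x - r) / \<delta>)) has_real_derivative bump ((x - r) / \<delta>) * (1 / \<delta>)) (at x)"
        by (rule DERIV_chain2[OF DERIV_bump_step]) (use \<delta>(1) in \<open>auto intro!: derivative_eq_intros\<close>)
      then show ?thesis by (simp add: P_def[abs_def] B_def)
    qed
    have sP: "smooth (P r)" for r
    proof -
      have "smooth (\<lambda>x. bump_step ((1 / \<delta>) * x + (- r / \<delta>)))"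
        by (rule smooth_affine[OF smooth_bump_step])
      then show ?thesis unfolding P_def[abs_def] by (simp add: diff_divide_distrib)
    qed
    have cB: "continuous_on A (B r)" for A r
      unfolding B_def[abs_def]
      by (intro continuous_intros continuous_on_compose2[OF smooth_continuous_on[OF smooth_bump]])
         (use \<delta> in auto)
    have Bs: "B r x = 0" if "x \<le> r \<or> r + \<delta> \<le> x" for r x
    proof -
      have "(x - r) / \<delta> \<le> 0 \<or> 1 \<le> (x - r) / \<delta>"
        using that \<delta>(1) by (auto simp: divide_nonpos_pos le_divide_eq)
      then show ?thesis by (simp add: B_def bump_support)
    qed
    have B0: "0 \<le> B r x" for r x using \<delta> by (simp add: B_def bump_nonneg)
    have P0: "P r x = 0" if "x \<le> r" for r x
      using that \<delta> by (simp add: P_def bump_step_0 divide_nonpos_pos)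
    have P1: "P r x = 1" if "r + \<delta> \<le> x" for r x
      using that \<delta> by (simp add: P_def bump_step_1 le_divide_eq)
    have I: "(B r has_integral 1) {0..L}" if "0 < r" "r + \<delta> < L" for r
    proof -
      have "(B r has_integral P r L - P r 0) {0..L}"
        using L by (intro has_integral_DERIV dP) simp
      then show ?thesis using P0[of 0 r] P1[of r L] that by simp
    qed
    have iBu: "(\<lambda>x. B r x * u x) integrable_on {0..L}" for r
      by (intro integrable_continuous_real continuous_intros cB u)
    have iBc: "((\<lambda>x. B r x * k) has_integral k) {0..L}" if "0 < r" "r + \<delta> < L" for r k
      using has_integral_mult_left[OF I[OF that], of k] by simp
    \<comment> \<open>Both steps equal 1 beyond their transitions, so their difference has compact
      support.\<close>
    have "test_function L (\<lambda>x. 1 * P s x + (-1) * P t x)"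
    proof (rule test_functionI)
      show "smooth (\<lambda>x. 1 * P s x + (-1) * P t x)" by (intro smooth_lincomb sP)
      show "0 < min s t" "max s t + \<delta> < L" using st \<delta> by auto
      show "1 * P s x + (-1) * P t x = 0" if "x < min s t" for x using P0[of x s] P0[of x t] that by auto
      show "1 * P s x + (-1) * P t x = 0" if "max s t + \<delta> < x" for x using P1[of s x] P1[of t x] that by auto
    qed
    from orth[OF this]
    have z: "integral {0..L} (\<lambda>x. deriv (\<lambda>x. 1 * P s x + (-1) * P t x) x * u x) = 0" .
    have "deriv (\<lambda>x. 1 * P s x + (-1) * P t x) x = 1 * B s x + (-1) * B t x" for x
      by (intro DERIV_imp_deriv DERIV_add DERIV_cmult dP)
    then have "integral {0..L} (\<lambda>x. B s x * u x - B t x * u x) = 0"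
      using z by (simp add: left_diff_distrib)
    then have eq: "integral {0..L} (\<lambda>x. B s x * u x) = integral {0..L} (\<lambda>x. B t x * u x)"
      by (simp add: integral_diff[OF iBu iBu])
    have "integral {0..L} (\<lambda>x. B s x * u x) \<le> u s + e"
    proof (rule has_integral_le[OF integrable_integral[OF iBu] iBc])
      fix x assume x: "x \<in> {0..L}"
      show "B s x * u x \<le> B s x * (u s + e)"
      proof (cases "s < x \<and> x < s + \<delta>")
        case True
        then show ?thesis using d1(2)[of x] x \<delta> B0 by (intro mult_left_mono) auto
      next
        case False
        then show ?thesis using Bs[of x s] by auto
      qed
    qed (use st \<delta> in auto)
    moreover have "u t - e \<le> integral {0..L} (\<lambda>x. B t x * u x)"
    proof (rule has_integral_le[OF iBc integrable_integral[OF iBu]])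
      fix x assume x: "x \<in> {0..L}"
      show "B t x * (u t - e) \<le> B t x * u x"
      proof (cases "t < x \<and> x < t + \<delta>")
        case True
        then show ?thesis using d2(2)[of x] x \<delta> B0 by (intro mult_left_mono) auto
      next
        case False
        then show ?thesis using Bs[of x t] by auto
      qed
    qed (use st \<delta> in auto)
    ultimately show False using eq e lt by (simp add: e_def field_simps)
  qed
  define c where "c = u (L/2)"
  have "u x = c" if "x \<in> {0<..<L}" for x
    using le[of x "L/2"] le[of "L/2" x] that L by (auto simp: c_def)
  \<comment> \<open>Test functions see the open interval; continuity carries the value to the end
    points.\<close>
  then have "u x = c" if "x \<in> {0..L}" for x
    using continuous_constant_on_closure[of "{0<..<L}" u c x] u L that
    by (auto simp: closure_greaterThanLessThan)
  then show ?thesis using t L by auto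
qed

section \<open>Tangent angle and weak curvature\<close>

lemma absolutely_integrable_continuous_scaleR:
  fixes g :: "real \<Rightarrow> 'a::euclidean_space"
  assumes "continuous_on {a..b} f" "g absolutely_integrable_on {a..b}"
  shows "(\<lambda>x. f x *\<^sub>R g x) absolutely_integrable_on {a..b}"
proof (rule absolutely_integrable_bounded_measurable_product[where h = "(*\<^sub>R)"])
  show "bilinear ((*\<^sub>R) :: real \<Rightarrow> 'a \<Rightarrow> 'a)"
    by (simp add: bilinear_conv_bounded_bilinear bounded_bilinear_scaleR)
  show "bounded (f ` {a..b})"
    using assms(1) by (intro compact_imp_bounded compact_continuous_image) auto
  show "f \<in> borel_measurable (lebesgue_on {a..b})"
    using assms(1) by (intro continuous_imp_measurable_on_sets_lebesgue) auto
qed (use assms in auto)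

text \<open>The definitions integrate over the open interval with respect to Lebesgue measure, the
  proofs over the closed one with the gauge integral; the end points form a null set.\<close>

lemma lebesgue_on_Ioo:
  fixes h :: "real \<Rightarrow> 'a::euclidean_space"
  assumes "h absolutely_integrable_on {a..b}"
  shows "integrable (lebesgue_on {a<..<b}) h" "integral\<^sup>L (lebesgue_on {a<..<b}) h = integral {a..b} h"
proof -
  show i: "integrable (lebesgue_on {a<..<b}) h"
    using assms by (intro absolutely_integrable_imp_integrable) (simp_all add: absolutely_integrable_on_Icc_iff_Ioo)
  show "integral\<^sup>L (lebesgue_on {a<..<b}) h = integral {a..b} h"
    using lebesgue_integral_eq_integral[OF i] by (simp add: integral_open_interval_real)
qed

lemma absolutely_integrable_if_lebesgue_on_Ioo:
  fixes h :: "real \<Rightarrow> 'a::euclidean_space"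
  assumes "integrable (lebesgue_on {a<..<b}) h"
  shows "h absolutely_integrable_on {a..b}"
proof -
  have "h absolutely_integrable_on {a<..<b}"
    unfolding set_integrable_def using assms by (subst (asm) integrable_restrict_space) auto
  then show ?thesis by (simp add: absolutely_integrable_on_Icc_iff_Ioo)
qed

lemma square_integrable_absolutely:
  fixes g :: "real \<Rightarrow> 'a::euclidean_space"
  assumes "square_integrable L g"
  shows "g absolutely_integrable_on {0..L}" "(\<lambda>s. (norm (g s))\<^sup>2) absolutely_integrable_on {0..L}"
proof -
  have m: "g \<in> borel_measurable (lebesgue_on {0<..<L})"
    and i: "integrable (lebesgue_on {0<..<L}) (\<lambda>s. (norm (g s))\<^sup>2)"
    using assms by (auto simp: square_integrable_def)
  show "(\<lambda>s. (norm (g s))\<^sup>2) absolutely_integrable_on {0..L}"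
    by (rule absolutely_integrable_if_lebesgue_on_Ioo[OF i])
  have c: "integrable (lebesgue_on {0<..<L}) (\<lambda>s. 1 :: real)"
    by (rule lebesgue_on_Ioo) (rule absolutely_integrable_continuous_real, simp)
  have "integrable (lebesgue_on {0<..<L}) g"
  proof (rule Bochner_Integration.integrable_bound[OF Bochner_Integration.integrable_add[OF c i] m])
    have "norm x \<le> norm (1 + (norm x)\<^sup>2)" for x :: 'a
    proof -
      have "0 \<le> (norm x - 1)\<^sup>2 + (norm x)\<^sup>2 + 1" by simp
      then have "2 * norm x \<le> 2 * (1 + (norm x)\<^sup>2)" by (simp add: power2_diff)
      then show ?thesis by simp
    qed
    then show "AE x in lebesgue_on {0<..<L}. norm (g x) \<le> norm (1 + (norm (g x))\<^sup>2)" by simp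
  qed
  then show "g absolutely_integrable_on {0..L}" by (rule absolutely_integrable_if_lebesgue_on_Ioo)
qed

lemma test_function_ac_on:
  assumes "test_function L \<phi>"
  shows "ac_on a b \<phi> (deriv \<phi>)"
  by (intro ac_on_DERIV smooth_has_derivative smooth_continuous_on smooth_deriv test_functionD(1)[OF assms])

lemma ac_on_test_parts:
  fixes f g :: "real \<Rightarrow> 'a::euclidean_space"
  assumes ac: "ac_on 0 L f g" and \<phi>: "test_function L \<phi>" and L: "0 < L"
  shows "(\<lambda>s. deriv \<phi> s *\<^sub>R f s) absolutely_integrable_on {0..L}"
    and "(\<lambda>s. \<phi> s *\<^sub>R g s) absolutely_integrable_on {0..L}"
    and "integral {0..L} (\<lambda>s. deriv \<phi> s *\<^sub>R f s) = - integral {0..L} (\<lambda>s. \<phi> s *\<^sub>R g s)"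
proof -
  note s = test_functionD(1)[OF \<phi>]
  have c: "continuous_on {0..L} \<phi>" "continuous_on {0..L} (deriv \<phi>)"
    by (intro smooth_continuous_on s smooth_deriv)+
  show i1: "(\<lambda>s. deriv \<phi> s *\<^sub>R f s) absolutely_integrable_on {0..L}"
    by (intro absolutely_integrable_continuous_real continuous_intros c ac_on_continuous[OF ac])
  show i2: "(\<lambda>s. \<phi> s *\<^sub>R g s) absolutely_integrable_on {0..L}"
    by (intro absolutely_integrable_continuous_scaleR c) (use ac in \<open>simp add: ac_on_def\<close>)
  show "integral {0..L} (\<lambda>s. deriv \<phi> s *\<^sub>R f s) = - integral {0..L} (\<lambda>s. \<phi> s *\<^sub>R g s)"
  proof (rule euclidean_eqI)
    fix b :: 'a
    have "ac_on 0 L (\<lambda>s. \<phi> s * (f s \<bullet> b)) (\<lambda>s. deriv \<phi> s * (f s \<bullet> b) + \<phi> s * (g s \<bullet> b))"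
      by (intro ac_on_mult test_function_ac_on[OF \<phi>] ac_on_linear[OF ac bounded_linear_inner_left])
    from ac_on_increment[OF this, of 0 L] L test_functionD(3,4)[OF \<phi>]
    have z: "integral {0..L} (\<lambda>s. (deriv \<phi> s *\<^sub>R f s + \<phi> s *\<^sub>R g s) \<bullet> b) = 0"
      by (simp add: inner_add_left)
    have "integral {0..L} (\<lambda>s. deriv \<phi> s *\<^sub>R f s + \<phi> s *\<^sub>R g s)
        = integral {0..L} (\<lambda>s. deriv \<phi> s *\<^sub>R f s) + integral {0..L} (\<lambda>s. \<phi> s *\<^sub>R g s)"
      using i1 i2 by (intro integral_add) (auto simp: absolutely_integrable_on_def)
    moreover have "integral {0..L} (\<lambda>s. (deriv \<phi> s *\<^sub>R f s + \<phi> s *\<^sub>R g s) \<bullet> b)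
        = integral {0..L} (\<lambda>s. deriv \<phi> s *\<^sub>R f s + \<phi> s *\<^sub>R g s) \<bullet> b"
      using i1 i2 by (intro integral_component_eq integrable_add) (auto simp: absolutely_integrable_on_def)
    ultimately show "integral {0..L} (\<lambda>s. deriv \<phi> s *\<^sub>R f s) \<bullet> b = (- integral {0..L} (\<lambda>s. \<phi> s *\<^sub>R g s)) \<bullet> b"
      using z by (simp add: inner_add_left inner_minus_left)
  qed
qed

lemma locally_integrable_if_absolutely:
  fixes g :: "real \<Rightarrow> 'a::euclidean_space"
  assumes "g absolutely_integrable_on {0..L}"
  shows "locally_integrable L g"
  unfolding locally_integrable_def
proof (intro allI impI)
  fix a b :: real assume "0 < a" "b < L"
  then show "integrable (lebesgue_on {a..b}) g"
    by (intro absolutely_integrable_imp_integrable absolutely_integrable_on_subinterval[OF assms]) auto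
qed

lemma weak_derivative_if_ac_on:
  fixes f g :: "real \<Rightarrow> 'a::euclidean_space"
  assumes "ac_on 0 L f g" "0 < L"
  shows "weak_derivative L f g"
  unfolding weak_derivative_def
  using assms ac_on_test_parts[OF assms(1) _ assms(2)]
  by (auto simp: lebesgue_on_Ioo(2) ac_on_def[of 0 L f g]
      intro!: locally_integrable_if_absolutely absolutely_integrable_continuous_real ac_on_continuous[OF assms(1)])

text \<open>The difference of \<open>f\<close> and a primitive of \<open>g\<close> is orthogonal to
  the derivatives of all test functions, hence constant by du Bois-Reymond's lemma in each
  coordinate. Continuity of \<open>f\<close> singles out the representative.\<close>

lemma ac_on_if_weak_derivative:
  fixes f g :: "real \<Rightarrow> 'a::euclidean_space"
  assumes w: "weak_derivative L f g" and L: "0 < L" and f: "continuous_on {0..L} f"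
    and g: "g absolutely_integrable_on {0..L}"
  shows "ac_on 0 L f g"
proof (rule ac_onI_increment[OF g])
  define G where "G t = integral {0..t} g" for t
  have G: "ac_on 0 L G g" by (rule ac_onI_increment[OF g]) (simp add: G_def)
  fix t assume t: "0 \<le> t" "t \<le> L"
  have "f t - G t = f 0 - G 0"
  proof (rule euclidean_eqI)
    fix b :: 'a
    show "(f t - G t) \<bullet> b = (f 0 - G 0) \<bullet> b"
    proof (rule du_Bois_Reymond[OF L, of "\<lambda>t. (f t - G t) \<bullet> b"])
      show "continuous_on {0..L} (\<lambda>t. (f t - G t) \<bullet> b)"
        by (intro continuous_intros f ac_on_continuous[OF G])
      fix \<phi> assume \<phi>: "test_function L \<phi>"
      have c: "continuous_on {0..L} \<phi>" "continuous_on {0..L} (deriv \<phi>)"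
        by (intro smooth_continuous_on smooth_deriv test_functionD(1)[OF \<phi>])+
      have i: "(\<lambda>s. deriv \<phi> s *\<^sub>R f s) absolutely_integrable_on {0..L}"
        by (intro absolutely_integrable_continuous_real continuous_intros c f)
      note p = ac_on_test_parts[OF G \<phi> L]
      have "integral {0..L} (\<lambda>s. deriv \<phi> s *\<^sub>R f s) = - integral {0..L} (\<lambda>s. \<phi> s *\<^sub>R g s)"
        using w \<phi> unfolding weak_derivative_def by (simp flip: lebesgue_on_Ioo(2)[OF i] lebesgue_on_Ioo(2)[OF p(2)])
      then have "integral {0..L} (\<lambda>s. deriv \<phi> s *\<^sub>R f s - deriv \<phi> s *\<^sub>R G s) = 0"
        using i p by (subst integral_diff) (auto simp: absolutely_integrable_on_def)
      moreover have "integral {0..L} (\<lambda>s. (deriv \<phi> s *\<^sub>R f s - deriv \<phi> s *\<^sub>R G s) \<bullet> b)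
          = integral {0..L} (\<lambda>s. deriv \<phi> s *\<^sub>R f s - deriv \<phi> s *\<^sub>R G s) \<bullet> b"
        using i p(1) by (intro integral_component_eq integrable_diff) (auto simp: absolutely_integrable_on_def)
      ultimately show "integral {0..L} (\<lambda>x. deriv \<phi> x * ((f x - G x) \<bullet> b)) = 0"
        by (simp flip: scaleR_diff_right)
    qed (use t in auto)
  qed
  then show "f t - f 0 = integral {0..t} g" by (simp add: G_def algebra_simps)
qed

lemma ac_on_spike:
  assumes "ac_on a b u v" "negligible N" "\<And>x. x \<in> {a..b} - N \<Longrightarrow> w x = v x"
  shows "ac_on a b u w"
proof (rule ac_onI_increment)
  show "w absolutely_integrable_on {a..b}"
    by (rule absolutely_integrable_spike[OF _ assms(2,3)]) (use assms(1) in \<open>simp_all add: ac_on_def\<close>)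
  fix t assume t: "a \<le> t" "t \<le> b"
  have "integral {a..t} w = integral {a..t} v"
    by (rule integral_spike[OF assms(2)]) (use t assms(3) in auto)
  then show "u t - u a = integral {a..t} w" using ac_on_increment[OF assms(1) order_refl t] by simp
qed

section \<open>Plane curves in terms of their tangent angle\<close>

lemma rot90_nth [simp]: "rot90 v $ 1 = - v $ 2" "rot90 v $ 2 = v $ 1"
  by (simp_all add: rot90_def)

lemma norm_one_components:
  fixes v :: "real^2"
  assumes "norm v = 1"
  shows "(v $ 1)\<^sup>2 + (v $ 2)\<^sup>2 = 1"
  using assms by (simp add: norm_eq_1 inner_vec_def sum_2 power2_eq_square)

lemma ac_on_vec_nth:
  fixes u v :: "real \<Rightarrow> real^2"
  assumes "ac_on a b u v"
  shows "ac_on a b (\<lambda>t. u t $ i) (\<lambda>t. v t $ i)"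
  by (rule ac_on_linear[OF assms bounded_linear_vec_nth])

context
  fixes L :: real and \<gamma> :: "real \<Rightarrow> real^2"
  assumes \<gamma>: "\<gamma> \<in> W22_arc L" and L: "0 < L"
begin

lemma continuous_tangent: "continuous_on {0..L} (tangent L \<gamma>)"
  using \<gamma> by (simp add: W22_arc_def)

lemma norm_tangent: "t \<in> {0..L} \<Longrightarrow> norm (tangent L \<gamma> t) = 1"
  using \<gamma> by (simp add: W22_arc_def)

lemma ac_on_curve: "ac_on 0 L \<gamma> (tangent L \<gamma>)"
  using \<gamma> continuous_tangent
  by (intro ac_on_ftc) (auto simp: W22_arc_def tangent_def simp flip: vector_derivative_works)

text \<open>Differentiating the squared norm of the unit tangent \<open>T\<close> makes the second
  derivative \<open>f2\<close> orthogonal to \<open>T\<close> almost everywhere, so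
  \<open>f2\<close> is a multiple of the normal, and the factor is the determinant of
  \<open>T\<close> and \<open>f2\<close>.\<close>

lemma signed_curvature_exists: "\<exists>k. is_signed_curvature L \<gamma> k"
proof -
  obtain f1 f2 where f: "weak_derivative L \<gamma> f1" "weak_derivative L f1 f2" "square_integrable L f2"
    using \<gamma> by (auto simp: W22_arc_def W22_def)
  let ?T = "tangent L \<gamma>"
  have wT: "weak_derivative L \<gamma> ?T" by (rule weak_derivative_if_ac_on[OF ac_on_curve L])
  have f2: "f2 absolutely_integrable_on {0..L}" by (rule square_integrable_absolutely[OF f(3)])
  have "weak_derivative L ?T f2"
    unfolding weak_derivative_def
  proof (intro conjI allI impI)
    show "locally_integrable L ?T" "locally_integrable L f2"
      using wT f(2) by (auto simp: weak_derivative_def)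
    fix \<phi> assume \<phi>: "test_function L \<phi>"
    \<comment> \<open>\<open>f1\<close> and the tangent are both weak derivatives of the curve;
      testing the curve with \<open>deriv \<phi>\<close> equates the two integrals.\<close>
    have "(\<integral>s. deriv \<phi> s *\<^sub>R ?T s \<partial>lebesgue_on {0<..<L}) = (\<integral>s. deriv \<phi> s *\<^sub>R f1 s \<partial>lebesgue_on {0<..<L})"
    proof -
      have "(\<integral>s. deriv (deriv \<phi>) s *\<^sub>R \<gamma> s \<partial>lebesgue_on {0<..<L}) = - (\<integral>s. deriv \<phi> s *\<^sub>R ?T s \<partial>lebesgue_on {0<..<L})"
        "(\<integral>s. deriv (deriv \<phi>) s *\<^sub>R \<gamma> s \<partial>lebesgue_on {0<..<L}) = - (\<integral>s. deriv \<phi> s *\<^sub>R f1 s \<partial>lebesgue_on {0<..<L})"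
        using wT f(1) test_function_deriv[OF \<phi>] unfolding weak_derivative_def by blast+
      then show ?thesis by simp
    qed
    then show "(\<integral>s. deriv \<phi> s *\<^sub>R ?T s \<partial>lebesgue_on {0<..<L}) = - (\<integral>s. \<phi> s *\<^sub>R f2 s \<partial>lebesgue_on {0<..<L})"
      using f(2) \<phi> by (simp add: weak_derivative_def)
  qed
  then have T: "ac_on 0 L ?T f2"
    by (rule ac_on_if_weak_derivative[OF _ L continuous_tangent f2])
  define D where "D t = (f2 t $ 1 * ?T t $ 1 + ?T t $ 1 * f2 t $ 1) + (f2 t $ 2 * ?T t $ 2 + ?T t $ 2 * f2 t $ 2)" for t
  have D: "ac_on 0 L (\<lambda>t. ?T t $ 1 * ?T t $ 1 + ?T t $ 2 * ?T t $ 2) D"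
    unfolding D_def by (intro ac_on_add ac_on_mult ac_on_vec_nth T)
  have one: "?T t $ 1 * ?T t $ 1 + ?T t $ 2 * ?T t $ 2 = 1" if "t \<in> {0..L}" for t
    using norm_one_components[OF norm_tangent[OF that]] by (simp add: power2_eq_square)
  have "negligible {x \<in> {0..L}. D x \<noteq> 0}"
  proof (rule negligible_of_integral_zero)
    show "D absolutely_integrable_on {0..L}" using D by (simp add: ac_on_def)
    show "integral {0..t} D = 0" if "0 \<le> t" "t \<le> L" for t
      using ac_on_increment[OF D order_refl that] one[of t] one[of 0] that by simp
  qed
  define k where "k t = ?T t $ 1 * f2 t $ 2 - ?T t $ 2 * f2 t $ 1" for t
  have kN: "k t *\<^sub>R rot90 (?T t) = f2 t" if "t \<in> {0..L}" "D t = 0" for t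
  proof -
    define x y p q where "x = ?T t $ 1" "y = ?T t $ 2" "p = f2 t $ 1" "q = f2 t $ 2"
    have "x * x + y * y = 1" "x * p + y * q = 0"
      using one[OF that(1)] that(2) by (auto simp: D_def x_y_p_q_def algebra_simps)
    then have "(x * q - y * p) * (- y) = p" "(x * q - y * p) * x = q" by algebra+
    then show ?thesis by (simp add: vec_eq_iff forall_2 k_def x_y_p_q_def)
  qed
  have kT: "ac_on 0 L ?T (\<lambda>t. k t *\<^sub>R rot90 (?T t))"
    by (rule ac_on_spike[OF T \<open>negligible {x \<in> {0..L}. D x \<noteq> 0}\<close>]) (use kN in auto)
  have "square_integrable L k"
    unfolding square_integrable_def
  proof
    have Tm: "?T \<in> borel_measurable (lebesgue_on {0<..<L})"
      by (intro continuous_imp_measurable_on_sets_lebesgue continuous_on_subset[OF continuous_tangent]) auto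
    have fm: "f2 \<in> borel_measurable (lebesgue_on {0<..<L})" using f(3) by (simp add: square_integrable_def)
    have nth: "(\<lambda>t. u t $ i) \<in> borel_measurable M" if "u \<in> borel_measurable M" for u :: "real \<Rightarrow> real^2" and M i
      using borel_measurable_inner[OF that borel_measurable_const[of "axis i 1"]] by (simp add: inner_axis)
    show km: "k \<in> borel_measurable (lebesgue_on {0<..<L})"
      unfolding k_def by (intro borel_measurable_diff borel_measurable_times nth Tm fm)
    show "integrable (lebesgue_on {0<..<L}) (\<lambda>s. (norm (k s))\<^sup>2)"
    proof (rule Bochner_Integration.integrable_bound)
      show "integrable (lebesgue_on {0<..<L}) (\<lambda>s. (norm (f2 s))\<^sup>2)"
        using f(3) by (simp add: square_integrable_def)
      show "(\<lambda>s. (norm (k s))\<^sup>2) \<in> borel_measurable (lebesgue_on {0<..<L})" using km by measurable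
      show "AE s in lebesgue_on {0<..<L}. norm ((norm (k s))\<^sup>2) \<le> norm ((norm (f2 s))\<^sup>2)"
      proof (rule AE_I2)
        fix s assume "s \<in> space (lebesgue_on {0<..<L})"
        then have s: "s \<in> {0..L}" by simp
        define x y p q where "x = ?T s $ 1" "y = ?T s $ 2" "p = f2 s $ 1" "q = f2 s $ 2"
        \<comment> \<open>Lagrange's identity: as \<open>T\<close> is a unit vector, the squares of
          the inner product and of the determinant add up to the squared norm of
          \<open>f2\<close>.\<close>
        have "x * x + y * y = 1" using one[OF s] by (simp add: x_y_p_q_def)
        then have "p\<^sup>2 + q\<^sup>2 - (x * q - y * p)\<^sup>2 = (x * p + y * q)\<^sup>2" by algebra
        then have "(x * q - y * p)\<^sup>2 \<le> p\<^sup>2 + q\<^sup>2" using zero_le_power2[of "x * p + y * q"] by linarith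
        moreover have "(norm (f2 s))\<^sup>2 = p\<^sup>2 + q\<^sup>2"
          unfolding power2_norm_eq_inner inner_vec_def sum_2 x_y_p_q_def by (simp add: power2_eq_square)
        ultimately show "norm ((norm (k s))\<^sup>2) \<le> norm ((norm (f2 s))\<^sup>2)"
          by (simp add: k_def x_y_p_q_def)
      qed
    qed
  qed
  then show ?thesis
    unfolding is_signed_curvature_def using weak_derivative_if_ac_on[OF kT L] by blast
qed

lemma ac_on_tangent:
  assumes "is_signed_curvature L \<gamma> k"
  shows "ac_on 0 L (tangent L \<gamma>) (\<lambda>t. k t *\<^sub>R rot90 (tangent L \<gamma> t))"
proof -
  have k: "k absolutely_integrable_on {0..L}"
    using assms square_integrable_absolutely unfolding is_signed_curvature_def by blast
  have "bounded_linear rot90"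
    by (intro linear_conv_bounded_linear[THEN iffD1] linearI) (auto simp: vec_eq_iff forall_2)
  then have r: "continuous_on {0..L} (\<lambda>t. rot90 (tangent L \<gamma> t))"
    by (rule bounded_linear.continuous_on[OF _ continuous_tangent])
  have "(\<lambda>t. k t *\<^sub>R rot90 (tangent L \<gamma> t)) absolutely_integrable_on {0..L}"
  proof -
    have "bilinear (\<lambda>(v::real^2) (x::real). x *\<^sub>R v)"
      unfolding bilinear_def by (auto intro!: linearI simp: scaleR_add_right scaleR_add_left)
    then show ?thesis
    proof (rule absolutely_integrable_bounded_measurable_product)
      show "(\<lambda>t. rot90 (tangent L \<gamma> t)) \<in> borel_measurable (lebesgue_on {0..L})"
        using r by (intro continuous_imp_measurable_on_sets_lebesgue) auto
      show "bounded ((\<lambda>t. rot90 (tangent L \<gamma> t)) ` {0..L})"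
        using r by (intro compact_imp_bounded compact_continuous_image) auto
    qed (use k in auto)
  qed
  then show ?thesis
    using assms by (intro ac_on_if_weak_derivative L continuous_tangent) (auto simp: is_signed_curvature_def)
qed

lemma signed_curvature_unique:
  assumes "is_signed_curvature L \<gamma> k" "is_signed_curvature L \<gamma> l"
  shows "negligible {t \<in> {0..L}. k t \<noteq> l t}"
proof -
  let ?N = "\<lambda>t. rot90 (tangent L \<gamma> t)"
  have d: "ac_on 0 L (\<lambda>t. tangent L \<gamma> t - tangent L \<gamma> t) (\<lambda>t. k t *\<^sub>R ?N t - l t *\<^sub>R ?N t)"
    by (intro ac_on_diff ac_on_tangent assms)
  have "negligible {t \<in> {0..L}. k t *\<^sub>R ?N t - l t *\<^sub>R ?N t \<noteq> 0}"
  proof (rule negligible_of_integral_zero)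
    show "integral {0..t} (\<lambda>t. k t *\<^sub>R ?N t - l t *\<^sub>R ?N t) = 0" if "0 \<le> t" "t \<le> L" for t
      using ac_on_increment[OF d order_refl that] by simp
  qed (use d in \<open>simp add: ac_on_def\<close>)
  moreover have "k t *\<^sub>R ?N t - l t *\<^sub>R ?N t \<noteq> 0" if "t \<in> {0..L}" "k t \<noteq> l t" for t
  proof -
    have "?N t \<noteq> 0"
      using norm_one_components[OF norm_tangent[OF that(1)]] by (auto simp: vec_eq_iff forall_2)
    then show ?thesis using that(2) by (simp flip: scaleR_diff_left)
  qed
  ultimately show ?thesis by (elim negligible_subset) auto
qed

text \<open>\<open>signed_curvature\<close> is an arbitrary choice, but two curvature functions
  differ on a null set only, which leaves the integral unchanged.\<close>

lemma bending_energy_eq: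
  assumes "is_signed_curvature L \<gamma> k"
  shows "bending_energy L \<gamma> = integral {0..L} (\<lambda>t. (k t)\<^sup>2)"
proof -
  have s: "is_signed_curvature L \<gamma> (signed_curvature L \<gamma>)"
    unfolding signed_curvature_def using signed_curvature_exists by (rule someI_ex)
  have "(\<lambda>t. (signed_curvature L \<gamma> t)\<^sup>2) absolutely_integrable_on {0..L}"
    using s square_integrable_absolutely(2)[of L "signed_curvature L \<gamma>"] by (simp add: is_signed_curvature_def)
  then have "bending_energy L \<gamma> = integral {0..L} (\<lambda>t. (signed_curvature L \<gamma> t)\<^sup>2)"
    unfolding bending_energy_def by (rule lebesgue_on_Ioo)
  also have "\<dots> = integral {0..L} (\<lambda>t. (k t)\<^sup>2)"
    by (rule integral_spike[OF signed_curvature_unique[OF s assms]]) auto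
  finally show ?thesis .
qed

text \<open>In the moving frame given by \<open>cos (\<theta> t)\<close> and
  \<open>sin (\<theta> t)\<close> the coordinates of the tangent have derivative zero and keep their
  initial values 1 and 0. Integrating \<open>k\<close> thus replaces the lifting of a path from the
  circle to the line.\<close>

lemma angle_lift:
  assumes k: "is_signed_curvature L \<gamma> k" and a: "tangent L \<gamma> 0 = vector [cos a, sin a]"
    and \<theta>: "\<And>t. \<theta> t = a + integral {0..t} k"
  shows "h1_on 0 L \<theta> k"
    and "\<And>t. t \<in> {0..L} \<Longrightarrow> tangent L \<gamma> t = vector [cos (\<theta> t), sin (\<theta> t)]"
    and "\<And>t. t \<in> {0..L} \<Longrightarrow> \<gamma> t = \<gamma> 0 +
      vector [integral {0..t} (\<lambda>s. cos (\<theta> s)), integral {0..t} (\<lambda>s. sin (\<theta> s))]"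
proof -
  have ki: "k absolutely_integrable_on {0..L}" "(\<lambda>t. (k t)\<^sup>2) absolutely_integrable_on {0..L}"
    using square_integrable_absolutely[of L k] k by (auto simp: is_signed_curvature_def)
  have ac: "ac_on 0 L \<theta> k" by (rule ac_onI_increment) (use ki \<theta> in auto)
  then show "h1_on 0 L \<theta> k" using ki by (simp add: h1_on_def absolutely_integrable_on_def)
  let ?T = "tangent L \<gamma>"
  have T1: "ac_on 0 L (\<lambda>t. ?T t $ 1) (\<lambda>t. - (k t * ?T t $ 2))"
    and T2: "ac_on 0 L (\<lambda>t. ?T t $ 2) (\<lambda>t. k t * ?T t $ 1)"
    using ac_on_vec_nth[OF ac_on_tangent[OF k], of 1] ac_on_vec_nth[OF ac_on_tangent[OF k], of 2] by auto
  have c: "ac_on 0 L (\<lambda>t. cos (\<theta> t)) (\<lambda>t. - sin (\<theta> t) * k t)"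
    by (rule ac_on_chain[OF ac]) (auto intro!: derivative_eq_intros continuous_intros)
  have s: "ac_on 0 L (\<lambda>t. sin (\<theta> t)) (\<lambda>t. cos (\<theta> t) * k t)"
    by (rule ac_on_chain[OF ac]) (auto intro!: derivative_eq_intros continuous_intros)
  have A: "ac_on 0 L (\<lambda>t. ?T t $ 1 * cos (\<theta> t) + ?T t $ 2 * sin (\<theta> t)) (\<lambda>t. 0)"
    by (rule ac_on_cong[OF ac_on_add[OF ac_on_mult[OF T1 c] ac_on_mult[OF T2 s]]]) (auto simp: algebra_simps)
  have B: "ac_on 0 L (\<lambda>t. ?T t $ 2 * cos (\<theta> t) - ?T t $ 1 * sin (\<theta> t)) (\<lambda>t. 0)"
    by (rule ac_on_cong[OF ac_on_diff[OF ac_on_mult[OF T2 c] ac_on_mult[OF T1 s]]]) (auto simp: algebra_simps)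
  show T: "?T t = vector [cos (\<theta> t), sin (\<theta> t)]" if t: "t \<in> {0..L}" for t
  proof -
    have \<theta>0: "\<theta> 0 = a" using \<theta> by simp
    have e: "?T t $ 1 * cos (\<theta> t) + ?T t $ 2 * sin (\<theta> t) = cos a * cos a + sin a * sin a"
      "?T t $ 2 * cos (\<theta> t) - ?T t $ 1 * sin (\<theta> t) = sin a * cos a - cos a * sin a"
      using ac_on_increment[OF A, of 0 t] ac_on_increment[OF B, of 0 t] t by (simp_all add: \<theta>0 a)
    define x y c s where "x = ?T t $ 1" "y = ?T t $ 2" "c = cos (\<theta> t)" "s = sin (\<theta> t)"
    have "x * c + y * s = 1" "y * c - x * s = 0" "c * c + s * s = 1"
      using e sin_cos_squared_add3[of a] sin_cos_squared_add3[of "\<theta> t"] by (auto simp: x_y_c_s_def)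
    then have "x = c" "y = s" by algebra+
    then show ?thesis by (simp add: vec_eq_iff forall_2 x_y_c_s_def)
  qed
  show "\<gamma> t = \<gamma> 0 + vector [integral {0..t} (\<lambda>s. cos (\<theta> s)), integral {0..t} (\<lambda>s. sin (\<theta> s))]"
    if t: "t \<in> {0..L}" for t
  proof -
    have "integral {0..t} (\<lambda>s. ?T s $ 1) = integral {0..t} (\<lambda>s. cos (\<theta> s))"
      "integral {0..t} (\<lambda>s. ?T s $ 2) = integral {0..t} (\<lambda>s. sin (\<theta> s))"
      using T t by (auto intro!: integral_cong)
    then show ?thesis
      using ac_on_increment[OF ac_on_vec_nth[OF ac_on_curve, of 1], of 0 t]
        ac_on_increment[OF ac_on_vec_nth[OF ac_on_curve, of 2], of 0 t] t
      by (simp add: vec_eq_iff forall_2 algebra_simps)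
  qed
qed

end

section \<open>The pendulum equation of an elastica\<close>

text \<open>The weak equation is integrated twice. With \<open>\<psi>\<close> for the derivative of
  the test function it says that \<open>J\<close> vanishes on test functions of mean zero. So
  \<open>J\<close> is a multiple \<open>C\<close> of the integral, and du Bois-Reymond's lemma gives
  \<open>k' = V - C\<close>.\<close>

lemma elastica_regular:
  assumes L: "0 < L" and el: "elastica lam L \<gamma>" and k: "is_signed_curvature L \<gamma> k" "continuous_on {0..L} k"
  obtains l where "ac_on 0 L k l" "ac_on 0 L l (\<lambda>t. (lam * k t - k t ^ 3) / 2)"
proof -
  obtain k0 where k0: "is_signed_curvature L \<gamma> k0"
    and eq: "\<And>\<phi>. test_function L \<phi> \<Longrightarrow>
       (\<integral>s. 2 * k0 s * (deriv ^^ 2) \<phi> s + (k0 s ^ 3 - lam * k0 s) * \<phi> s \<partial>lebesgue_on {0<..<L}) = 0"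
    using el by (auto simp: elastica_def)
  have \<gamma>: "\<gamma> \<in> W22_arc L" using el by (simp add: elastica_def)
  have cont: "continuous_on {0..L} \<phi>" "continuous_on {0..L} (deriv \<phi>)" "continuous_on {0..L} (deriv (deriv \<phi>))"
    if "test_function L \<phi>" for \<phi>
    by (intro smooth_continuous_on smooth_deriv test_functionD(1)[OF that])+
  have weak: "integral {0..L} (\<lambda>s. 2 * k s * deriv (deriv \<phi>) s + (k s ^ 3 - lam * k s) * \<phi> s) = 0"
    if \<phi>: "test_function L \<phi>" for \<phi>
  proof -
    define h where "h u s = 2 * u * deriv (deriv \<phi>) s + (u ^ 3 - lam * u) * \<phi> s" for u s
    have h: "(\<lambda>s. h (k s) s) absolutely_integrable_on {0..L}"
      unfolding h_def by (intro absolutely_integrable_continuous_real continuous_intros cont[OF \<phi>] k)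
    \<comment> \<open>The equation is given for some curvature function \<open>k0\<close>, which
      agrees with the continuous \<open>k\<close> off a null set.\<close>
    note neg = signed_curvature_unique[OF \<gamma> L k0 k(1)]
    have h0: "(\<lambda>s. h (k0 s) s) absolutely_integrable_on {0..L}"
      by (rule absolutely_integrable_spike[OF h neg]) auto
    have "integral {0..L} (\<lambda>s. h (k s) s) = integral {0..L} (\<lambda>s. h (k0 s) s)"
      by (rule integral_spike[OF neg]) auto
    also have "\<dots> = 0"
    proof -
      have "(deriv ^^ 2) \<phi> = deriv (deriv \<phi>)" by (simp add: numeral_2_eq_2)
      from eq[OF \<phi>, unfolded this, folded h_def] show ?thesis by (simp only: lebesgue_on_Ioo(2)[OF h0])
    qed
    finally show ?thesis by (simp add: h_def)
  qed
  define v where "v t = (lam * k t - k t ^ 3) / 2" for t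
  have cv: "continuous_on {0..L} v" unfolding v_def by (intro continuous_intros k) auto
  define V where "V t = integral {0..t} v" for t
  have V: "ac_on 0 L V v"
    by (rule ac_onI_increment) (auto simp: V_def intro: absolutely_integrable_continuous_real cv)
  note cV = ac_on_continuous[OF V]
  define J where "J \<psi> = integral {0..L} (\<lambda>s. deriv \<psi> s * k s) + integral {0..L} (\<lambda>s. \<psi> s * V s)" for \<psi>
  have iJ: "(\<lambda>s. deriv \<psi> s * k s) integrable_on {0..L}" "(\<lambda>s. \<psi> s * V s) integrable_on {0..L}"
    if "test_function L \<psi>" for \<psi>
    by (intro integrable_continuous_real continuous_intros cont[OF that] k cV)+
  have Jz: "J \<psi> = 0" if \<psi>: "test_function L \<psi>" "integral {0..L} \<psi> = 0" for \<psi>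
  proof -
    obtain \<phi> where \<phi>: "test_function L \<phi>" "deriv \<phi> = \<psi>"
      using test_function_antiderivative[OF \<psi>(1) L \<psi>(2)] by blast
    have "integral {0..L} (\<lambda>s. 2 * k s * deriv (deriv \<phi>) s + (k s ^ 3 - lam * k s) * \<phi> s)
       = integral {0..L} (\<lambda>s. 2 * (deriv \<psi> s * k s) - 2 * (\<phi> s * v s))"
      by (intro integral_cong) (simp add: \<phi>(2) v_def field_simps)
    also have "\<dots> = 2 * integral {0..L} (\<lambda>s. deriv \<psi> s * k s) - 2 * integral {0..L} (\<lambda>s. \<phi> s * v s)"
    proof (subst integral_diff)
      show "(\<lambda>s. 2 * (deriv \<psi> s * k s)) integrable_on {0..L}" "(\<lambda>s. 2 * (\<phi> s * v s)) integrable_on {0..L}"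
        by (intro integrable_continuous_real continuous_intros cont[OF \<phi>(1)] cont[OF \<psi>(1)] cv k)+
    qed simp
    also have "integral {0..L} (\<lambda>s. \<phi> s * v s) = - integral {0..L} (\<lambda>s. \<psi> s * V s)"
      using ac_on_test_parts(3)[OF V \<phi>(1) L] by (simp add: \<phi>(2))
    finally show ?thesis using weak[OF \<phi>(1)] by (simp add: J_def)
  qed
  have Jlin: "J (\<lambda>s. 1 * \<psi> s + b * \<eta> s) = J \<psi> + b * J \<eta>"
    if "test_function L \<psi>" "test_function L \<eta>" for \<psi> \<eta> b
  proof -
    have "deriv (\<lambda>s. 1 * \<psi> s + b * \<eta> s) s = 1 * deriv \<psi> s + b * deriv \<eta> s" for s
      by (intro DERIV_imp_deriv DERIV_add DERIV_cmult smooth_has_derivative test_functionD(1)[OF that(1)]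
          test_functionD(1)[OF that(2)])
    then have "J (\<lambda>s. 1 * \<psi> s + b * \<eta> s)
       = integral {0..L} (\<lambda>s. deriv \<psi> s * k s + b * (deriv \<eta> s * k s))
       + integral {0..L} (\<lambda>s. \<psi> s * V s + b * (\<eta> s * V s))"
      by (simp add: J_def algebra_simps)
    also have "\<dots> = J \<psi> + b * J \<eta>"
      using iJ[OF that(1)] iJ[OF that(2)]
      by (subst (1 2) integral_add) (auto simp: J_def algebra_simps intro: integrable_on_mult_right)
    finally show ?thesis .
  qed
  have tlin: "test_function L (\<lambda>s. 1 * \<psi> s + b * \<eta> s)"
    if \<psi>: "test_function L \<psi>" and \<eta>: "test_function L \<eta>" for \<psi> \<eta> b
  proof -
    obtain a1 b1 where 1: "0 < a1" "b1 < L" "\<And>x. x \<notin> {a1..b1} \<Longrightarrow> \<psi> x = 0"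
      using \<psi> by (auto simp: test_function_def)
    obtain a2 b2 where 2: "0 < a2" "b2 < L" "\<And>x. x \<notin> {a2..b2} \<Longrightarrow> \<eta> x = 0"
      using \<eta> by (auto simp: test_function_def)
    show ?thesis
      by (rule test_functionI[OF smooth_lincomb[OF test_functionD(1)[OF \<psi>] test_functionD(1)[OF \<eta>]],
            of "min a1 a2" "max b1 b2"]) (use 1 2 in auto)
  qed
  have "\<exists>C. \<forall>\<psi>. test_function L \<psi> \<longrightarrow> J \<psi> = C * integral {0..L} \<psi>"
  proof (cases "\<exists>\<eta>. test_function L \<eta> \<and> integral {0..L} \<eta> \<noteq> 0")
    case True
    then obtain \<eta> where \<eta>: "test_function L \<eta>" "integral {0..L} \<eta> \<noteq> 0" by blast
    show ?thesis
    proof (intro exI[of _ "J \<eta> / integral {0..L} \<eta>"] allI impI)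
      fix \<psi> assume \<psi>: "test_function L \<psi>"
      define b where "b = - integral {0..L} \<psi> / integral {0..L} \<eta>"
      have "\<psi> integrable_on {0..L}" "\<eta> integrable_on {0..L}"
        by (intro integrable_continuous_real cont \<psi> \<eta>)+
      then have "integral {0..L} (\<lambda>s. 1 * \<psi> s + b * \<eta> s) = integral {0..L} \<psi> + b * integral {0..L} \<eta>"
        by (subst integral_add) (auto intro: integrable_on_mult_right)
      then have "integral {0..L} (\<lambda>s. 1 * \<psi> s + b * \<eta> s) = 0"
        using \<eta>(2) by (simp add: b_def)
      then have "J \<psi> + b * J \<eta> = 0"
        using Jz[OF tlin[OF \<psi> \<eta>(1)]] Jlin[OF \<psi> \<eta>(1)] by simp
      then show "J \<psi> = J \<eta> / integral {0..L} \<eta> * integral {0..L} \<psi>"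
        by (simp add: b_def)
    qed
  next
    case False
    then show ?thesis using Jz by (intro exI[of _ 0]) auto
  qed
  then obtain C where C: "\<And>\<psi>. test_function L \<psi> \<Longrightarrow> J \<psi> = C * integral {0..L} \<psi>" by blast
  define l where "l t = V t + - C" for t
  have l: "ac_on 0 L l v" unfolding l_def by (rule ac_on_add_const[OF V])
  define G where "G t = integral {0..t} l" for t
  have G: "ac_on 0 L G l"
    by (rule ac_onI_increment) (auto simp: G_def intro: absolutely_integrable_continuous_real ac_on_continuous[OF l])
  have "k t - G t = k 0 - G 0" if t: "t \<in> {0..L}" for t
  proof (rule du_Bois_Reymond[OF L _ _ t, of "\<lambda>t. k t - G t"])
    show "continuous_on {0..L} (\<lambda>t. k t - G t)" by (intro continuous_intros k ac_on_continuous[OF G])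
    fix \<psi> assume \<psi>: "test_function L \<psi>"
    have i: "(\<lambda>s. deriv \<psi> s * G s) integrable_on {0..L}" "\<psi> integrable_on {0..L}"
      by (intro integrable_continuous_real continuous_intros cont[OF \<psi>] ac_on_continuous[OF G])+
    have "integral {0..L} (\<lambda>s. deriv \<psi> s * G s) = - integral {0..L} (\<lambda>s. \<psi> s * l s)"
      using ac_on_test_parts(3)[OF G \<psi> L] by simp
    also have "integral {0..L} (\<lambda>s. \<psi> s * l s) = integral {0..L} (\<lambda>s. \<psi> s * V s + (- C) * \<psi> s)"
      by (intro integral_cong) (simp add: l_def algebra_simps)
    also have "\<dots> = integral {0..L} (\<lambda>s. \<psi> s * V s) - C * integral {0..L} \<psi>"
    proof -
      have "(\<lambda>s. (- C) * \<psi> s) integrable_on {0..L}" by (intro integrable_on_mult_right i)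
      from integral_add[OF iJ(2)[OF \<psi>] this] show ?thesis by simp
    qed
    finally have "integral {0..L} (\<lambda>s. deriv \<psi> s * G s) = integral {0..L} (\<lambda>s. deriv \<psi> s * k s)"
      using C[OF \<psi>] by (simp add: J_def)
    then show "integral {0..L} (\<lambda>x. deriv \<psi> x * (k x - G x)) = 0"
      using iJ[OF \<psi>] i by (simp add: right_diff_distrib integral_diff)
  qed
  then have kG: "k t = G t + k 0" if "t \<in> {0..L}" for t
    using that by (fastforce simp: G_def)
  have "ac_on 0 L k l"
    by (rule ac_on_cong[OF ac_on_add_const[OF G, of "k 0"]]) (rule kG, auto)
  then show thesis using l by (intro that) (auto simp: v_def[abs_def])
qed

text \<open>The vector \<open>(k\<^sup>2 - lam) T + 2 k' N\<close> is conserved; \<open>p\<close> and \<open>\<beta>\<close> are its polar coordinates.\<close>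

lemma elastica_frame:
  fixes \<theta> k l :: "real \<Rightarrow> real"
  assumes \<theta>: "ac_on 0 L \<theta> k" and k: "ac_on 0 L k l" and l: "ac_on 0 L l (\<lambda>t. (lam * k t - k t ^ 3) / 2)"
  obtains p \<beta> where "0 \<le> p" "\<And>t. t \<in> {0..L} \<Longrightarrow> (k t)\<^sup>2 = lam + p * cos (\<theta> t - \<beta>)"
    "\<And>t. t \<in> {0..L} \<Longrightarrow> 2 * l t = - p * sin (\<theta> t - \<beta>)"
proof -
  have c: "ac_on 0 L (\<lambda>t. cos (\<theta> t)) (\<lambda>t. - sin (\<theta> t) * k t)"
    by (rule ac_on_chain[OF \<theta>]) (auto intro!: derivative_eq_intros continuous_intros)
  have s: "ac_on 0 L (\<lambda>t. sin (\<theta> t)) (\<lambda>t. cos (\<theta> t) * k t)"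
    by (rule ac_on_chain[OF \<theta>]) (auto intro!: derivative_eq_intros continuous_intros)
  have k2: "ac_on 0 L (\<lambda>t. k t * k t - lam) (\<lambda>t. l t * k t + k t * l t)"
    using ac_on_add_const[OF ac_on_mult[OF k k], of "- lam"] by simp
  have l2: "ac_on 0 L (\<lambda>t. 2 * l t) (\<lambda>t. lam * k t - k t ^ 3)"
    by (rule ac_on_cong[OF ac_on_cmult[OF l, of 2]]) auto
  \<comment> \<open>\<open>A\<close> and \<open>B\<close> are the coordinates of the conserved
    vector in the fixed frame.\<close>
  define A where "A t = (k t * k t - lam) * cos (\<theta> t) - 2 * l t * sin (\<theta> t)" for t
  define B where "B t = (k t * k t - lam) * sin (\<theta> t) + 2 * l t * cos (\<theta> t)" for t
  have "ac_on 0 L A (\<lambda>_. 0)"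
    unfolding A_def
    by (rule ac_on_cong[OF ac_on_diff[OF ac_on_mult[OF k2 c] ac_on_mult[OF l2 s]]])
       (auto simp: algebra_simps power3_eq_cube)
  then have A: "A t = A 0" if "t \<in> {0..L}" for t
    using ac_on_increment[of 0 L A "\<lambda>_. 0" 0 t] that by auto
  have "ac_on 0 L B (\<lambda>_. 0)"
    unfolding B_def
    by (rule ac_on_cong[OF ac_on_add[OF ac_on_mult[OF k2 s] ac_on_mult[OF l2 c]]])
       (auto simp: algebra_simps power3_eq_cube)
  then have B: "B t = B 0" if "t \<in> {0..L}" for t
    using ac_on_increment[of 0 L B "\<lambda>_. 0" 0 t] that by auto
  define p where "p = sqrt ((A 0)\<^sup>2 + (B 0)\<^sup>2)"
  have p: "0 \<le> p" "p\<^sup>2 = (A 0)\<^sup>2 + (B 0)\<^sup>2" by (auto simp: p_def)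
  obtain \<beta> where \<beta>: "A 0 = p * cos \<beta>" "B 0 = p * sin \<beta>"
  proof (cases "p = 0")
    case True
    then show ?thesis using that[of 0] p by (simp add: sum_power2_eq_zero_iff)
  next
    case False
    then have "(A 0 / p)\<^sup>2 + (B 0 / p)\<^sup>2 = 1"
    proof -
      have "(A 0 / p)\<^sup>2 + (B 0 / p)\<^sup>2 = ((A 0)\<^sup>2 + (B 0)\<^sup>2) / p\<^sup>2"
        by (simp add: power_divide add_divide_distrib)
      then show ?thesis using False by (simp flip: p(2))
    qed
    then obtain b where "A 0 / p = cos b" "B 0 / p = sin b" using sincos_total_2pi by metis
    then show ?thesis using that[of b] False by (simp add: field_simps)
  qed
  show thesis
  proof (rule that[OF p(1)])
    fix t assume t: "t \<in> {0..L}"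
    define x y a b where "x = k t * k t - lam" "y = 2 * l t" "a = cos (\<theta> t)" "b = sin (\<theta> t)"
    have e: "x * a - y * b = p * cos \<beta>" "x * b + y * a = p * sin \<beta>" "a * a + b * b = 1"
      using A[OF t] B[OF t] \<beta> sin_cos_squared_add3[of "\<theta> t"] by (auto simp: A_def B_def x_y_a_b_def)
    then have "x = p * (a * cos \<beta> + b * sin \<beta>)" by algebra
    then show "(k t)\<^sup>2 = lam + p * cos (\<theta> t - \<beta>)"
      by (simp add: x_y_a_b_def cos_diff power2_eq_square)
    have "y = - p * (b * cos \<beta> - a * sin \<beta>)" using e by algebra
    then show "2 * l t = - p * sin (\<theta> t - \<beta>)"
      by (simp add: x_y_a_b_def sin_diff)
  qed
qed

text \<open>Once full turns are removed, the angle starts in \<open>{0..pi}\<close>; to leave this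
  interval it would, by continuity, take values with negative sine.\<close>

lemma angle_in_half_turn:
  fixes \<theta> :: "real \<Rightarrow> real"
  assumes L: "0 \<le> L" and c: "continuous_on {0..L} \<theta>" and s: "\<And>t. t \<in> {0..L} \<Longrightarrow> 0 \<le> sin (\<theta> t)"
  obtains N :: int where "\<And>t. t \<in> {0..L} \<Longrightarrow> \<theta> t - 2 * pi * of_int N \<in> {0..pi}"
proof -
  define N where "N = \<lfloor>\<theta> 0 / (2 * pi)\<rfloor>"
  define u where "u t = \<theta> t - 2 * pi * of_int N" for t
  have su: "0 \<le> sin (u t)" if "t \<in> {0..L}" for t
    using s[OF that] cos_int_2pin[of N] sin_int_2pin[of N] by (simp add: u_def sin_diff)
  have u0: "0 \<le> u 0" "u 0 < 2 * pi"
    using floor_divide_lower[of "2 * pi" "\<theta> 0"] floor_divide_upper[of "2 * pi" "\<theta> 0"]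
    by (auto simp: u_def N_def algebra_simps)
  have u0pi: "u 0 \<le> pi"
    using su[of 0] L sin_lt_zero[of "u 0"] u0 by (cases "pi < u 0") auto
  have cu: "continuous_on {0..t} u" if "t \<in> {0..L}" for t
    unfolding u_def by (intro continuous_intros continuous_on_subset[OF c]) (use that in auto)
  have "u t \<in> {0..pi}" if t: "t \<in> {0..L}" for t
  proof (rule ccontr)
    assume "u t \<notin> {0..pi}"
    then consider "pi < u t" | "u t < 0" by force
    then show False
    proof cases
      case 1
      define y where "y = min (u t) (3 * pi / 2)"
      have y: "pi < y" "y < 2 * pi" "y \<le> u t" using 1 pi_gt_zero by (simp_all add: y_def min_def)
      have "\<exists>x\<ge>0. x \<le> t \<and> u x = y" using y u0pi t cu[OF t] by (intro IVT') auto
      then obtain x where "0 \<le> x" "x \<le> t" "u x = y" by blast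
      then show False using su[of x] sin_lt_zero[OF y(1,2)] t by auto
    next
      case 2
      define y where "y = max (u t) (- pi / 2)"
      have y: "- pi < y" "y < 0" "u t \<le> y" using 2 pi_gt_zero by (simp_all add: y_def max_def)
      have "\<exists>x\<ge>0. x \<le> t \<and> u x = y" using y u0 t cu[OF t] by (intro IVT2') auto
      then obtain x where "0 \<le> x" "x \<le> t" "u x = y" by blast
      moreover have "0 < sin (- y)" using y by (intro sin_gt_zero) auto
      ultimately show False using su[of x] t by auto
    qed
  qed
  then show thesis using that[of N] by (simp add: u_def)
qed

text \<open>The angle pi with zero curvature is an equilibrium. Uniqueness is applied forward from
  \<open>t0\<close> and, after reversing time, backward.\<close>

lemma pendulum_rest:
  fixes \<theta> k :: "real \<Rightarrow> real"
  assumes \<theta>: "ac_on 0 L \<theta> k" "ac_on 0 L k (\<lambda>t. - a * sin (\<theta> t))"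
    and t0: "t0 \<in> {0..L}" "\<theta> t0 = pi" "k t0 = 0" and t: "t \<in> {0..L}"
  shows "k t = 0"
proof -
  have const: "ac_on 0 b (\<lambda>_. pi) (\<lambda>_. 0)" "ac_on 0 b (\<lambda>_. 0) (\<lambda>_. - a * sin pi)" for b
    using ac_on_const[of 0 b] by auto
  show ?thesis
  proof (cases "t0 \<le> t")
    case True
    have "ac_on 0 (L - t0) (\<lambda>t. \<theta> (t + t0)) (\<lambda>t. k (t + t0))"
      "ac_on 0 (L - t0) (\<lambda>t. k (t + t0)) (\<lambda>t. - a * sin (\<theta> (t + t0)))"
      using ac_on_shift[OF ac_on_subinterval[OF \<theta>(1), of t0 L], of "- t0"]
        ac_on_shift[OF ac_on_subinterval[OF \<theta>(2), of t0 L], of "- t0"] t0 by auto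
    from pendulum_unique[OF this const, of "t - t0"] show ?thesis using True t t0 by simp
  next
    case False
    have "ac_on 0 t0 (\<lambda>t. \<theta> (t0 - t)) (\<lambda>t. - k (t0 - t))"
      using t0 by (intro ac_on_reverse ac_on_subinterval[OF \<theta>(1)]) auto
    moreover have "ac_on 0 t0 (\<lambda>t. - k (t0 - t)) (\<lambda>t. - a * sin (\<theta> (t0 - t)))"
      using ac_on_minus[OF ac_on_reverse[OF ac_on_subinterval[OF \<theta>(2), of 0 t0]]] t0 by simp
    ultimately have "\<theta> (t0 - (t0 - t)) = pi \<and> - k (t0 - (t0 - t)) = 0"
      using t0 t False by (intro pendulum_unique[OF _ _ const, where L = t0]) auto
    then show ?thesis by simp
  qed
qed

text \<open>The assumption \<open>sub\<close> is the analytic form of not being subcritical: it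
  speaks of the tangent angle and of \<open>ellW\<close> instead of similarities and
  \<open>m0\<close>.\<close>

lemma pendulum_minimal:
  assumes L: "0 < L" and M: "0 < M" and p: "0 < p"
    and \<alpha>: "ac_on 0 L \<alpha> \<kappa>" "ac_on 0 L \<kappa> (\<lambda>t. - (p / 2) * sin (\<alpha> t))"
    and ode: "\<And>t. t \<in> {0..L} \<Longrightarrow> (\<kappa> t)\<^sup>2 = lam + p * cos (\<alpha> t)"
    and rng: "\<And>t. t \<in> {0..L} \<Longrightarrow> \<alpha> t \<in> {0..pi}"
    and nonconst: "\<exists>t\<in>{0..L}. \<kappa> t \<noteq> \<kappa> 0"
    and sub: "\<And>m c s0. 0 < m \<Longrightarrow> m < 1 \<Longrightarrow> 0 < c \<Longrightarrow>
      (\<And>t. t \<in> {0..L} \<Longrightarrow> \<alpha> t = wth c m (s0 + t)) \<Longrightarrow> ellW m \<le> 0"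
    and \<phi>: "h1_on 0 M \<phi> g" "\<phi> 0 = \<alpha> 0" "\<phi> M = \<alpha> L + 2 * pi * of_int n"
    and X: "integral {0..M} (\<lambda>t. cos (\<phi> t)) = integral {0..L} (\<lambda>t. cos (\<alpha> t))"
    and Y: "integral {0..M} (\<lambda>t. sin (\<phi> t)) = integral {0..L} (\<lambda>t. sin (\<alpha> t))"
  shows "path_energy lam L \<kappa> \<le> path_energy lam M g \<and>
    (path_energy lam M g \<le> path_energy lam L \<kappa> \<longrightarrow> M = L \<and> (\<forall>t\<in>{0..L}. \<phi> t = \<alpha> t))"
proof (cases "p \<le> lam")
  case True
  \<comment> \<open>A zero of the curvature would force \<open>lam = p\<close> and the angle pi,
    hence rest at the equilibrium and constant curvature.\<close>
  have "\<kappa> t \<noteq> 0" if t: "t \<in> {0..L}" for t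
  proof
    assume z: "\<kappa> t = 0"
    then have "lam + p * cos (\<alpha> t) = 0" using ode[OF t] by simp
    moreover have "p * (-1) \<le> p * cos (\<alpha> t)" using p by (intro mult_left_mono) auto
    ultimately have "p * cos (\<alpha> t) = p * (-1)" using True by linarith
    then have "cos (\<alpha> t) = cos pi" using p unfolding mult_left_cancel[OF less_imp_neq[OF p, symmetric]] by simp
    then have "\<alpha> t = pi" using rng[OF t] cos_inj_pi[of "\<alpha> t" pi] by auto
    then have "\<kappa> s = 0" if "s \<in> {0..L}" for s using pendulum_rest[OF \<alpha> t _ z that] by simp
    then show False using nonconst L by auto
  qed
  then show ?thesis
    using orbit_minimal[OF p True L M \<alpha>(1) ac_on_continuous[OF \<alpha>(2)] ode _ rng \<phi> X Y] by blast
next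
  case False
  have lam: "- p < lam"
  proof (rule ccontr)
    assume "\<not> - p < lam"
    have "\<kappa> t = 0" if "t \<in> {0..L}" for t
    proof -
      have "p * cos (\<alpha> t) \<le> p * 1" using p by (intro mult_left_mono) auto
      then have "(\<kappa> t)\<^sup>2 \<le> 0" using ode[OF that] \<open>\<not> - p < lam\<close> by linarith
      then show ?thesis by simp
    qed
    then show False using nonconst L by auto
  qed
  \<comment> \<open>\<open>m\<close> and \<open>c\<close> solve
    \<open>lam = 2 * c\<^sup>2 * (2 * m - 1)\<close> and \<open>p = 2 * c\<^sup>2\<close>, the
    constants of \<open>wk_sq\<close>; the bounds \<open>- p < lam\<close> and
    \<open>lam < p\<close> place \<open>m\<close> in (0,1).\<close>
  define m where "m = (1 + lam / p) / 2"
  define c where "c = sqrt (p / 2)"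
  have c: "0 < c" "2 * c\<^sup>2 = p" using p by (auto simp: c_def)
  have m: "0 < m" "m < 1" using lam False p by (auto simp: m_def field_simps)
  have lm: "lam = 2 * c\<^sup>2 * (2 * m - 1)" unfolding c(2) using p by (simp add: m_def field_simps)
  have "\<alpha> 0 \<noteq> pi"
  proof
    assume "\<alpha> 0 = pi"
    then have "(\<kappa> 0)\<^sup>2 < 0" using ode[of 0] L False by simp
    then show False by simp
  qed
  then have \<alpha>0: "- pi < \<alpha> 0" "\<alpha> 0 < pi" using rng[of 0] L by auto
  have "(\<kappa> 0)\<^sup>2 = 2 * c\<^sup>2 * (2 * m - 1) + 2 * c\<^sup>2 * cos (\<alpha> 0)"
    using ode[of 0] L unfolding lm[symmetric] unfolding c(2) by simp
  then obtain s0 where s0: "0 \<le> s0" "am (c * s0) m < 2 * pi" "wth c m s0 = \<alpha> 0" "wk c m s0 = \<kappa> 0"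
    using wave_phase[OF m c(1) \<alpha>0] by blast
  have w: "ac_on 0 L (\<lambda>t. wth c m (s0 + t)) (\<lambda>t. wk c m (s0 + t))"
    "ac_on 0 L (\<lambda>t. wk c m (s0 + t)) (\<lambda>t. - (p / 2) * sin (wth c m (s0 + t)))"
  proof -
    show "ac_on 0 L (\<lambda>t. wth c m (s0 + t)) (\<lambda>t. wk c m (s0 + t))"
      using ac_on_shift[OF ac_on_wth[OF m, of s0 "s0 + L" c], of "- s0"] by (simp add: add.commute)
    have "ac_on s0 (s0 + L) (wk c m) (\<lambda>s. - c\<^sup>2 * sin (wth c m s))"
      by (intro ac_on_DERIV DERIV_wk[OF m] continuous_intros continuous_on_wth[OF m])
    moreover have "c\<^sup>2 = p / 2" using c(2) by simp
    ultimately show "ac_on 0 L (\<lambda>t. wk c m (s0 + t)) (\<lambda>t. - (p / 2) * sin (wth c m (s0 + t)))"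
      using ac_on_shift[of s0 "s0 + L" "wk c m" "\<lambda>s. - (p / 2) * sin (wth c m s)" "- s0"]
      by (simp only:) (simp add: add.commute)
  qed
  have id: "\<alpha> t = wth c m (s0 + t) \<and> \<kappa> t = wk c m (s0 + t)" if "t \<in> {0..L}" for t
    using pendulum_unique[OF \<alpha> w _ _ that] s0 by simp
  then have W: "ellW m \<le> 0" using sub[OF m c(1), of s0] by blast
  have m2: "1/2 < m"
  proof (rule ccontr)
    assume "\<not> 1/2 < m"
    then consider "m < 1/2" | "m = 1/2" by linarith
    then show False
      using ellW_strict_antimono[of m "1/2"] m W ellW_half_pos by cases auto
  qed
  have s1: "s0 + L \<le> 2 * complete_K m / c"
    using wave_half_period[OF m c(1) L s0(2)] id rng by auto
  have e: "path_energy lam L \<kappa> = path_energy lam L (\<lambda>t. wk c m (s0 + t))"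
    unfolding path_energy_def using id by (intro arg_cong2[where f = "(+)"] integral_cong) auto
  have XY: "integral {0..L} (\<lambda>t. cos (\<alpha> t)) = integral {0..L} (\<lambda>t. cos (wth c m (s0 + t)))"
    "integral {0..L} (\<lambda>t. sin (\<alpha> t)) = integral {0..L} (\<lambda>t. sin (wth c m (s0 + t)))"
    using id by (auto intro!: integral_cong)
  have "path_energy lam L (\<lambda>t. wk c m (s0 + t)) \<le> path_energy lam M g \<and>
    (path_energy lam M g \<le> path_energy lam L (\<lambda>t. wk c m (s0 + t)) \<longrightarrow>
      M = L \<and> (\<forall>t\<in>{0..L}. \<phi> t = wth c m (s0 + t)))"
  proof (rule wave_minimal[OF c(1) m2 m(2) W s0(1) s1 L M \<phi>(1) _ _ _ _ lm, where n = n])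
    show "\<phi> 0 = wth c m s0" unfolding \<phi>(2) s0(3) ..
    show "\<phi> M = wth c m (s0 + L) + 2 * pi * of_int n" unfolding \<phi>(3) using id[of L] L by simp
  qed (simp_all only: X Y XY)
  moreover have "(\<forall>t\<in>{0..L}. \<phi> t = wth c m (s0 + t)) \<longleftrightarrow> (\<forall>t\<in>{0..L}. \<phi> t = \<alpha> t)"
    using id by (intro ball_cong) simp_all
  ultimately show ?thesis unfolding e by blast
qed

text \<open>Passing from the angle \<open>wth\<close> to \<open>\<beta> + \<sigma> * wth\<close>
  rotates the curve by \<open>\<beta>\<close>, after a reflection if \<open>\<sigma> = -1\<close>.
  Arc length on the curve is \<open>1 / c\<close> times the parameter of
  \<open>wave_curve\<close>.\<close>

lemma wavelike_if_angle:
  assumes m: "0 < m" "m < 1" and c: "0 < c" and L: "0 < L" and \<sigma>: "\<sigma> = 1 \<or> \<sigma> = (-1::real)"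
    and \<gamma>: "\<And>t. t \<in> {0..L} \<Longrightarrow> \<gamma> t = \<gamma> 0 +
      vector [integral {0..t} (\<lambda>s. cos (\<theta> s)), integral {0..t} (\<lambda>s. sin (\<theta> s))]"
    and \<theta>: "\<And>t. t \<in> {0..L} \<Longrightarrow> \<theta> t = \<beta> + \<sigma> * wth c m (s0 + t)"
  shows "wavelike_elastica m L \<gamma>"
proof -
  define A :: "real^2 \<Rightarrow> real^2" where
    "A v = vector [cos \<beta> * v $ 1 - \<sigma> * sin \<beta> * v $ 2, sin \<beta> * v $ 1 + \<sigma> * cos \<beta> * v $ 2]" for v
  have A: "orthogonal_transformation A"
    unfolding orthogonal_transformation_def
  proof
    show "linear A" by (rule linearI) (simp_all add: A_def vec_eq_iff forall_2 algebra_simps)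
    show "\<forall>v w. A v \<bullet> A w = v \<bullet> w"
    proof (intro allI)
      fix v w
      have "\<sigma> * \<sigma> = 1" using \<sigma> by auto
      moreover have "cos \<beta> * cos \<beta> + sin \<beta> * sin \<beta> = 1" by (simp add: sin_cos_squared_add3)
      ultimately show "A v \<bullet> A w = v \<bullet> w"
        unfolding A_def inner_vec_def sum_2 vector_2 inner_real_def by algebra
    qed
  qed
  define f where "f x = (1 / c) *\<^sub>R A x + (\<gamma> 0 - (1 / c) *\<^sub>R A (wave_curve (c * s0) m))" for x
  have sim: "similarity f" unfolding similarity_def f_def using A c
    by (intro exI[of _ "1 / c"] exI[of _ A] exI[of _ "\<gamma> 0 - (1 / c) *\<^sub>R A (wave_curve (c * s0) m)"]) auto
  have hom: "homeomorphism {0..L} {0..c * L} (\<lambda>s. c * s) (\<lambda>s. s / c)"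
    by (rule homeomorphismI) (use c in \<open>auto intro!: continuous_intros simp: field_simps\<close>)
  have curve: "\<gamma> t = f (wave_curve (c * t + c * s0) m)" if t: "t \<in> {0..L}" for t
  proof -
    define C where "C = integral {0..t} (\<lambda>s. cos (wth c m (s0 + s)))"
    define D where "D = integral {0..t} (\<lambda>s. sin (wth c m (s0 + s)))"
    have shift: "integral {0..t} (\<lambda>s. h (wth c m (s0 + s))) = integral {s0..s0 + t} (\<lambda>s. h (wth c m s))" for h :: "real \<Rightarrow> real"
      using integral_shift_real_interval[of 0 s0 t "\<lambda>s. h (wth c m (s0 + s))"] by (simp add: add.commute)
    have C: "C = (wave_curve (c * (s0 + t)) m $ 1 - wave_curve (c * s0) m $ 1) / c"
      unfolding C_def shift using integral_unique[OF integral_cos_wth[OF m, of c s0 "s0 + t"]] c t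
      by (simp add: wave_curve_def diff_divide_distrib)
    have D: "D = (wave_curve (c * (s0 + t)) m $ 2 - wave_curve (c * s0) m $ 2) / c"
      unfolding D_def shift using integral_unique[OF integral_sin_wth[OF m, of c s0 "s0 + t"]] c t
      by (simp add: wave_curve_def cn_def diff_divide_distrib)
    have cw: "continuous_on {0..t} (\<lambda>s. wth c m (s0 + s))"
      by (intro continuous_on_compose2[OF continuous_on_wth[OF m, of UNIV]] continuous_intros) auto
    have i: "(\<lambda>s. a * cos (wth c m (s0 + s))) integrable_on {0..t}"
      "(\<lambda>s. a * sin (wth c m (s0 + s))) integrable_on {0..t}" for a
      by (intro integrable_continuous_real continuous_intros cw)+
    have 1: "integral {0..t} (\<lambda>s. cos (\<theta> s)) = cos \<beta> * C - \<sigma> * sin \<beta> * D"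
    proof -
      have "integral {0..t} (\<lambda>s. cos (\<theta> s)) = integral {0..t} (\<lambda>s. cos \<beta> * cos (wth c m (s0 + s))
          - (\<sigma> * sin \<beta>) * sin (wth c m (s0 + s)))"
        using \<theta> \<sigma> t by (intro integral_cong) (auto simp: cos_add)
      also have "\<dots> = cos \<beta> * C - \<sigma> * sin \<beta> * D"
        by (subst integral_diff[OF i]) (simp add: C_def D_def)
      finally show ?thesis .
    qed
    have 2: "integral {0..t} (\<lambda>s. sin (\<theta> s)) = sin \<beta> * C + \<sigma> * cos \<beta> * D"
    proof -
      have "integral {0..t} (\<lambda>s. sin (\<theta> s)) = integral {0..t} (\<lambda>s. sin \<beta> * cos (wth c m (s0 + s))
          + (\<sigma> * cos \<beta>) * sin (wth c m (s0 + s)))"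
        using \<theta> \<sigma> t by (intro integral_cong) (auto simp: sin_add)
      also have "\<dots> = sin \<beta> * C + \<sigma> * cos \<beta> * D"
        by (subst integral_add[OF i]) (simp add: C_def D_def)
      finally show ?thesis .
    qed
    have e: "c * t + c * s0 = c * (s0 + t)" by (simp add: algebra_simps)
    show ?thesis
      unfolding \<gamma>[OF t] f_def e 1 2 C D
      using c by (simp add: A_def vec_eq_iff forall_2 field_simps)
  qed
  show ?thesis
    unfolding wavelike_elastica_def
    using m sim hom curve c L by (intro conjI exI[of _ f] exI[of _ "c * s0"] exI[of _ "c * L"]
        exI[of _ "\<lambda>s. c * s"] exI[of _ "\<lambda>s. s / c"]) auto
qed

section \<open>Minimality\<close>

lemma ac_on_deriv_nonneg:
  fixes k l :: "real \<Rightarrow> real"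
  assumes ac: "ac_on 0 L k l" and l: "continuous_on {0..L} l" and mono: "mono_on {0..L} k"
    and L: "0 < L" and t: "t \<in> {0..L}"
  shows "0 \<le> l t"
proof (rule ccontr)
  assume neg: "\<not> 0 \<le> l t"
  then obtain d where d: "0 < d" "\<And>s. s \<in> {0..L} \<Longrightarrow> dist s t < d \<Longrightarrow> dist (l s) (l t) < - l t"
    using l t unfolding continuous_on_iff by (metis neg_0_less_iff_less not_le)
  define u where "u = max 0 (t - d/2)"
  define w where "w = min L (t + d/2)"
  have uw: "0 \<le> u" "u < w" "w \<le> L" "t - d < u" "w < t + d"
    using d(1) t L by (auto simp: u_def w_def)
  have "integral {u..w} l < integral {u..w} (\<lambda>_. 0)"
  proof (rule integral_less_real)
    fix s assume "s \<in> {u<..<w}"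
    then have "s \<in> {0..L}" "dist s t < d" using uw by (auto simp: dist_real_def)
    then have "\<bar>l s - l t\<bar> < - l t" using d(2)[of s] by (simp add: dist_real_def)
    then show "l s < 0" by linarith
  qed (use uw in \<open>auto intro: continuous_on_subset[OF l]\<close>)
  then have "k w < k u" using ac_on_increment[OF ac, of u w] uw by simp
  then show False using mono_onD[OF mono, of u w] uw by auto
qed

lemma unit_vector_angle:
  fixes v :: "real^2"
  assumes "norm v = 1"
  obtains a where "v = vector [cos a, sin a]"
proof -
  obtain a where "v $ 1 = cos a" "v $ 2 = sin a"
    using sincos_total_2pi[OF norm_one_components[OF assms]] by metis
  then show thesis using that[of a] by (simp add: vec_eq_iff forall_2)
qed

text \<open>Curvature is determined up to null sets only, so monotonicity and nonconstancy refer to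
  its continuous representative \<open>k\<close>. Curves are total functions whose values off the
  parameter interval are arbitrary, hence uniqueness is asserted on \<open>{0..L}\<close>.\<close>

theorem theorem1p2:
  fixes lam L :: real and \<gamma> :: "real \<Rightarrow> real^2" and k :: "real \<Rightarrow> real"
  assumes "0 < L"
    and "elastica lam L \<gamma>"
    and "is_signed_curvature L \<gamma> k" and "continuous_on {0..L} k"
    and "\<not> k constant_on {0..L}"
    and "mono_on {0..L} k \<or> antimono_on {0..L} k"
    and "\<not> subcritical_wavelike L \<gamma>"
  shows "is_arg_min (modified_energy lam) (\<lambda>c. c \<in> admissible L \<gamma>) (L, \<gamma>) \<and>
    (\<forall>L' \<gamma>'. is_arg_min (modified_energy lam) (\<lambda>c. c \<in> admissible L \<gamma>) (L', \<gamma>') \<longrightarrow>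
       L' = L \<and> (\<forall>s\<in>{0..L}. \<gamma>' s = \<gamma> s))"
proof -
  note L = assms(1) and k = assms(3)
  have \<gamma>: "\<gamma> \<in> W22_arc L" using assms(2) by (simp add: elastica_def)
  obtain a where a: "tangent L \<gamma> 0 = vector [cos a, sin a]"
    using unit_vector_angle[OF norm_tangent[OF \<gamma> L, of 0]] L by auto
  define \<theta> where "\<theta> t = a + integral {0..t} k" for t
  note lift = angle_lift[OF \<gamma> L k a \<theta>_def]
  obtain l where l: "ac_on 0 L k l" "ac_on 0 L l (\<lambda>t. (lam * k t - k t ^ 3) / 2)"
    using elastica_regular[OF L assms(2) k assms(4)] by blast
  note lc = ac_on_continuous[OF l(2)]
  have \<theta>ac: "ac_on 0 L \<theta> k" by (rule h1_on_ac_on[OF lift(1)])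
  obtain p \<beta> where p0: "0 \<le> p"
    and k2: "\<And>t. t \<in> {0..L} \<Longrightarrow> (k t)\<^sup>2 = lam + p * cos (\<theta> t - \<beta>)"
    and l2: "\<And>t. t \<in> {0..L} \<Longrightarrow> 2 * l t = - p * sin (\<theta> t - \<beta>)"
    using elastica_frame[OF \<theta>ac l] by blast
  have nonconst: "\<exists>t\<in>{0..L}. k t \<noteq> k 0"
    using assms(5) unfolding constant_on_def by blast
  have p: "0 < p"
  proof (rule ccontr)
    assume "\<not> 0 < p"
    then have "l t = 0" if "t \<in> {0..L}" for t using l2[OF that] p0 by simp
    then have "integral {0..t} l = integral {0..t} (\<lambda>_. 0)" if "t \<in> {0..L}" for t
      using that by (intro integral_cong) auto
    then have "k t = k 0" if "t \<in> {0..L}" for t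
      using ac_on_increment[OF l(1), of 0 t] that by simp
    then show False using nonconst by blast
  qed
  \<comment> \<open>The sign decides on a reflection across \<open>P\<close>: if \<open>k\<close>
    increases, the sine of the angle is nonpositive, and \<open>\<sigma> = -1\<close> brings the
    angle into the upper half turn.\<close>
  obtain \<sigma> :: real where \<sigma>: "\<sigma> = 1 \<or> \<sigma> = -1" and sgn: "\<And>t. t \<in> {0..L} \<Longrightarrow> 0 \<le> sin (\<sigma> * (\<theta> t - \<beta>))"
  proof (cases "mono_on {0..L} k")
    case True
    have "0 \<le> sin (- 1 * (\<theta> t - \<beta>))" if "t \<in> {0..L}" for t
    proof -
      have "0 \<le> - p * sin (\<theta> t - \<beta>)"
        using ac_on_deriv_nonneg[OF l(1) lc True L that] l2[OF that] by linarith
      then have "sin (\<theta> t - \<beta>) \<le> 0" using p by (simp add: mult_le_0_iff)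
      then show ?thesis by (metis mult_minus1 neg_0_le_iff_le sin_minus)
    qed
    then show ?thesis using that[of "-1"] by simp
  next
    case False
    then have "mono_on {0..L} (\<lambda>t. - k t)"
      using assms(6) by (auto simp: monotone_on_def)
    then have "0 \<le> - l t" if "t \<in> {0..L}" for t
      using ac_on_deriv_nonneg[OF ac_on_minus[OF l(1)] _ _ L that] lc by (simp add: continuous_on_minus)
    then have "0 \<le> p * sin (\<theta> t - \<beta>)" if "t \<in> {0..L}" for t
      using l2[OF that] that by force
    then have "0 \<le> sin (1 * (\<theta> t - \<beta>))" if "t \<in> {0..L}" for t
      using p that by (simp add: zero_le_mult_iff)
    then show ?thesis using that[of 1] by simp
  qed
  have \<sigma>2: "\<sigma> * \<sigma> = 1" using \<sigma> by auto
  have trig: "cos (\<sigma> * x) = cos x" "sin (\<sigma> * x) = \<sigma> * sin x" for x using \<sigma> by auto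
  have "continuous_on {0..L} (\<lambda>t. \<sigma> * (\<theta> t - \<beta>))"
    by (intro continuous_intros ac_on_continuous[OF \<theta>ac])
  from angle_in_half_turn[OF less_imp_le[OF L] this sgn]
  obtain N where N: "\<And>t. t \<in> {0..L} \<Longrightarrow> \<sigma> * (\<theta> t - \<beta>) - 2 * pi * of_int N \<in> {0..pi}" by blast
  \<comment> \<open>The angle measured from \<open>P\<close>, reflected according to
    \<open>\<sigma>\<close> and reduced by full turns. It is applied to both curves, so their
    constraints transform alike.\<close>
  define rel where "rel x = \<sigma> * (x - \<beta>) - 2 * pi * of_int N" for x
  have rel_trig: "cos (rel x) = cos (x - \<beta>)" "sin (rel x) = \<sigma> * sin (x - \<beta>)" for x
    using cos_int_2pin[of N] sin_int_2pin[of N] by (simp_all add: rel_def cos_diff[of "\<sigma> * _"] sin_diff[of "\<sigma> * _"] trig)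
  have rel_inj: "x = y" if "rel x = rel y" for x y using that \<sigma> by (auto simp: rel_def)
  have rel_h1: "h1_on 0 b (\<lambda>t. rel (u t)) (\<lambda>t. \<sigma> * v t)" if "h1_on 0 b u v" for b u v
  proof -
    have "h1_on 0 b (\<lambda>t. \<sigma> * u t) (\<lambda>t. \<sigma> * v t)" using that h1_on_minus[OF that] \<sigma> by auto
    then show ?thesis
      using ac_on_add_const[of 0 b "\<lambda>t. \<sigma> * u t" "\<lambda>t. \<sigma> * v t" "- \<sigma> * \<beta> - 2 * pi * of_int N"]
      by (simp add: h1_on_def rel_def algebra_simps)
  qed
  have rel_int: "integral {0..b} (\<lambda>t. cos (rel (u t))) =
        cos \<beta> * integral {0..b} (\<lambda>t. cos (u t)) + sin \<beta> * integral {0..b} (\<lambda>t. sin (u t))"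
      "integral {0..b} (\<lambda>t. sin (rel (u t))) =
        \<sigma> * (cos \<beta> * integral {0..b} (\<lambda>t. sin (u t)) - sin \<beta> * integral {0..b} (\<lambda>t. cos (u t)))"
    if "h1_on 0 b u v" for b u v
  proof -
    have cu: "continuous_on {0..b} u" by (rule ac_on_continuous[OF h1_on_ac_on[OF that]])
    have i: "(\<lambda>t. c * cos (u t)) integrable_on {0..b}" "(\<lambda>t. c * sin (u t)) integrable_on {0..b}" for c
      by (intro integrable_continuous_real continuous_intros cu)+
    have "integral {0..b} (\<lambda>t. cos (rel (u t))) = integral {0..b} (\<lambda>t. cos \<beta> * cos (u t) + sin \<beta> * sin (u t))"
      by (simp add: rel_trig cos_diff mult.commute)
    also have "\<dots> = cos \<beta> * integral {0..b} (\<lambda>t. cos (u t)) + sin \<beta> * integral {0..b} (\<lambda>t. sin (u t))"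
      by (subst integral_add[OF i]) simp
    finally show "integral {0..b} (\<lambda>t. cos (rel (u t))) =
        cos \<beta> * integral {0..b} (\<lambda>t. cos (u t)) + sin \<beta> * integral {0..b} (\<lambda>t. sin (u t))" .
    have "integral {0..b} (\<lambda>t. sin (rel (u t))) = integral {0..b} (\<lambda>t. \<sigma> * (cos \<beta> * sin (u t) - sin \<beta> * cos (u t)))"
      by (simp add: rel_trig sin_diff mult.commute)
    also have "\<dots> = \<sigma> * (integral {0..b} (\<lambda>t. cos \<beta> * sin (u t)) - integral {0..b} (\<lambda>t. sin \<beta> * cos (u t)))"
      by (simp add: integral_diff[OF i(2,1)])
    finally show "integral {0..b} (\<lambda>t. sin (rel (u t))) =
        \<sigma> * (cos \<beta> * integral {0..b} (\<lambda>t. sin (u t)) - sin \<beta> * integral {0..b} (\<lambda>t. cos (u t)))" by simp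
  qed
  define \<alpha> where "\<alpha> t = rel (\<theta> t)" for t
  define \<kappa> where "\<kappa> t = \<sigma> * k t" for t
  have \<alpha>1: "ac_on 0 L \<alpha> \<kappa>"
    unfolding \<alpha>_def \<kappa>_def by (rule h1_on_ac_on[OF rel_h1[OF lift(1)]])
  have \<alpha>2: "ac_on 0 L \<kappa> (\<lambda>t. - (p / 2) * sin (\<alpha> t))"
    unfolding \<kappa>_def
  proof (rule ac_on_cong[OF ac_on_cmult[OF l(1), of \<sigma>]])
    fix t assume "0 < t" "t < L"
    then have "l t = - (p / 2) * sin (\<theta> t - \<beta>)" using l2[of t] by simp
    then show "- (p / 2) * sin (\<alpha> t) = \<sigma> * l t" by (simp add: \<alpha>_def rel_trig)
  qed simp
  have ode: "(\<kappa> t)\<^sup>2 = lam + p * cos (\<alpha> t)" if "t \<in> {0..L}" for t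
    using k2[OF that] \<sigma> by (auto simp: \<kappa>_def \<alpha>_def rel_trig)
  have rng: "\<alpha> t \<in> {0..pi}" if "t \<in> {0..L}" for t
    using N[OF that] by (simp add: \<alpha>_def rel_def)
  have nonconst': "\<exists>t\<in>{0..L}. \<kappa> t \<noteq> \<kappa> 0" using nonconst \<sigma> by (auto simp: \<kappa>_def)
  have sub: "ellW m \<le> 0"
    if m: "0 < m" "m < 1" "0 < c" and w: "\<And>t. t \<in> {0..L} \<Longrightarrow> \<alpha> t = wth c m (s0 + t)" for m c s0
  proof (rule ccontr)
    assume "\<not> ellW m \<le> 0"
    then have "m < m0" using ellW_pos_imp_less_m0 m by simp
    moreover have "wavelike_elastica m L \<gamma>"
    proof (rule wavelike_if_angle[OF m L \<sigma> lift(3)])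
      fix t assume "t \<in> {0..L}"
      have "\<sigma> * rel (\<theta> t) = \<theta> t - \<beta> - \<sigma> * (2 * pi * of_int N)"
        unfolding rel_def right_diff_distrib mult.assoc[symmetric] \<sigma>2 by simp
      then show "\<theta> t = (\<beta> + \<sigma> * (2 * pi * of_int N)) + \<sigma> * wth c m (s0 + t)"
        unfolding w[OF \<open>t \<in> {0..L}\<close>, symmetric] \<alpha>_def by simp
    qed
    ultimately show False using assms(7) by (auto simp: subcritical_wavelike_def)
  qed
  have sq: "path_energy lam b (\<lambda>t. \<sigma> * v t) = path_energy lam b v" for b v
    using \<sigma> by (auto simp: path_energy_def power_mult_distrib)
  have E: "modified_energy lam (L, \<gamma>) = path_energy lam L k"
    using bending_energy_eq[OF \<gamma> L k] by (simp add: modified_energy_def path_energy_def)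
  have min: "modified_energy lam (L, \<gamma>) \<le> modified_energy lam (M, \<eta>) \<and>
      (modified_energy lam (M, \<eta>) \<le> modified_energy lam (L, \<gamma>) \<longrightarrow> M = L \<and> (\<forall>s\<in>{0..L}. \<eta> s = \<gamma> s))"
    if adm: "(M, \<eta>) \<in> admissible L \<gamma>" for M \<eta>
  proof -
    have M: "0 < M" and \<eta>: "\<eta> \<in> W22_arc M" "\<eta> 0 = \<gamma> 0" "\<eta> M = \<gamma> L"
      and T: "tangent M \<eta> 0 = tangent L \<gamma> 0" "tangent M \<eta> M = tangent L \<gamma> L"
      using adm by (auto simp: admissible_def)
    obtain j where j: "is_signed_curvature M \<eta> j" using signed_curvature_exists[OF \<eta>(1) M] by blast
    define \<psi> where "\<psi> t = a + integral {0..t} j" for t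
    note lift' = angle_lift[OF \<eta>(1) M j T(1)[unfolded a] \<psi>_def]
    have "cos (\<psi> M) = cos (\<theta> L)" "sin (\<psi> M) = sin (\<theta> L)"
      using T(2) lift'(2)[of M] lift(2)[of L] M L by (auto simp: vec_eq_iff forall_2)
    \<comment> \<open>Equal end tangents determine the final angle up to full turns.\<close>
    then obtain n where n: "\<psi> M = \<theta> L + 2 * pi * of_int n"
      using sin_cos_eq_iff[of "\<psi> M" "\<theta> L"] by blast
    have C: "integral {0..M} (\<lambda>s. cos (\<psi> s)) = integral {0..L} (\<lambda>s. cos (\<theta> s))"
      and S: "integral {0..M} (\<lambda>s. sin (\<psi> s)) = integral {0..L} (\<lambda>s. sin (\<theta> s))"
      using lift'(3)[of M] lift(3)[of L] M L \<eta> by (auto simp: vec_eq_iff forall_2)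
    obtain n' :: int where n': "\<sigma> * of_int n = of_int n'"
      using \<sigma> by (metis mult_1 mult_minus1 of_int_minus)
    have main: "path_energy lam L \<kappa> \<le> path_energy lam M (\<lambda>t. \<sigma> * j t) \<and>
      (path_energy lam M (\<lambda>t. \<sigma> * j t) \<le> path_energy lam L \<kappa> \<longrightarrow>
        M = L \<and> (\<forall>t\<in>{0..L}. rel (\<psi> t) = \<alpha> t))"
    proof (rule pendulum_minimal[OF L M p \<alpha>1 \<alpha>2 ode rng nonconst' sub rel_h1[OF lift'(1)]])
      show "rel (\<psi> 0) = \<alpha> 0" by (simp add: \<alpha>_def \<psi>_def \<theta>_def)
      show "rel (\<psi> M) = \<alpha> L + 2 * pi * of_int n'"
        by (simp add: \<alpha>_def rel_def n algebra_simps flip: n')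
      show "integral {0..M} (\<lambda>t. cos (rel (\<psi> t))) = integral {0..L} (\<lambda>t. cos (\<alpha> t))"
        unfolding \<alpha>_def rel_int[OF lift'(1)] rel_int[OF lift(1)] C S ..
      show "integral {0..M} (\<lambda>t. sin (rel (\<psi> t))) = integral {0..L} (\<lambda>t. sin (\<alpha> t))"
        unfolding \<alpha>_def rel_int[OF lift'(1)] rel_int[OF lift(1)] C S ..
    qed
    have Em: "modified_energy lam (M, \<eta>) = path_energy lam M j"
      using bending_energy_eq[OF \<eta>(1) M j] by (simp add: modified_energy_def path_energy_def)
    have Ek: "path_energy lam L \<kappa> = path_energy lam L k"
      unfolding \<kappa>_def by (rule sq)
    have "\<eta> s = \<gamma> s"
      if eq: "M = L" "\<forall>t\<in>{0..L}. rel (\<psi> t) = \<alpha> t" and s: "s \<in> {0..L}" for s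
    proof -
      have "\<psi> t = \<theta> t" if "t \<in> {0..L}" for t
        using rel_inj[of "\<psi> t" "\<theta> t"] eq(2) that by (simp add: \<alpha>_def)
      then have "integral {0..s} (\<lambda>t. cos (\<psi> t)) = integral {0..s} (\<lambda>t. cos (\<theta> t))"
        "integral {0..s} (\<lambda>t. sin (\<psi> t)) = integral {0..s} (\<lambda>t. sin (\<theta> t))"
        using s by (auto intro!: integral_cong)
      then show ?thesis using lift'(3)[of s] lift(3)[OF s] s eq(1) \<eta>(2) by simp
    qed
    then show ?thesis using main unfolding E Em Ek sq by blast
  qed
  have adm: "(L, \<gamma>) \<in> admissible L \<gamma>" using L \<gamma> by (simp add: admissible_def)
  have "is_arg_min (modified_energy lam) (\<lambda>c. c \<in> admissible L \<gamma>) (L, \<gamma>)"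
    unfolding is_arg_min_def using adm min by (auto simp: not_less)
  moreover have "M = L \<and> (\<forall>s\<in>{0..L}. \<eta> s = \<gamma> s)"
    if "is_arg_min (modified_energy lam) (\<lambda>c. c \<in> admissible L \<gamma>) (M, \<eta>)" for M \<eta>
    using that adm min[of M \<eta>] unfolding is_arg_min_def by (auto simp: not_less)
  ultimately show ?thesis by blast
qed

end
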